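(* Let the integral system $S[R_1,R_2]$ be singular at $b$. Then the following statements are equivalent: (LP) The system $S[R_1,R_2]$ is in the limit point case at $b$. (D) The system $S[R_1,R_2]$ has the Dirichlet property: $\int_0^b|u_2(t)|^2\,dR_1(t)<\infty$ for every $(u_1,u_2,f)\in\mathcal{T}$. (SLP$^*$) For every $(u_1,u_2,f)\in\mathcal{T}$ one has $\lim_{x\to b}u_1(x)u_2(x)=0$. (SLP) The system $S[R_1,R_2]$ is in the strong limit point case: $\lim_{x\to b}u_1(x)v_2(x)=0$ for all $(u_1,u_2,f),(v_1,v_2,g)\in\mathcal{T}$.
   Context: **Integral systems.** Let $0<b\le\infty$ and let $R_1,R_2:[0,b)\to\mathbb{R}$ be nondecreasing left-continuous functions with $R_1(0)=R_2(0)=0$; put $R_j(b):=\lim_{x\to b}R_j(x)\in[0,\infty]$. $dR_j$ is the Lebesgue-Stieltjes measure of $R_j$ on $[0,b)$. Convention: $\int_a^x f\,d\sigma:=\int_{[a,x)}f\,d\sigma$. The integral system $S[R_1,R_2]$ with spectral parameter $\lambda\in\mathbb{C}$ is $$u_1(x)=u_1(0)+\int_0^x u_2\,dR_1,\qquad u_2(x)=u_2(0)-\lambda\int_0^x u_1\,dR_2,\qquad x\in[0,b).$$ The system is regular (at $b$) if $R_1(b)+R_2(b)<\infty$, and singular otherwise. **Standing assumptions.** $R_1$ and $R_2$ have no common points of discontinuity; and there is an interval $[0,b_0)\subseteq[0,b)$ such that the classes of $1$ and $R_1$ in $L^2(R_2,[0,b_0))$ are linearly independent. **Maximal relation, limit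 point case.** $\mathcal{L}^2(R_2)$ is the space of complex functions with $\int_{[0,b)}|f|^2dR_2<\infty$, $L^2(R_2)$ is its quotient modulo $dR_2$-a.e. equality, with quotient map $\pi$. $\mathcal{T}$ is the set of triples $(u_1,u_2,f)$ with $f,u_1\in\mathcal{L}^2(R_2)$ and $$u_1(x)=u_1(0)+\int_0^xu_2\,dR_1,\qquad u_2(x)=u_2(0)-\int_0^xf\,dR_2\qquad\text{for all }x\in[0,b).$$ $T_{\max}=\{[\pi u_1\ \pi f]^T:(u_1,u_2,f)\in\mathcal{T}\}$ is a linear relation in $L^2(R_2)$ (a subspace of $L^2(R_2)\times L^2(R_2)$). For $\lambda\in\mathbb{C}\setminus\mathbb{R}$, the system is called limit point at $b$ if $\dim\ker(T_{\max}-\lambda I)=1$ and limit circle at $b$ if $\dim\ker(T_{\max}-\lambda I)=2$ (one of the two holds, independently of $\lambda$). Here $\ker(T-\lambda I)=\{u:[u\ \lambda u]^T\in T\}$. *)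

theory Defs
  imports "HOL-Analysis.Analysis" "Jordan_Normal_Form.VS_Connect"
begin

section \<open>The interval \<open>[0,b)\<close> and its right end\<close>

definition Ico0 :: "ereal \<Rightarrow> real set" where
  "Ico0 b = {x. 0 \<le> x \<and> ereal x < b}"

(* \<open>x \<rightarrow> b\<close> from the left, as a filter on the reals; for \<open>b = \<infinity>\<close> it is at_top *)
definition to_end :: "ereal \<Rightarrow> real filter" where
  "to_end b = filtercomap ereal (at_left b)"

section \<open>Lebesgue--Stieltjes measures of left-continuous functions\<close>

definition LS_measure :: "ereal \<Rightarrow> (real \<Rightarrow> real) \<Rightarrow> real measure" where
  "LS_measure b R =
     extend_measure (Ico0 b) {(x, y). x \<in> Ico0 b \<and> y \<in> Ico0 b \<and> x \<le> y}
       (\<lambda>(x, y). {x..<y}) (\<lambda>(x, y). ennreal (R y - R x))"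

locale LS_function =
  fixes b :: ereal and R :: "real \<Rightarrow> real"
  assumes mono: "mono_on (Ico0 b) R"
    and left_cont: "\<And>x. x \<in> Ico0 b \<Longrightarrow> 0 < x \<Longrightarrow> continuous (at_left x) R"
    and at_0: "R 0 = 0"

lemma Ico0_downward: "y \<in> Ico0 b \<Longrightarrow> 0 \<le> x \<Longrightarrow> x \<le> y \<Longrightarrow> x \<in> Ico0 b"
  unfolding Ico0_def using order_le_less_trans[of "ereal x" "ereal y" b] by auto

lemma Ico_subset_Ico0: "x \<in> Ico0 b \<Longrightarrow> y \<in> Ico0 b \<Longrightarrow> {x..<y} \<subseteq> Ico0 b"
  using Ico0_downward[of y b] by (auto simp: Ico0_def)

lemma space_LS_measure [simp]: "space (LS_measure b R) = Ico0 b"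
  unfolding LS_measure_def
  by (rule space_extend_measure) (use Ico_subset_Ico0 in fastforce)

(* The measure exists: it is the push-forward of Lebesgue measure under the generalized inverse
   of R, so extend_measure is not in its default case. *)
context LS_function
begin

definition levels :: "real set" where "levels = {t. 0 \<le> t \<and> (\<exists>y\<in>Ico0 b. t < R y)}"

definition rinv :: "real \<Rightarrow> real" where "rinv t = Sup {x \<in> Ico0 b. R x \<le> t}"

lemma levels_borel: "levels \<in> sets borel"
proof -
  have "levels = {0..} \<inter> (\<Union>y\<in>Ico0 b. {..<R y})" by (auto simp: levels_def)
  then show ?thesis by (simp add: sets.Int borel_open open_UN)
qed

lemma rinv_galois:
  assumes t: "t \<in> levels"
  shows "rinv t \<in> Ico0 b" and "x \<in> Ico0 b \<Longrightarrow> x \<le> rinv t \<longleftrightarrow> R x \<le> t"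
proof -
  let ?S = "{x \<in> Ico0 b. R x \<le> t}"
  obtain y where y: "y \<in> Ico0 b" "t < R y" and t0: "0 \<le> t" using t by (auto simp: levels_def)
  have 0: "0 \<in> ?S" using Ico0_downward[OF y(1), of 0] y(1) t0 at_0 by (auto simp: Ico0_def)
  have ub: "w \<le> z" if "z \<in> Ico0 b" "t < R z" "w \<in> ?S" for z w
    using that mono by (fastforce simp: mono_on_def not_le[symmetric])
  have bdd: "bdd_above ?S" using ub[OF y] by (auto simp: bdd_above_def)
  have "rinv t \<le> y" unfolding rinv_def using 0 ub[OF y] by (intro cSup_least) auto
  moreover have "0 \<le> rinv t" unfolding rinv_def by (rule cSup_upper[OF 0 bdd])
  ultimately show "rinv t \<in> Ico0 b" using Ico0_downward[OF y(1)] by auto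
  assume x: "x \<in> Ico0 b"
  show "x \<le> rinv t \<longleftrightarrow> R x \<le> t"
  proof
    assume "R x \<le> t"
    then show "x \<le> rinv t" unfolding rinv_def using x by (intro cSup_upper bdd) auto
  next
    assume le: "x \<le> rinv t"
    show "R x \<le> t"
    proof (rule ccontr)
      assume n: "\<not> R x \<le> t"
      have x0: "0 < x" using x n at_0 t0 by (cases "x = 0") (auto simp: Ico0_def)
      have "(R \<longlongrightarrow> R x) (at_left x)"
        using left_cont[OF x x0] by (simp add: continuous_within)
      then have "eventually (\<lambda>z. t < R z) (at_left x)"
        using n by (intro order_tendstoD) auto
      moreover have "eventually (\<lambda>z. z \<in> {0<..<x}) (at_left x)"
        by (rule eventually_at_leftI[OF _ x0]) auto
      ultimately have "eventually (\<lambda>z. t < R z \<and> z \<in> {0<..<x}) (at_left x)"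
        by eventually_elim auto
      then obtain z where z: "t < R z" "0 < z" "z < x"
        using eventually_happens[of _ "at_left x"] trivial_limit_at_left_real by fastforce
      then have zI: "z \<in> Ico0 b" using Ico0_downward[OF x, of z] by auto
      have "rinv t \<le> z" unfolding rinv_def using 0 ub[OF zI z(1)] by (intro cSup_least) auto
      then show False using le z by simp
    qed
  qed
qed

lemma emeasure_LS_measure:
  assumes xy: "x \<in> Ico0 b" "y \<in> Ico0 b" "x \<le> y"
  shows "emeasure (LS_measure b R) {x..<y} = ennreal (R y - R x)"
proof -
  let ?I = "{(x, y). x \<in> Ico0 b \<and> y \<in> Ico0 b \<and> x \<le> y}"
  let ?G = "\<lambda>(x, y). {x..<y::real}"
  have sub: "?G ` ?I \<subseteq> Pow (Ico0 b)" using Ico_subset_Ico0 by fastforce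
  define N where "N = sigma (Ico0 b) (?G ` ?I)"
  define M where "M = restrict_space lborel levels"
  have sN: "space N = Ico0 b" "sets N = sigma_sets (Ico0 b) (?G ` ?I)"
    using sub by (auto simp: N_def)
  have sM: "space M = levels" "levels \<in> sets lborel" using levels_borel by (auto simp: M_def)
  have vim: "rinv -` {x..<y} \<inter> levels = {R x..<R y}" if "x \<in> Ico0 b" "y \<in> Ico0 b" for x y
  proof -
    have "0 \<le> R x"
      using mono_onD[OF mono _ that(1), of 0] Ico0_downward[OF that(1), of 0] that(1) at_0
      by (auto simp: Ico0_def)
    then have "{R x..<R y} \<subseteq> levels" using that(2) by (auto simp: levels_def)
    then show ?thesis
      using rinv_galois(2)[OF _ that(1)] rinv_galois(2)[OF _ that(2)] by (auto simp: not_le[symmetric])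
  qed
  have meas: "rinv \<in> measurable M N"
    unfolding N_def
  proof (rule measurable_measure_of[OF sub])
    show "rinv \<in> space M \<rightarrow> Ico0 b" using rinv_galois(1) by (auto simp: sM)
    fix A assume "A \<in> ?G ` ?I"
    then obtain x y where A: "A = {x..<y}" "x \<in> Ico0 b" "y \<in> Ico0 b" by auto
    have "rinv -` A \<inter> space M = {R x..<R y}" using vim A by (simp add: sM)
    moreover from this have "{R x..<R y} \<subseteq> levels" by (auto simp: sM)
    ultimately show "rinv -` A \<inter> space M \<in> sets M"
      by (auto simp: M_def sets_restrict_space_iff levels_borel)
  qed
  have val: "emeasure (distr M N rinv) {x..<y} = ennreal (R y - R x)"
    if "x \<in> Ico0 b" "y \<in> Ico0 b" "x \<le> y" for x y
  proof -
    have s: "{x..<y} \<in> sets N" using that by (auto simp: sN)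
    have le: "R x \<le> R y" using mono that by (auto simp: mono_on_def)
    have "{R x..<R y} \<subseteq> levels" using vim[OF that(1,2)] by auto
    then show ?thesis
      using le by (simp add: emeasure_distr[OF meas s] sM vim[OF that(1,2)])
         (simp add: M_def emeasure_restrict_space levels_borel)
  qed
  have sets_eq: "sets (LS_measure b R) = sets (distr M N rinv)"
    unfolding LS_measure_def by (simp add: sets_extend_measure[OF sub] sN)
  have "emeasure (LS_measure b R) (?G (x, y)) = (\<lambda>(x, y). ennreal (R y - R x)) (x, y)"
  proof (rule emeasure_extend_measure[OF LS_measure_def, where \<mu>' = "emeasure (distr M N rinv)"])
    show "emeasure (distr M N rinv) (?G i) = (\<lambda>(x, y). ennreal (R y - R x)) i" if "i \<in> ?I" for i
      using that val by auto
    show "?G ` ?I \<subseteq> Pow (Ico0 b)" by (rule sub)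
    show "positive (sets (LS_measure b R)) (emeasure (distr M N rinv))"
      by (simp add: positive_def)
    show "countably_additive (sets (LS_measure b R)) (emeasure (distr M N rinv))"
      unfolding sets_eq by (rule countably_additiveI) (simp add: suminf_emeasure)
    show "(x, y) \<in> ?I" using xy by simp
  qed
  then show ?thesis by simp
qed

end

section \<open>The space \<open>L\<^sup>2(M)\<close> of classes\<close>

definition sq_integrable :: "real measure \<Rightarrow> (real \<Rightarrow> complex) set" where
  "sq_integrable M = {f \<in> borel_measurable M. (\<integral>\<^sup>+x. ennreal ((cmod (f x))\<^sup>2) \<partial>M) < \<infinity>}"

definition ae_rel :: "real measure \<Rightarrow> ((real \<Rightarrow> complex) \<times> (real \<Rightarrow> complex)) set" where
  "ae_rel M = {(f, h). f \<in> sq_integrable M \<and> h \<in> sq_integrable M \<and> (AE x in M. f x = h x)}"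

definition L2_class :: "real measure \<Rightarrow> (real \<Rightarrow> complex) \<Rightarrow> (real \<Rightarrow> complex) set" where
  "L2_class M f = ae_rel M `` {f}"

(* The module record has to supply a ring multiplication and a unit; vector spaces never use them. *)
definition L2 :: "real measure \<Rightarrow> (complex, (real \<Rightarrow> complex) set) module" where
  "L2 M = \<lparr> carrier = sq_integrable M // ae_rel M,
            mult = undefined, one = undefined,
            zero = L2_class M (\<lambda>_. 0),
            add = (\<lambda>X Y. \<Union>f\<in>X. \<Union>h\<in>Y. L2_class M (\<lambda>x. f x + h x)),
            smult = (\<lambda>c X. \<Union>f\<in>X. L2_class M (\<lambda>x. c * f x)) \<rparr>"

section \<open>Integral systems\<close>

locale integral_system =
  fixes b :: ereal and R1 R2 :: "real \<Rightarrow> real"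
  assumes b_pos: "0 < b"
    and R1: "LS_function b R1"
    and R2: "LS_function b R2"
    and no_common_discontinuity:
      "\<And>x. x \<in> Ico0 b \<Longrightarrow>
        continuous (at x within Ico0 b) R1 \<or> continuous (at x within Ico0 b) R2"
    and one_R1_independent:
      "\<exists>b0. 0 < b0 \<and> b0 \<le> b \<and>
        (let M = LS_measure b0 R2; u = (\<lambda>_. 1); v = (\<lambda>x. complex_of_real (R1 x)) in
          u \<in> sq_integrable M \<and> v \<in> sq_integrable M \<and>
          (\<forall>\<alpha> \<beta>. \<alpha> \<odot>\<^bsub>L2 M\<^esub> L2_class M u \<oplus>\<^bsub>L2 M\<^esub> \<beta> \<odot>\<^bsub>L2 M\<^esub> L2_class M v = \<zero>\<^bsub>L2 M\<^esub> \<longrightarrow>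
            \<alpha> = 0 \<and> \<beta> = 0))"

definition end_value :: "ereal \<Rightarrow> (real \<Rightarrow> real) \<Rightarrow> ereal" where
  "end_value b R = Lim (to_end b) (\<lambda>x. ereal (R x))"

definition regular_at_end :: "ereal \<Rightarrow> (real \<Rightarrow> real) \<Rightarrow> (real \<Rightarrow> real) \<Rightarrow> bool" where
  "regular_at_end b R1 R2 \<longleftrightarrow> end_value b R1 + end_value b R2 < \<infinity>"

definition singular_at_end :: "ereal \<Rightarrow> (real \<Rightarrow> real) \<Rightarrow> (real \<Rightarrow> real) \<Rightarrow> bool" where
  "singular_at_end b R1 R2 \<longleftrightarrow> \<not> regular_at_end b R1 R2"

(* Both integrals exist automatically: f is square integrable and dR2 is finite on {0..<x},
   hence u2 is left-continuous and bounded on {0..<x}, where dR1 is finite. *)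
definition triples ::
    "ereal \<Rightarrow> (real \<Rightarrow> real) \<Rightarrow> (real \<Rightarrow> real) \<Rightarrow>
      ((real \<Rightarrow> complex) \<times> (real \<Rightarrow> complex) \<times> (real \<Rightarrow> complex)) set" where
  "triples b R1 R2 = {(u1, u2, f).
     f \<in> sq_integrable (LS_measure b R2) \<and> u1 \<in> sq_integrable (LS_measure b R2) \<and>
     (\<forall>x\<in>Ico0 b. u1 x = u1 0 + (LINT t:{0..<x}|LS_measure b R1. u2 t)) \<and>
     (\<forall>x\<in>Ico0 b. u2 x = u2 0 - (LINT t:{0..<x}|LS_measure b R2. f t))}"

definition T_max ::
    "ereal \<Rightarrow> (real \<Rightarrow> real) \<Rightarrow> (real \<Rightarrow> real) \<Rightarrow>
      ((real \<Rightarrow> complex) set \<times> (real \<Rightarrow> complex) set) set" where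
  "T_max b R1 R2 = {(L2_class (LS_measure b R2) u1, L2_class (LS_measure b R2) f) | u1 u2 f.
     (u1, u2, f) \<in> triples b R1 R2}"

definition ker_shift ::
    "real measure \<Rightarrow> ((real \<Rightarrow> complex) set \<times> (real \<Rightarrow> complex) set) set \<Rightarrow> complex \<Rightarrow>
      (real \<Rightarrow> complex) set set" where
  "ker_shift M S z = {u \<in> carrier (L2 M). (u, z \<odot>\<^bsub>L2 M\<^esub> u) \<in> S}"

(* vectorspace.dim is a LEAST over the sizes of finite generating sets, so it means something
   only together with fin_dim. *)
definition has_dim :: "(complex, 'v) module \<Rightarrow> 'v set \<Rightarrow> nat \<Rightarrow> bool" where
  "has_dim V W n \<longleftrightarrow>
     vectorspace.fin_dim class_ring (V\<lparr>carrier := W\<rparr>) \<and>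
     vectorspace.dim class_ring (V\<lparr>carrier := W\<rparr>) = n"

definition limit_point :: "ereal \<Rightarrow> (real \<Rightarrow> real) \<Rightarrow> (real \<Rightarrow> real) \<Rightarrow> bool" where
  "limit_point b R1 R2 \<longleftrightarrow>
     (\<forall>z. z \<notin> \<real> \<longrightarrow>
       has_dim (L2 (LS_measure b R2)) (ker_shift (LS_measure b R2) (T_max b R1 R2) z) 1)"

definition Dirichlet_property :: "ereal \<Rightarrow> (real \<Rightarrow> real) \<Rightarrow> (real \<Rightarrow> real) \<Rightarrow> bool" where
  "Dirichlet_property b R1 R2 \<longleftrightarrow>
     (\<forall>(u1, u2, f) \<in> triples b R1 R2.
       (\<integral>\<^sup>+t. ennreal ((cmod (u2 t))\<^sup>2) \<partial>LS_measure b R1) < \<infinity>)"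

definition strong_limit_point_diag :: "ereal \<Rightarrow> (real \<Rightarrow> real) \<Rightarrow> (real \<Rightarrow> real) \<Rightarrow> bool" where
  "strong_limit_point_diag b R1 R2 \<longleftrightarrow>
     (\<forall>(u1, u2, f) \<in> triples b R1 R2. ((\<lambda>x. u1 x * u2 x) \<longlongrightarrow> 0) (to_end b))"

definition strong_limit_point :: "ereal \<Rightarrow> (real \<Rightarrow> real) \<Rightarrow> (real \<Rightarrow> real) \<Rightarrow> bool" where
  "strong_limit_point b R1 R2 \<longleftrightarrow>
     (\<forall>(u1, u2, f) \<in> triples b R1 R2. \<forall>(v1, v2, h) \<in> triples b R1 R2.
       ((\<lambda>x. u1 x * v2 x) \<longlongrightarrow> 0) (to_end b))"

end

theory Submission
  imports Defs
begin

text \<open>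
  Why the theorem is true. Everything reduces to one growth condition, called
  \<open>limit_circle_growth\<close> below: \<open>R\<^sub>1\<close> is unbounded and \<open>R\<^sub>1 \<in> L\<^sup>2(R\<^sub>2)\<close>. For a singular system this
  says that both solutions \<open>1\<close> and \<open>R\<^sub>1\<close> for \<open>\<lambda> = 0\<close> are square integrable. Each of the four
  properties is equivalent to its negation.

  The tool is integration by parts for two measures without common atoms (\<open>product_rule\<close>), which
  gives Green's formula
  \<open>u\<^sub>1 v\<^sub>2 = u\<^sub>1(0) v\<^sub>2(0) - \<integral> u\<^sub>1 g dR\<^sub>2 + \<integral> u\<^sub>2 v\<^sub>2 dR\<^sub>1\<close> on every \<open>[0,x)\<close>.
  The first integral always converges at \<open>b\<close>, so \<open>u\<^sub>1 v\<^sub>2\<close> has a limit as soon as the Dirichlet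
  integrals converge, while a divergent Dirichlet integral makes \<open>\<bar>u\<^sub>1 u\<^sub>2\<bar>\<close> large near \<open>b\<close>.

  A product \<open>f G\<close> cannot stay away from \<open>0\<close> if \<open>f\<close> and \<open>dG/dR\<close> are in \<open>L\<^sup>2(R)\<close> and \<open>R\<close> is unbounded:
  by Cauchy--Schwarz \<open>\<bar>G\<bar>\<^sup>2 \<le> C R\<close>, hence \<open>\<bar>f\<bar>\<^sup>2 \<ge> c / R\<close>, but \<open>\<integral> dR / R\<close> diverges. If instead \<open>R(b)\<close>
  is finite and \<open>G\<close> tends to \<open>0\<close>, the same works with \<open>R(b) - R\<close> in place of \<open>R\<close>
  (\<open>product_small_if_infinite\<close>, \<open>product_small_if_vanishing\<close>). This has two consequences.
  First, the Dirichlet property forces \<open>u\<^sub>1 v\<^sub>2 \<longlongrightarrow> 0\<close>: use \<open>R = R\<^sub>2\<close>, \<open>f = u\<^sub>1\<close>, \<open>G = v\<^sub>2\<close> or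
  \<open>R = R\<^sub>1\<close>, \<open>f = v\<^sub>2\<close>, \<open>G = u\<^sub>1\<close>, according to which of the two functions is unbounded
  (\<open>product_tendsto_0\<close>). Secondly, a divergent Dirichlet integral is possible only if \<open>R\<^sub>2\<close> is
  bounded and \<open>u\<^sub>2\<close> has a nonzero limit; then \<open>u\<^sub>1\<close> grows like \<open>R\<^sub>1\<close>, so that \<open>R\<^sub>1 \<in> L\<^sup>2(R\<^sub>2)\<close>
  (\<open>dirichlet_integral_finite\<close>). Conversely, under the growth condition \<open>(R\<^sub>1, 1, 0)\<close> belongs to
  \<open>\<T>\<close> and violates the diagonal strong limit point property. This closes the cycle of the negated
  growth condition, (D), (SLP) and (SLP*).

  It remains to treat (LP). Suppose that the growth condition fails, and let \<open>\<lambda>\<close> be nonreal. Green's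
  formula for \<open>u\<close> and its conjugate, without boundary term at \<open>b\<close>, shows that a square integrable
  solution with \<open>u\<^sub>2(0) = 0\<close> vanishes, so the kernel is at most one-dimensional. It is nontrivial by
  Weyl's argument: the solutions with normalized initial data and \<open>u\<^sub>2(x) = 0\<close> have square integrals over
  \<open>[0,x)\<close> bounded independently of \<open>x\<close>, and a limit point of their initial data as \<open>x\<close> tends to \<open>b\<close>
  gives a square integrable solution (\<open>weyl_solution_exists\<close>); its class is nonzero because \<open>1\<close> and
  \<open>R\<^sub>1\<close> are independent. If the growth condition holds, then for small imaginary \<open>\<lambda>\<close> all solutions are
  square integrable, as perturbations of the solutions \<open>c\<^sub>1 + c\<^sub>2 R\<^sub>1\<close> for \<open>\<lambda> = 0\<close>, and the kernel is
  two-dimensional (\<open>limit_circle_growth_all_sq\<close>).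
\<close>

section \<open>Approaching the right end\<close>

lemma zero_in_Ico0: "0 < b \<Longrightarrow> 0 \<in> Ico0 b"
  by (simp add: Ico0_def zero_ereal_def[symmetric])

lemma Ico0_nonneg: "x \<in> Ico0 b \<Longrightarrow> 0 \<le> x"
  by (simp add: Ico0_def)

lemma max_in_Ico0: "x \<in> Ico0 b \<Longrightarrow> y \<in> Ico0 b \<Longrightarrow> max x y \<in> Ico0 b"
  by (simp add: max_def)

lemma Ico0_larger:
  assumes "x \<in> Ico0 b"
  obtains y where "y \<in> Ico0 b" "x < y"
proof -
  obtain y where "ereal x < ereal y" "ereal y < b"
    using assms ereal_dense2[of "ereal x" b] by (auto simp: Ico0_def)
  then show ?thesis using that[of y] assms by (auto simp: Ico0_def)
qed

text \<open>Both the finite and the infinite end are handled through this description of the filter.\<close>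
lemma eventually_to_end:
  assumes b: "0 < b"
  shows "eventually P (to_end b) \<longleftrightarrow> (\<exists>c\<in>Ico0 b. \<forall>x\<in>Ico0 b. c \<le> x \<longrightarrow> P x)"
proof
  assume "eventually P (to_end b)"
  then obtain Q where Q: "eventually Q (at_left b)" "\<And>x. Q (ereal x) \<Longrightarrow> P x"
    unfolding to_end_def eventually_filtercomap by blast
  obtain d where d: "d < b" "\<And>y. d < y \<Longrightarrow> y < b \<Longrightarrow> Q y"
    using Q(1) unfolding eventually_at_left[OF b] by blast
  obtain c where c: "max d 0 < ereal c" "ereal c < b"
    using ereal_dense2[of "max d 0" b] d(1) b by auto
  have "c \<in> Ico0 b" using c by (auto simp: Ico0_def)
  moreover have "P x" if "x \<in> Ico0 b" "c \<le> x" for x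
  proof (intro Q(2) d(2))
    show "d < ereal x" using c that(2) by (meson ereal_less_eq(3) less_le_trans max_less_iff_conj)
    show "ereal x < b" using that(1) by (simp add: Ico0_def)
  qed
  ultimately show "\<exists>c\<in>Ico0 b. \<forall>x\<in>Ico0 b. c \<le> x \<longrightarrow> P x" by blast
next
  assume "\<exists>c\<in>Ico0 b. \<forall>x\<in>Ico0 b. c \<le> x \<longrightarrow> P x"
  then obtain c where c: "c \<in> Ico0 b" "\<And>x. x \<in> Ico0 b \<Longrightarrow> c \<le> x \<Longrightarrow> P x" by blast
  have "eventually (\<lambda>y. ereal c < y \<and> y < b) (at_left b)"
    unfolding eventually_at_left[OF b] using c(1) by (intro exI[of _ "ereal c"]) (auto simp: Ico0_def)
  moreover have "P x" if "ereal c < ereal x \<and> ereal x < b" for x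
    using that c(1) by (intro c(2)) (auto simp: Ico0_def)
  ultimately show "eventually P (to_end b)"
    unfolding to_end_def eventually_filtercomap by blast
qed

lemma to_end_nontrivial: "0 < b \<Longrightarrow> to_end b \<noteq> bot"
  unfolding trivial_limit_def eventually_to_end by blast

lemma Ico0_sequence:
  assumes b: "0 < b"
  obtains X :: "nat \<Rightarrow> real" where "incseq X" "\<And>n. X n \<in> Ico0 b"
    "\<And>x. x \<in> Ico0 b \<Longrightarrow> eventually (\<lambda>n. x < X n) sequentially"
proof -
  obtain X :: "nat \<Rightarrow> real" where X: "incseq X" "\<And>i. 0 < ereal (X i)" "\<And>i. ereal (X i) < b"
    "(\<lambda>x. ereal (X x)) \<longlonglongrightarrow> b"
    using ereal_incseq_approx[OF b] by metis
  have "X n \<in> Ico0 b" for n using X(2,3)[of n] by (auto simp: Ico0_def)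
  moreover have "eventually (\<lambda>n. x < X n) sequentially" if "x \<in> Ico0 b" for x
    using order_tendstoD(1)[OF X(4), of "ereal x"] that by (auto simp: Ico0_def)
  ultimately show ?thesis using that X(1) by blast
qed

section \<open>Measures on the interval that are finite before its end\<close>

text \<open>
  The analysis uses nothing of a Lebesgue--Stieltjes measure but its Borel sets and its finiteness on
  every \<open>[0,x)\<close>. The function \<open>cum\<close> defined below recovers \<open>R\<close> from the measure.
\<close>
locale initial_finite_measure =
  fixes b :: ereal and M :: "real measure"
  assumes b_pos: "0 < b"
    and sets_M: "sets M = sets (restrict_space borel (Ico0 b))"
    and finite_initial: "\<And>x. x \<in> Ico0 b \<Longrightarrow> emeasure M {0..<x} < \<infinity>"
begin

definition cum :: "real \<Rightarrow> real" where "cum x = measure M {0..<x}"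

lemma space_M: "space M = Ico0 b"
  using sets_eq_imp_space_eq[OF sets_M] by (simp add: space_restrict_space)

lemma measurable_from_borel:
  assumes "f \<in> borel_measurable borel" shows "f \<in> borel_measurable M"
  using measurable_restrict_space1[OF assms, of "Ico0 b"] measurable_cong_sets[OF sets_M refl] by blast

lemma sets_Ico [measurable]: "0 \<le> x \<Longrightarrow> y \<in> Ico0 b \<Longrightarrow> {x..<y} \<in> sets M"
  unfolding sets_M sets_restrict_space
  by (rule image_eqI[of _ _ "{x..<y}"]) (use Ico0_downward[of y b] in auto)

lemma emeasure_Ico_finite: "0 \<le> x \<Longrightarrow> y \<in> Ico0 b \<Longrightarrow> emeasure M {x..<y} < \<infinity>"
  using emeasure_mono[of "{x..<y}" "{0..<y}" M] finite_initial[of y] by (auto simp: top.not_eq_extremum)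

lemma measure_Ico:
  assumes "0 \<le> x" "x \<le> y" "y \<in> Ico0 b"
  shows "measure M {x..<y} = cum y - cum x"
proof -
  have x: "x \<in> Ico0 b" using assms Ico0_downward by blast
  have "measure M ({0..<x} \<union> {x..<y}) = cum x + measure M {x..<y}"
    unfolding cum_def
    by (rule measure_Union)
      (use assms x emeasure_Ico_finite[of 0 x] emeasure_Ico_finite[of x y] in auto)
  moreover have "{0..<x} \<union> {x..<y} = {0..<y}" using assms by auto
  ultimately show ?thesis by (simp add: cum_def)
qed

lemma emeasure_Ico:
  "0 \<le> x \<Longrightarrow> x \<le> y \<Longrightarrow> y \<in> Ico0 b \<Longrightarrow> emeasure M {x..<y} = ennreal (cum y - cum x)"
  using emeasure_Ico_finite[of x y] by (subst measure_Ico[symmetric]) (auto simp: emeasure_eq_ennreal_measure)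

lemma cum_mono: "0 \<le> x \<Longrightarrow> x \<le> y \<Longrightarrow> y \<in> Ico0 b \<Longrightarrow> cum x \<le> cum y"
  using measure_Ico[of x y] measure_nonneg[of M "{x..<y}"] by simp

lemma cum_nonneg: "0 \<le> cum x"
  by (simp add: cum_def)

lemma cum_measurable: "cum \<in> borel_measurable M"
proof -
  have "mono_on (Ico0 b) cum" using cum_mono by (intro mono_onI) (auto simp: Ico0_nonneg)
  then show ?thesis
    using borel_measurable_mono_on_fnc measurable_cong_sets[OF sets_M refl] by blast
qed

lemma sigma_finite: "sigma_finite_measure M"
proof -
  obtain X where X: "incseq X" "\<And>n. X n \<in> Ico0 b"
    "\<And>x. x \<in> Ico0 b \<Longrightarrow> eventually (\<lambda>n. x < X n) sequentially"
    using Ico0_sequence[OF b_pos] by blast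
  let ?A = "range (\<lambda>n. {0..<X n})"
  have "\<Union> ?A = Ico0 b"
  proof
    show "\<Union> ?A \<subseteq> Ico0 b"
    proof safe
      fix x n assume "x \<in> {0..<X n}"
      then show "x \<in> Ico0 b" using Ico0_downward[OF X(2)[of n], of x] by auto
    qed
    show "Ico0 b \<subseteq> \<Union> ?A"
    proof
      fix x assume x: "x \<in> Ico0 b"
      obtain n where "x < X n" using X(3)[OF x] by (auto simp: eventually_sequentially)
      then show "x \<in> \<Union> ?A" using x by (auto simp: Ico0_nonneg)
    qed
  qed
  moreover have "?A \<subseteq> sets M" using X(2) by auto
  moreover have "emeasure M a \<noteq> \<infinity>" if "a \<in> ?A" for a
    using that finite_initial[OF X(2)] by (auto simp: less_top)
  ultimately show ?thesis
    by (intro sigma_finite_measure.intro exI[of _ ?A]) (auto simp: space_M)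
qed

lemma nn_integral_le_if_initial:
  assumes [measurable]: "h \<in> borel_measurable M"
    and le: "\<And>x. x \<in> Ico0 b \<Longrightarrow> (\<integral>\<^sup>+t\<in>{0..<x}. h t \<partial>M) \<le> C"
  shows "(\<integral>\<^sup>+t. h t \<partial>M) \<le> C"
proof -
  obtain X where X: "incseq X" "\<And>n. X n \<in> Ico0 b"
    "\<And>x. x \<in> Ico0 b \<Longrightarrow> eventually (\<lambda>n. x < X n) sequentially"
    using Ico0_sequence[OF b_pos] by blast
  let ?h = "\<lambda>n t. h t * indicator {0..<X n} t"
  have S: "{0..<X n} \<in> sets M" for n using X(2) by auto
  have "h t = (SUP n. ?h n t)" if "t \<in> space M" for t
  proof (rule antisym)
    have t: "t \<in> Ico0 b" using that by (simp add: space_M)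
    obtain n where "t < X n" using X(3)[OF t] by (auto simp: eventually_sequentially)
    then have "h t = ?h n t" using t by (simp add: Ico0_nonneg)
    then show "h t \<le> (SUP n. ?h n t)" by (metis SUP_upper UNIV_I)
    show "(SUP n. ?h n t) \<le> h t" by (rule SUP_least) (simp add: indicator_def)
  qed
  then have "(\<integral>\<^sup>+t. h t \<partial>M) = (\<integral>\<^sup>+t. (SUP n. ?h n t) \<partial>M)" by (rule nn_integral_cong)
  also have "\<dots> = (SUP n. (\<integral>\<^sup>+t. ?h n t \<partial>M))"
  proof (rule nn_integral_monotone_convergence_SUP)
    show "incseq ?h"
      using X(1) by (auto simp: incseq_def le_fun_def indicator_def intro: less_le_trans)
    show "?h n \<in> borel_measurable M" for n using S[of n] by measurable
  qed
  also have "\<dots> \<le> C" by (rule SUP_least) (use le X(2) in auto)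
  finally show ?thesis .
qed

lemma nn_integral_split:
  assumes [measurable]: "h \<in> borel_measurable M" and "0 \<le> c" "c \<le> x" "x \<in> Ico0 b"
  shows "(\<integral>\<^sup>+t\<in>{0..<x}. h t \<partial>M) = (\<integral>\<^sup>+t\<in>{0..<c}. h t \<partial>M) + (\<integral>\<^sup>+t\<in>{c..<x}. h t \<partial>M)"
proof -
  have [measurable]: "{0..<c} \<in> sets M" "{c..<x} \<in> sets M"
    using assms Ico0_downward[of x b c] by auto
  have "(\<integral>\<^sup>+t\<in>{0..<x}. h t \<partial>M)
      = (\<integral>\<^sup>+t. h t * indicator {0..<c} t + h t * indicator {c..<x} t \<partial>M)"
    by (rule nn_integral_cong) (use assms in \<open>auto simp: indicator_def\<close>)
  also have "\<dots> = (\<integral>\<^sup>+t\<in>{0..<c}. h t \<partial>M) + (\<integral>\<^sup>+t\<in>{c..<x}. h t \<partial>M)"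
    by (rule nn_integral_add) auto
  finally show ?thesis .
qed

lemma initial_le_nn_integral: "(\<integral>\<^sup>+t\<in>A. h t \<partial>M) \<le> (\<integral>\<^sup>+t. h t \<partial>M)"
  by (rule nn_integral_mono) (auto simp: indicator_def)

lemma small_tail:
  assumes h: "h \<in> borel_measurable M" and fin: "(\<integral>\<^sup>+t. h t \<partial>M) < \<infinity>" and "0 < (e::ennreal)"
  obtains c where "c \<in> Ico0 b" "\<And>x. x \<in> Ico0 b \<Longrightarrow> (\<integral>\<^sup>+t\<in>{c..<x}. h t \<partial>M) \<le> e"
proof (cases "(\<integral>\<^sup>+t. h t \<partial>M) = 0")
  case True
  then have "(\<integral>\<^sup>+t\<in>A. h t \<partial>M) = 0" for A using initial_le_nn_integral[of h A] by simp
  then show ?thesis using that[of 0] zero_in_Ico0[OF b_pos] by simp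
next
  case False
  let ?I = "\<integral>\<^sup>+t. h t \<partial>M"
  have "\<not> ?I \<le> ?I - e"
    using False fin \<open>0 < e\<close>
    by (cases ?I; cases e) (auto simp: ennreal_minus ennreal_le_iff2 ennreal_minus_top)
  then obtain c where c: "c \<in> Ico0 b" "?I - e < (\<integral>\<^sup>+t\<in>{0..<c}. h t \<partial>M)"
    using nn_integral_le_if_initial[OF h, of "?I - e"] by (meson linorder_not_le)
  have "(\<integral>\<^sup>+t\<in>{c..<x}. h t \<partial>M) \<le> e" if x: "x \<in> Ico0 b" for x
  proof (cases "c \<le> x")
    case True
    let ?a = "\<integral>\<^sup>+t\<in>{0..<c}. h t \<partial>M" and ?d = "\<integral>\<^sup>+t\<in>{c..<x}. h t \<partial>M"
    have "?a + ?d \<le> ?I"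
      using nn_integral_split[OF h _ True x] c(1) initial_le_nn_integral[of h "{0..<x}"]
      by (simp add: Ico0_nonneg)
    also have "?I \<le> e + (?I - e)" 
      by (cases "e \<le> ?I") (auto simp: add_diff_inverse_ennreal intro: order_trans[of _ e])
    also have "\<dots> \<le> e + ?a" using c(2) by (intro add_left_mono) auto
    finally have "?a + ?d \<le> ?a + e" by (simp add: add.commute)
    moreover have "?a < \<infinity>" using initial_le_nn_integral[of h "{0..<c}"] fin by (rule le_less_trans)
    ultimately show ?thesis by (auto simp: ennreal_add_left_cancel_le)
  qed simp
  then show ?thesis using that c(1) by blast
qed

text \<open>
  The function \<open>1 / R\<close> is not integrable against an infinite \<open>dR\<close>. Since \<open>dR\<close> may have atoms, the
  logarithm is replaced by the estimate \<open>\<integral>\<^bsub>[c,x)\<^esub> dR / R \<ge> (R(x) - R(c)) / R(x)\<close>, whose right-hand side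
  exceeds \<open>1/2\<close> for \<open>x\<close> near the end: no tail of the integral is small.
\<close>
lemma not_integrable_if_ge_recip_cum:
  assumes h: "h \<in> borel_measurable M" and fin: "(\<integral>\<^sup>+t. h t \<partial>M) < \<infinity>"
    and unbounded: "\<And>B. \<exists>x\<in>Ico0 b. B < cum x"
    and k: "0 < k"
    and ge: "\<forall>\<^sub>F t in to_end b. ennreal (k / cum t) \<le> h t"
  shows False
proof -
  obtain c0 where c0: "c0 \<in> Ico0 b" "\<And>t. t \<in> Ico0 b \<Longrightarrow> c0 \<le> t \<Longrightarrow> ennreal (k / cum t) \<le> h t"
    using ge unfolding eventually_to_end[OF b_pos] by blast
  obtain c1 where c1: "c1 \<in> Ico0 b" "0 < cum c1" using unbounded by blast
  obtain c2 where c2: "c2 \<in> Ico0 b" "\<And>x. x \<in> Ico0 b \<Longrightarrow> (\<integral>\<^sup>+t\<in>{c2..<x}. h t \<partial>M) \<le> ennreal (k/3)"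
    using small_tail[OF h fin, of "ennreal (k/3)"] k by auto
  \<comment> \<open>Beyond \<open>c\<close> the lower bound holds, \<open>cum\<close> is positive and the tail is at most \<open>k/3\<close>.\<close>
  define c where "c = max c0 (max c1 c2)"
  have c: "c \<in> Ico0 b" "c0 \<le> c" "c1 \<le> c" "c2 \<le> c"
    using c0 c1 c2 by (auto simp: c_def max_in_Ico0)
  have cp: "0 < cum c" using c1 c cum_mono[of c1 c] by (simp add: Ico0_nonneg)
  obtain x where x: "x \<in> Ico0 b" "2 * cum c < cum x" using unbounded by blast
  have cx: "c \<le> x" using x c cp cum_mono[of x c] by (force simp: Ico0_nonneg)
  have xp: "0 < cum x" using x cp by simp
  have S: "{c..<x} \<in> sets M" using c x by (simp add: Ico0_nonneg sets_Ico)
  have "ennreal (k/2) \<le> ennreal (k / cum x * (cum x - cum c))"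
    using x cp xp k by (intro ennreal_leI) (simp add: field_simps)
  also have "\<dots> = ennreal (k / cum x) * emeasure M {c..<x}"
    using c x cx k xp cum_mono[of c x]
    by (subst emeasure_Ico) (auto simp: Ico0_nonneg ennreal_mult simp del: times_divide_eq_left)
  also have "\<dots> = (\<integral>\<^sup>+t\<in>{c..<x}. ennreal (k / cum x) \<partial>M)"
    using S by (simp add: nn_integral_cmult_indicator)
  also have "\<dots> \<le> (\<integral>\<^sup>+t\<in>{c2..<x}. h t \<partial>M)"
  proof (rule nn_integral_mono)
    fix t
    show "ennreal (k / cum x) * indicator {c..<x} t \<le> h t * indicator {c2..<x} t"
    proof (cases "t \<in> {c..<x}")
      case True
      have t: "t \<in> Ico0 b" using True x c Ico0_downward[of x b t] Ico0_nonneg[OF c(1)] by auto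
      have "0 < cum t" "cum t \<le> cum x"
        using True cp cum_mono[of c t] cum_mono[of t x] t x c by (auto simp: Ico0_nonneg)
      then have "ennreal (k / cum x) \<le> ennreal (k / cum t)"
        using k by (intro ennreal_leI divide_left_mono) auto
      also have "\<dots> \<le> h t" using c0(2) t True c by auto
      finally show ?thesis using True c by auto
    qed simp
  qed
  also have "\<dots> \<le> ennreal (k/3)" using c2(2) x by blast
  finally show False using k by (simp add: ennreal_le_iff2)
qed

text \<open>
  The counterpart for a finite measure of total mass \<open>T\<close>:
  \<open>\<integral>\<^bsub>[c,x)\<^esub> dR / (T - R) \<ge> (R(x) - R(c)) / (T - R(c))\<close>, and this tends to \<open>1\<close> as \<open>x\<close> approaches the end.
\<close>
lemma not_integrable_if_ge_recip_tail:
  assumes h: "h \<in> borel_measurable M" and fin: "(\<integral>\<^sup>+t. h t \<partial>M) < \<infinity>"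
    and T: "(cum \<longlongrightarrow> T) (to_end b)"
    and k: "0 < k"
    and ge: "\<forall>\<^sub>F t in to_end b. cum t < T \<and> ennreal (k / (T - cum t)) \<le> h t"
  shows False
proof -
  obtain c0 where c0: "c0 \<in> Ico0 b"
    "\<And>t. t \<in> Ico0 b \<Longrightarrow> c0 \<le> t \<Longrightarrow> cum t < T \<and> ennreal (k / (T - cum t)) \<le> h t"
    using ge unfolding eventually_to_end[OF b_pos] by blast
  obtain c2 where c2: "c2 \<in> Ico0 b" "\<And>x. x \<in> Ico0 b \<Longrightarrow> (\<integral>\<^sup>+t\<in>{c2..<x}. h t \<partial>M) \<le> ennreal (k/3)"
    using small_tail[OF h fin, of "ennreal (k/3)"] k by auto
  define c where "c = max c0 c2"
  have c: "c \<in> Ico0 b" "c0 \<le> c" "c2 \<le> c"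
    using c0 c2 by (auto simp: c_def max_in_Ico0)
  have cT: "cum c < T" using c0(2) c by blast
  have "\<forall>\<^sub>F x in to_end b. (T + cum c) / 2 < cum x" using T cT by (intro order_tendstoD) auto
  then obtain x' where x': "x' \<in> Ico0 b" "\<And>x. x \<in> Ico0 b \<Longrightarrow> x' \<le> x \<Longrightarrow> (T + cum c) / 2 < cum x"
    unfolding eventually_to_end[OF b_pos] by blast
  define x where "x = max c x'"
  have x: "x \<in> Ico0 b" "c \<le> x" "(T + cum c) / 2 < cum x"
    using x' c by (auto simp: x_def max_in_Ico0)
  have S: "{c..<x} \<in> sets M" using c x by (simp add: Ico0_nonneg sets_Ico)
  have "ennreal (k/2) \<le> ennreal (k / (T - cum c) * (cum x - cum c))"
    using x cT mult_left_mono[of "T + cum c" "cum x * 2" k] k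
    by (intro ennreal_leI) (simp add: field_simps)
  also have "\<dots> = ennreal (k / (T - cum c)) * emeasure M {c..<x}"
    using c x k cT cum_mono[of c x]
    by (subst emeasure_Ico) (auto simp: Ico0_nonneg ennreal_mult simp del: times_divide_eq_left)
  also have "\<dots> = (\<integral>\<^sup>+t\<in>{c..<x}. ennreal (k / (T - cum c)) \<partial>M)"
    using S by (simp add: nn_integral_cmult_indicator)
  also have "\<dots> \<le> (\<integral>\<^sup>+t\<in>{c2..<x}. h t \<partial>M)"
  proof (rule nn_integral_mono)
    fix t
    show "ennreal (k / (T - cum c)) * indicator {c..<x} t \<le> h t * indicator {c2..<x} t"
    proof (cases "t \<in> {c..<x}")
      case True
      have t: "t \<in> Ico0 b" using True x c Ico0_downward[of x b t] Ico0_nonneg[OF c(1)] by auto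
      have *: "cum t < T" "ennreal (k / (T - cum t)) \<le> h t" using c0(2)[OF t] True c by auto
      have "cum c \<le> cum t" using True cum_mono[of c t] t c by (auto simp: Ico0_nonneg)
      then have "ennreal (k / (T - cum c)) \<le> ennreal (k / (T - cum t))"
        using k * by (intro ennreal_leI divide_left_mono) auto
      then show ?thesis using True c * by auto
    qed simp
  qed
  also have "\<dots> \<le> ennreal (k/3)" using c2(2) x by blast
  finally show False using k by (simp add: ennreal_le_iff2)
qed

end

section \<open>Square integrals and primitives\<close>

definition energy :: "real measure \<Rightarrow> real set \<Rightarrow> (real \<Rightarrow> complex) \<Rightarrow> ennreal" where
  "energy M A f = (\<integral>\<^sup>+t\<in>A. ennreal ((cmod (f t))\<^sup>2) \<partial>M)"

lemma energy_mono: "A \<subseteq> B \<Longrightarrow> energy M A f \<le> energy M B f"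
  unfolding energy_def by (rule nn_integral_mono) (auto simp: indicator_def)

text \<open>Cauchy--Schwarz against the constant \<open>1\<close>.\<close>
lemma norm_integral_sq_le_energy:
  assumes [measurable]: "f \<in> borel_measurable M" "A \<in> sets M"
  shows "(\<integral>\<^sup>+t\<in>A. ennreal (cmod (f t)) \<partial>M)\<^sup>2 \<le> energy M A f * emeasure M A"
proof -
  have "(\<integral>\<^sup>+t\<in>A. ennreal (cmod (f t)) \<partial>M)\<^sup>2
      = (\<integral>\<^sup>+t. (ennreal (cmod (f t)) * indicator A t) * indicator A t \<partial>M)\<^sup>2"
    by (rule arg_cong[where f = "\<lambda>x. x\<^sup>2"], rule nn_integral_cong) (auto simp: indicator_def)
  also have "\<dots> \<le> (\<integral>\<^sup>+t. (ennreal (cmod (f t)) * indicator A t)\<^sup>2 \<partial>M)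
      * (\<integral>\<^sup>+t. (indicator A t)\<^sup>2 \<partial>M)"
    by (rule Cauchy_Schwarz_nn_integral) measurable
  also have "(\<integral>\<^sup>+t. (ennreal (cmod (f t)) * indicator A t)\<^sup>2 \<partial>M) = energy M A f"
    unfolding energy_def by (rule nn_integral_cong) (auto simp: indicator_def ennreal_power)
  also have "(\<integral>\<^sup>+t. (indicator A t)\<^sup>2 \<partial>M) = (\<integral>\<^sup>+t. indicator A t \<partial>M)"
    by (rule nn_integral_cong) (auto simp: indicator_def)
  finally show ?thesis by simp
qed

lemma set_integrable_if_energy_finite:
  assumes [measurable]: "f \<in> borel_measurable M" "A \<in> sets M"
    and "emeasure M A < \<infinity>" "energy M A f < \<infinity>"
  shows "set_integrable M A f"
  unfolding set_integrable_def
proof (rule integrableI_bounded)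
  have "(\<integral>\<^sup>+t\<in>A. ennreal (cmod (f t)) \<partial>M)\<^sup>2 < \<infinity>"
    using norm_integral_sq_le_energy[OF assms(1,2)] assms(3,4)
    by (auto simp: ennreal_mult_less_top intro: le_less_trans)
  then have "(\<integral>\<^sup>+t\<in>A. ennreal (cmod (f t)) \<partial>M) < \<infinity>"
    by (auto simp: power2_eq_square ennreal_mult_less_top)
  then show "(\<integral>\<^sup>+t. ennreal (norm (indicat_real A t *\<^sub>R f t)) \<partial>M) < \<infinity>"
    by (subst nn_integral_cong[where v = "\<lambda>t. ennreal (cmod (f t)) * indicator A t"])
      (auto simp: indicator_def)
qed measurable

lemma cmod_set_integral_sq_le:
  assumes "f \<in> borel_measurable M" "A \<in> sets M" "set_integrable M A f"
  shows "ennreal ((cmod (LINT t:A|M. f t))\<^sup>2) \<le> energy M A f * emeasure M A"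
proof -
  have "ennreal (cmod (LINT t:A|M. f t)) \<le> (\<integral>\<^sup>+t. ennreal (norm (indicat_real A t *\<^sub>R f t)) \<partial>M)"
    using assms(3) unfolding set_integrable_def set_lebesgue_integral_def
    by (rule integral_norm_bound_ennreal)
  also have "\<dots> = (\<integral>\<^sup>+t\<in>A. ennreal (cmod (f t)) \<partial>M)"
    by (rule nn_integral_cong) (auto simp: indicator_def)
  finally have "(ennreal (cmod (LINT t:A|M. f t)))\<^sup>2 \<le> (\<integral>\<^sup>+t\<in>A. ennreal (cmod (f t)) \<partial>M)\<^sup>2"
    by (intro power_mono) auto
  then show ?thesis
    using norm_integral_sq_le_energy[OF assms(1,2)] by (simp add: ennreal_power)
qed

text \<open>
  Both equations of the system have this form; integrability is part of the notion because the Bochner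
  integral of a non-integrable function is \<open>0\<close>.
\<close>
definition primitive :: "ereal \<Rightarrow> real measure \<Rightarrow> (real \<Rightarrow> complex) \<Rightarrow> (real \<Rightarrow> complex) \<Rightarrow> bool" where
  "primitive b M f F \<longleftrightarrow> f \<in> borel_measurable M \<and>
     (\<forall>x\<in>Ico0 b. set_integrable M {0..<x} f \<and> F x = F 0 + (LINT t:{0..<x}|M. f t))"

lemma primitive_at:
  "primitive b M f F \<Longrightarrow> x \<in> Ico0 b \<Longrightarrow> F x = F 0 + (LINT t:{0..<x}|M. f t)"
  "primitive b M f F \<Longrightarrow> x \<in> Ico0 b \<Longrightarrow> set_integrable M {0..<x} f"
  "primitive b M f F \<Longrightarrow> f \<in> borel_measurable M"
  unfolding primitive_def by blast+

lemma primitive_add: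
  assumes "primitive b M f F" "primitive b M g G"
  shows "primitive b M (\<lambda>t. f t + g t) (\<lambda>t. F t + G t)"
  unfolding primitive_def
proof (intro conjI ballI)
  fix x assume x: "x \<in> Ico0 b"
  have i: "set_integrable M {0..<x} f" "set_integrable M {0..<x} g"
    using assms x by (auto simp: primitive_def)
  show "set_integrable M {0..<x} (\<lambda>t. f t + g t)" by (rule set_integral_add(1)[OF i])
  have "F x = F 0 + (LINT t:{0..<x}|M. f t)" "G x = G 0 + (LINT t:{0..<x}|M. g t)"
    using assms x by (auto simp: primitive_def)
  then show "F x + G x = F 0 + G 0 + (LINT t:{0..<x}|M. f t + g t)"
    unfolding set_integral_add(2)[OF i] by simp
qed (use assms in \<open>auto simp: primitive_def\<close>)

lemma primitive_cmult:
  assumes "primitive b M f F"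
  shows "primitive b M (\<lambda>t. c * f t) (\<lambda>t. c * F t)"
  unfolding primitive_def
proof (intro conjI ballI)
  fix x assume x: "x \<in> Ico0 b"
  show "set_integrable M {0..<x} (\<lambda>t. c * f t)"
    using assms x by (auto simp: primitive_def)
  have "F x = F 0 + (LINT t:{0..<x}|M. f t)"
    using assms x by (auto simp: primitive_def)
  then show "c * F x = c * F 0 + (LINT t:{0..<x}|M. c * f t)"
    by (simp add: distrib_left)
qed (use assms in \<open>auto simp: primitive_def\<close>)

lemma primitive_add_const:
  assumes "primitive b M f F"
  shows "primitive b M f (\<lambda>x. c + F x)"
  unfolding primitive_def
proof (intro conjI ballI)
  fix x assume "x \<in> Ico0 b"
  then show "c + F x = c + F 0 + (LINT t:{0..<x}|M. f t)" "set_integrable M {0..<x} f"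
    using primitive_at(1,2)[OF assms, of x] by simp_all
qed (rule primitive_at(3)[OF assms])

lemma primitive_cnj:
  assumes "primitive b M f F"
  shows "primitive b M (\<lambda>t. cnj (f t)) (\<lambda>t. cnj (F t))"
  unfolding primitive_def
proof (intro conjI ballI)
  show "(\<lambda>t. cnj (f t)) \<in> borel_measurable M"
    using measurable_compose[OF primitive_at(3)[OF assms] borel_measurable_continuous_onI, of cnj]
    by (simp add: continuous_on_cnj)
next
  have cnj: "(\<lambda>t. indicat_real A t *\<^sub>R cnj (f t)) = (\<lambda>t. cnj (indicat_real A t *\<^sub>R f t))" for A
    by auto
  fix x assume x: "x \<in> Ico0 b"
  have i: "set_integrable M {0..<x} f" and F: "F x = F 0 + (LINT t:{0..<x}|M. f t)"
    using assms x by (auto simp: primitive_def)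
  show "set_integrable M {0..<x} (\<lambda>t. cnj (f t))"
    using i unfolding set_integrable_def cnj by (rule integrable_bounded_linear[OF bounded_linear_cnj])
  have "(LINT t:{0..<x}|M. cnj (f t)) = cnj (LINT t:{0..<x}|M. f t)"
    using i unfolding set_integrable_def set_lebesgue_integral_def cnj
    by (intro integral_bounded_linear[OF bounded_linear_cnj])
  then show "cnj (F x) = cnj (F 0) + (LINT t:{0..<x}|M. cnj (f t))"
    using F by simp
qed

context initial_finite_measure
begin

lemma id_measurable [measurable]: "(\<lambda>x. x) \<in> borel_measurable M"
  by (rule measurable_from_borel) simp

lemma primitive_increment:
  assumes "primitive b M f F" "0 \<le> x" "x \<le> y" "y \<in> Ico0 b"
  shows "F y - F x = (LINT t:{x..<y}|M. f t)"
proof -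
  have x: "x \<in> Ico0 b" using assms Ico0_downward by blast
  have i: "set_integrable M {0..<y} f" using assms by (auto simp: primitive_def)
  have "set_integrable M {0..<x} f" "set_integrable M {x..<y} f"
    using assms x by (auto intro!: set_integrable_subset[OF i])
  then have "(LINT t:{0..<x} \<union> {x..<y}|M. f t) = (LINT t:{0..<x}|M. f t) + (LINT t:{x..<y}|M. f t)"
    by (intro set_integral_Un) auto
  moreover have "{0..<x} \<union> {x..<y} = {0..<y}" using assms by auto
  moreover have "F x = F 0 + (LINT t:{0..<x}|M. f t)" "F y = F 0 + (LINT t:{0..<y}|M. f t)"
    using assms x by (auto simp: primitive_def)
  ultimately show ?thesis by simp
qed

lemma initial_integral_measurable:
  fixes f :: "real \<Rightarrow> complex"
  assumes [measurable]: "f \<in> borel_measurable M"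
  shows "(\<lambda>x. LINT t:{0..<x}|M. f t) \<in> borel_measurable M"
proof -
  have "(\<lambda>x. LINT t|M. (if t < x then f t else 0)) \<in> borel_measurable M"
    by (rule sigma_finite_measure.borel_measurable_lebesgue_integral[OF sigma_finite])
      (simp add: case_prod_unfold)
  moreover have "(LINT t:{0..<x}|M. f t) = (LINT t|M. (if t < x then f t else 0))" for x
    unfolding set_lebesgue_integral_def
    by (rule Bochner_Integration.integral_cong) (auto simp: indicator_def space_M Ico0_nonneg)
  ultimately show ?thesis by simp
qed

lemma primitive_measurable:
  assumes "primitive b M f F"
  shows "F \<in> borel_measurable M"
proof -
  have f: "f \<in> borel_measurable M" using assms by (simp add: primitive_def)
  have "(\<lambda>x. F 0 + (LINT t:{0..<x}|M. f t)) \<in> borel_measurable M"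
    using initial_integral_measurable[OF f] by simp
  moreover have "F x = F 0 + (LINT t:{0..<x}|M. f t)" if "x \<in> space M" for x
    using assms that by (auto simp: primitive_def space_M)
  ultimately show ?thesis using measurable_cong[of M F] by auto
qed

lemma primitive_bounded:
  assumes "primitive b M f F" "X \<in> Ico0 b"
  obtains C where "\<And>x. 0 \<le> x \<Longrightarrow> x \<le> X \<Longrightarrow> cmod (F x) \<le> C"
proof -
  have "cmod (F x) \<le> cmod (F 0) + (LINT t|M. norm (indicat_real {0..<X} t *\<^sub>R f t))"
    if "0 \<le> x" "x \<le> X" for x
  proof -
    have x: "x \<in> Ico0 b" using assms(2) that Ico0_downward by blast
    have i: "set_integrable M {0..<x} f" "set_integrable M {0..<X} f"
      using assms x by (auto simp: primitive_def)
    have "cmod (LINT t:{0..<x}|M. f t) \<le> (LINT t|M. norm (indicat_real {0..<x} t *\<^sub>R f t))"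
      unfolding set_lebesgue_integral_def by (rule integral_norm_bound)
    also have "\<dots> \<le> (LINT t|M. norm (indicat_real {0..<X} t *\<^sub>R f t))"
      using i that unfolding set_integrable_def
      by (intro integral_mono integrable_norm) (auto simp: indicator_def)
    finally show ?thesis
      using assms x by (auto simp: primitive_def intro: order_trans[OF norm_triangle_ineq])
  qed
  then show ?thesis using that by blast
qed

lemma set_integrable_mult_bounded:
  fixes F g :: "real \<Rightarrow> complex"
  assumes [measurable]: "F \<in> borel_measurable M" and g: "set_integrable M A g"
    and C: "\<And>x. x \<in> A \<Longrightarrow> cmod (F x) \<le> C"
  shows "set_integrable M A (\<lambda>t. F t * g t)"
proof -
  have g': "integrable M (\<lambda>t. C *\<^sub>R (indicat_real A t *\<^sub>R g t))"
    using g unfolding set_integrable_def by (rule integrable_scaleR_right)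
  have [measurable]: "(\<lambda>t. indicat_real A t *\<^sub>R g t) \<in> borel_measurable M"
    using g unfolding set_integrable_def by (rule borel_measurable_integrable)
  have "(\<lambda>t. F t * (indicat_real A t *\<^sub>R g t)) \<in> borel_measurable M" by measurable
  then have "integrable M (\<lambda>t. F t * (indicat_real A t *\<^sub>R g t))"
    by (rule Bochner_Integration.integrable_bound[OF g'])
      (auto simp: norm_mult indicator_def intro!: AE_I2 mult_right_mono order_trans[OF C])
  moreover have "F t * (indicat_real A t *\<^sub>R g t) = indicat_real A t *\<^sub>R (F t * g t)" for t by simp
  ultimately show ?thesis unfolding set_integrable_def by simp
qed

lemma set_integrable_bounded:
  fixes F :: "real \<Rightarrow> complex"
  assumes "F \<in> borel_measurable M" "X \<in> Ico0 b" "\<And>x. x \<in> {0..<X} \<Longrightarrow> cmod (F x) \<le> C"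
  shows "set_integrable M {0..<X} F"
proof -
  have "set_integrable M {0..<X} (\<lambda>_. 1 :: complex)"
    using assms(2) finite_initial[OF assms(2)] by (auto simp: set_integrable_def sets_Ico less_top)
  from set_integrable_mult_bounded[OF assms(1) this assms(3)] show ?thesis by simp
qed

lemma primitive_increment_sq_le:
  assumes "primitive b M f F" "0 \<le> x" "x \<le> y" "y \<in> Ico0 b"
  shows "ennreal ((cmod (F y - F x))\<^sup>2) \<le> energy M {x..<y} f * ennreal (cum y - cum x)"
proof -
  have f: "f \<in> borel_measurable M" and i: "set_integrable M {0..<y} f"
    using assms by (auto simp: primitive_def)
  have S: "{x..<y} \<in> sets M" using assms sets_Ico by blast
  have "set_integrable M {x..<y} f" using assms S by (intro set_integrable_subset[OF i]) auto
  from cmod_set_integral_sq_le[OF f S this] show ?thesis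
    using primitive_increment[OF assms] emeasure_Ico[OF assms(2-4)] by simp
qed

lemma primitive_cong_AE:
  assumes "primitive b M f F" "g \<in> borel_measurable M" "AE t in M. f t = g t"
  shows "primitive b M g F"
  unfolding primitive_def
proof (intro conjI ballI)
  fix x assume x: "x \<in> Ico0 b"
  have f: "f \<in> borel_measurable M" "set_integrable M {0..<x} f" "F x = F 0 + (LINT t:{0..<x}|M. f t)"
    using assms x by (auto simp: primitive_def)
  have [measurable]: "f \<in> borel_measurable M" "g \<in> borel_measurable M" "{0..<x} \<in> sets M"
    using f(1) assms(2) sets_Ico[OF _ x] by auto
  have "AE t\<in>{0..<x} in M. f t = g t" using assms(3) by eventually_elim auto
  then show "F x = F 0 + (LINT t:{0..<x}|M. g t)"
    unfolding f(3) by (subst set_lebesgue_integral_cong_AE[of "{0..<x}" M f g]) auto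
  show "set_integrable M {0..<x} g"
    using f(2) \<open>AE t\<in>{0..<x} in M. f t = g t\<close> set_integrable_cong_AE[of f M g "{0..<x}"] by simp
qed (use assms in simp)

text \<open>
  Needed for the diagonal of a product of two such measures: a countable set of atoms of one measure is
  a null set of the other if no atom is shared.
\<close>
lemma countable_atoms: "countable {x \<in> Ico0 b. emeasure M {x} \<noteq> 0}"
proof -
  obtain X where X: "incseq X" "\<And>n. X n \<in> Ico0 b"
    "\<And>x. x \<in> Ico0 b \<Longrightarrow> eventually (\<lambda>n. x < X n) sequentially"
    using Ico0_sequence[OF b_pos] by blast
  let ?N = "\<lambda>n. restrict_space M {0..<X n}"
  have S: "{0..<X n} \<in> sets M" for n using X(2) sets_Ico by simp
  have fin: "finite_measure (?N n)" for n
    using S finite_initial[OF X(2), of n] sets.sets_into_space[OF S[of n]]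
    by (intro finite_measureI) (auto simp: emeasure_restrict_space space_restrict_space Int_absorb2)
  have "{x \<in> Ico0 b. emeasure M {x} \<noteq> 0} \<subseteq> (\<Union>n. {x. measure (?N n) {x} \<noteq> 0})"
  proof safe
    fix x assume x: "x \<in> Ico0 b" "emeasure M {x} \<noteq> 0"
    obtain n where n: "x < X n" using X(3)[OF x(1)] by (auto simp: eventually_sequentially)
    have "emeasure (?N n) {x} = emeasure M {x}"
      using n x S by (intro emeasure_restrict_space) (auto simp: Ico0_nonneg sets.Int_space_eq2)
    then have "measure (?N n) {x} \<noteq> 0"
      using x finite_measure.emeasure_eq_measure[OF fin, of n "{x}"] by auto
    then show "x \<in> (\<Union>n. {x. measure (?N n) {x} \<noteq> 0})" by blast
  qed
  moreover have "countable (\<Union>n. {x. measure (?N n) {x} \<noteq> 0})"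
    using finite_measure.countable_support[OF fin] by blast
  ultimately show ?thesis by (rule countable_subset)
qed

lemma bounded_cum_converges:
  assumes "\<And>x. x \<in> Ico0 b \<Longrightarrow> cum x \<le> B"
  obtains T where "(cum \<longlongrightarrow> T) (to_end b)" "\<And>x. x \<in> Ico0 b \<Longrightarrow> cum x \<le> T"
proof -
  let ?T = "SUP x\<in>Ico0 b. cum x"
  have bdd: "bdd_above (cum ` Ico0 b)" using assms by (auto simp: bdd_above_def)
  have le: "cum x \<le> ?T" if "x \<in> Ico0 b" for x using bdd that by (rule cSUP_upper[rotated])
  have "(cum \<longlongrightarrow> ?T) (to_end b)"
  proof (rule order_tendstoI)
    fix a assume "a < ?T"
    then obtain c where c: "c \<in> Ico0 b" "a < cum c"
      using less_cSUP_iff[OF _ bdd] zero_in_Ico0[OF b_pos] by blast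
    show "\<forall>\<^sub>F x in to_end b. a < cum x" unfolding eventually_to_end[OF b_pos]
      using c cum_mono[of c] by (intro bexI[of _ c]) (force simp: Ico0_nonneg)+
  next
    fix a assume "?T < a"
    then show "\<forall>\<^sub>F x in to_end b. cum x < a" unfolding eventually_to_end[OF b_pos]
      using le zero_in_Ico0[OF b_pos] by (force intro: bexI[of _ 0])
  qed
  then show ?thesis using that le by blast
qed

end

lemma (in initial_finite_measure) energy_le_if_initial:
  assumes "f \<in> borel_measurable M" "\<And>x. x \<in> Ico0 b \<Longrightarrow> energy M {0..<x} f \<le> C"
  shows "(\<integral>\<^sup>+t. ennreal ((cmod (f t))\<^sup>2) \<partial>M) \<le> C"
  by (rule nn_integral_le_if_initial) (use assms in \<open>simp_all add: energy_def\<close>)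

section \<open>Integration by parts for two measures without common atoms\<close>

locale initial_finite_pair = m1: initial_finite_measure b M1 + m2: initial_finite_measure b M2
  for b M1 M2 +
  assumes no_common_atom: "x \<in> Ico0 b \<Longrightarrow> emeasure M1 {x} = 0 \<or> emeasure M2 {x} = 0"
begin

lemma measurable_12: "borel_measurable M1 = borel_measurable M2"
  by (intro measurable_cong_sets) (simp_all add: m1.sets_M m2.sets_M)

lemma pair_sigma_finite: "pair_sigma_finite M1 M2"
  by (intro pair_sigma_finite.intro m1.sigma_finite m2.sigma_finite)

lemma AE_off_diagonal: "AE p in M1 \<Otimes>\<^sub>M M2. fst p < snd p \<or> snd p < fst p"
proof -
  interpret pair_sigma_finite M1 M2 by (rule pair_sigma_finite)
  have sing: "{x} \<in> sets M1" "{x} \<in> sets M2" if "x \<in> Ico0 b" for x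
    using that unfolding m1.sets_M m2.sets_M sets_restrict_space by (auto intro!: image_eqI[of _ _ "{x}"])
  let ?N = "{x \<in> Ico0 b. emeasure M2 {x} \<noteq> 0}"
  have "(\<Union>x\<in>?N. {x}) \<in> null_sets M1"
    using m2.countable_atoms no_common_atom sing by (intro null_sets_UN') auto
  then have "AE x in M1. x \<notin> ?N" using AE_not_in[of ?N M1] by simp
  then have "AE x in M1. AE y in M2. fst (x, y) < snd (x, y) \<or> snd (x, y) < fst (x, y)"
    using AE_space
  proof eventually_elim
    case (elim x)
    then have "x \<in> Ico0 b" "emeasure M2 {x} = 0" by (auto simp: m1.space_M)
    then have "{x} \<in> null_sets M2" using sing by blast
    from AE_not_in[OF this] show ?case by eventually_elim auto
  qed
  then show ?thesis by (intro AE_pair_measure) measurable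
qed

text \<open>
  The square \<open>[0,x) \<times> [0,x)\<close> is cut along its diagonal, which is a null set of the product measure,
  and Fubini's theorem is applied to the product \<open>f(s) g(t)\<close> on each of the two triangles. Without the
  assumption on the atoms one of the functions would have to be evaluated at right limits.
\<close>
lemma product_rule:
  assumes F: "primitive b M1 f F" and G: "primitive b M2 g G" and x: "x \<in> Ico0 b"
  shows "set_integrable M2 {0..<x} (\<lambda>t. F t * g t)"
    and "set_integrable M1 {0..<x} (\<lambda>t. G t * f t)"
    and "F x * G x - F 0 * G 0 = (LINT t:{0..<x}|M2. F t * g t) + (LINT t:{0..<x}|M1. G t * f t)"
proof -
  interpret pair_sigma_finite M1 M2 by (rule pair_sigma_finite)
  have [measurable]: "F \<in> borel_measurable M1" "G \<in> borel_measurable M2"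
    "F \<in> borel_measurable M2" "G \<in> borel_measurable M1"
    using m1.primitive_measurable[OF F] m2.primitive_measurable[OF G] measurable_12 by auto
  have [measurable]: "f \<in> borel_measurable M1" "g \<in> borel_measurable M2"
    using primitive_at(3)[OF F] primitive_at(3)[OF G] .
  have fi: "set_integrable M1 {0..<x} f" and gi: "set_integrable M2 {0..<x} g"
    using primitive_at(2)[OF F x] primitive_at(2)[OF G x] .
  obtain C where C: "\<And>t. 0 \<le> t \<Longrightarrow> t \<le> x \<Longrightarrow> cmod (F t) \<le> C"
    using m1.primitive_bounded[OF F x] by blast
  obtain D where D: "\<And>t. 0 \<le> t \<Longrightarrow> t \<le> x \<Longrightarrow> cmod (G t) \<le> D"
    using m2.primitive_bounded[OF G x] by blast
  show Fg: "set_integrable M2 {0..<x} (\<lambda>t. F t * g t)"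
    using C by (intro m2.set_integrable_mult_bounded[of _ _ _ C] gi) auto
  show Gf: "set_integrable M1 {0..<x} (\<lambda>t. G t * f t)"
    using D by (intro m1.set_integrable_mult_bounded[of _ _ _ D] fi) auto
  define a where "a s = indicat_real {0..<x} s *\<^sub>R f s" for s
  define c where "c t = indicat_real {0..<x} t *\<^sub>R g t" for t
  have ai: "integrable M1 a" and ci: "integrable M2 c"
    using fi gi unfolding a_def c_def set_integrable_def by simp_all
  have [measurable]: "a \<in> borel_measurable M1" "c \<in> borel_measurable M2"
    using ai ci by (simp_all add: borel_measurable_integrable)
  define p where "p = (\<lambda>(s, t). a s * c t)"
  have pm [measurable]: "p \<in> borel_measurable (M1 \<Otimes>\<^sub>M M2)" unfolding p_def by measurable
  have pint: "integrable (M1 \<Otimes>\<^sub>M M2) p"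
  proof (rule Fubini_integrable)
    show "integrable M1 (\<lambda>s. LINT t|M2. norm (p (s, t)))"
      using ai by (simp add: p_def norm_mult)
    show "AE s in M1. integrable M2 (\<lambda>t. p (s, t))"
      using ci by (simp add: p_def)
  qed measurable
  define p1 where "p1 = (\<lambda>(s, t). if s < t then a s * c t else 0)"
  define p2 where "p2 = (\<lambda>(s, t). if t < s then a s * c t else 0)"
  have [measurable]: "p1 \<in> borel_measurable (M1 \<Otimes>\<^sub>M M2)" "p2 \<in> borel_measurable (M1 \<Otimes>\<^sub>M M2)"
    unfolding p1_def p2_def case_prod_unfold by measurable
  have p1i: "integrable (M1 \<Otimes>\<^sub>M M2) p1" and p2i: "integrable (M1 \<Otimes>\<^sub>M M2) p2"
    by (rule Bochner_Integration.integrable_bound[OF pint], measurable, simp add: p_def p1_def p2_def case_prod_unfold)+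
  have "(integral\<^sup>L (M1 \<Otimes>\<^sub>M M2) p1) = (LINT t|M2. LINT s|M1. p1 (s, t))"
    using integral_snd[of "\<lambda>s t. p1 (s, t)"] p1i by simp
  also have "\<dots> = (LINT t:{0..<x}|M2. (F t - F 0) * g t)"
    unfolding set_lebesgue_integral_def
  proof (rule Bochner_Integration.integral_cong[OF refl])
    fix t assume "t \<in> space M2"
    show "(LINT s|M1. p1 (s, t)) = indicat_real {0..<x} t *\<^sub>R ((F t - F 0) * g t)"
    proof (cases "t \<in> {0..<x}")
      case True
      then have t: "t \<in> Ico0 b" using x Ico0_downward[of x b t] by auto
      have "(LINT s|M1. p1 (s, t)) = (LINT s:{0..<t}|M1. f s * g t)"
        unfolding set_lebesgue_integral_def by (rule Bochner_Integration.integral_cong)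
          (use True in \<open>auto simp: p1_def a_def c_def indicator_def m1.space_M Ico0_nonneg\<close>)
      also have "\<dots> = (LINT s:{0..<t}|M1. f s) * g t" by simp
      also have "\<dots> = (F t - F 0) * g t" using primitive_at(1)[OF F t] by simp
      finally show ?thesis using True by simp
    next
      case False
      then have "c t = 0" by (simp add: c_def)
      then show ?thesis using False by (simp add: p1_def cong: if_cong)
    qed
  qed
  finally have P1: "(integral\<^sup>L (M1 \<Otimes>\<^sub>M M2) p1) = (LINT t:{0..<x}|M2. (F t - F 0) * g t)" .
  have "(integral\<^sup>L (M1 \<Otimes>\<^sub>M M2) p2) = (LINT s|M1. LINT t|M2. p2 (s, t))"
    using p2i by (intro integral_fst'[symmetric])
  also have "\<dots> = (LINT s:{0..<x}|M1. (G s - G 0) * f s)"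
    unfolding set_lebesgue_integral_def
  proof (rule Bochner_Integration.integral_cong[OF refl])
    fix s assume "s \<in> space M1"
    show "(LINT t|M2. p2 (s, t)) = indicat_real {0..<x} s *\<^sub>R ((G s - G 0) * f s)"
    proof (cases "s \<in> {0..<x}")
      case True
      then have s: "s \<in> Ico0 b" using x Ico0_downward[of x b s] by auto
      have "(LINT t|M2. p2 (s, t)) = (LINT t:{0..<s}|M2. g t * f s)"
        unfolding set_lebesgue_integral_def by (rule Bochner_Integration.integral_cong)
          (use True in \<open>auto simp: p2_def a_def c_def indicator_def m2.space_M Ico0_nonneg\<close>)
      also have "\<dots> = (LINT t:{0..<s}|M2. g t) * f s" by simp
      also have "\<dots> = (G s - G 0) * f s" using primitive_at(1)[OF G s] by simp
      finally show ?thesis using True by simp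
    next
      case False
      then have "a s = 0" by (simp add: a_def)
      then show ?thesis using False by (simp add: p2_def cong: if_cong)
    qed
  qed
  finally have P2: "(integral\<^sup>L (M1 \<Otimes>\<^sub>M M2) p2) = (LINT s:{0..<x}|M1. (G s - G 0) * f s)" .
  have "(F x - F 0) * (G x - G 0) = (LINT s|M1. a s) * (LINT t|M2. c t)"
    using primitive_at(1)[OF F x] primitive_at(1)[OF G x]
    unfolding a_def c_def set_lebesgue_integral_def by simp
  also have "\<dots> = (LINT s|M1. LINT t|M2. p (s, t))" by (simp add: p_def)
  also have "\<dots> = (integral\<^sup>L (M1 \<Otimes>\<^sub>M M2) p)" by (rule integral_fst'[OF pint])
  also have "\<dots> = (\<integral>p'. p1 p' + p2 p' \<partial>(M1 \<Otimes>\<^sub>M M2))"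
  proof (rule integral_cong_AE)
    show "AE p' in M1 \<Otimes>\<^sub>M M2. p p' = p1 p' + p2 p'"
      using AE_off_diagonal by eventually_elim (auto simp: p_def p1_def p2_def)
  qed measurable
  also have "\<dots> = (LINT t:{0..<x}|M2. (F t - F 0) * g t) + (LINT s:{0..<x}|M1. (G s - G 0) * f s)"
    using p1i p2i P1 P2 by simp
  also have "(LINT t:{0..<x}|M2. (F t - F 0) * g t) = (LINT t:{0..<x}|M2. F t * g t) - F 0 * (G x - G 0)"
    using set_integral_diff(2)[OF Fg set_integrable_mult_right[OF gi, of "F 0"]] primitive_at(1)[OF G x]
    by (simp add: left_diff_distrib)
  also have "(LINT s:{0..<x}|M1. (G s - G 0) * f s) = (LINT s:{0..<x}|M1. G s * f s) - G 0 * (F x - F 0)"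
    using set_integral_diff(2)[OF Gf set_integrable_mult_right[OF fi, of "G 0"]] primitive_at(1)[OF F x]
    by (simp add: left_diff_distrib)
  finally show "F x * G x - F 0 * G 0 = (LINT t:{0..<x}|M2. F t * g t) + (LINT t:{0..<x}|M1. G t * f t)"
    by (simp add: algebra_simps)
qed

end

section \<open>Existence of solutions\<close>

context initial_finite_measure
begin

text \<open>
  The measure of the set of all \<open>(t\<^sub>1, \<dots>, t\<^sub>n)\<close> with \<open>t\<^sub>1 < \<dots> < t\<^sub>n < x\<close> under the \<open>n\<close>-fold product
  measure. It bounds the Picard iterates.
\<close>
primrec ordered_volume :: "nat \<Rightarrow> real \<Rightarrow> ennreal" where
  "ordered_volume 0 x = 1"
| "ordered_volume (Suc n) x = (\<integral>\<^sup>+t\<in>{0..<x}. ordered_volume n t \<partial>M)"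

lemma nn_initial_integral_measurable:
  assumes [measurable]: "h \<in> borel_measurable M"
  shows "(\<lambda>x. \<integral>\<^sup>+t\<in>{0..<x}. h t \<partial>M) \<in> borel_measurable M"
proof -
  have "(\<lambda>x. \<integral>\<^sup>+t. (if t < x then h t else 0) \<partial>M) \<in> borel_measurable M"
    by (rule sigma_finite_measure.borel_measurable_nn_integral[OF sigma_finite])
      (simp add: case_prod_unfold)
  moreover have "(\<integral>\<^sup>+t\<in>{0..<x}. h t \<partial>M) = (\<integral>\<^sup>+t. (if t < x then h t else 0) \<partial>M)" for x
    by (rule nn_integral_cong) (auto simp: indicator_def space_M Ico0_nonneg)
  ultimately show ?thesis by simp
qed

lemma ordered_volume_measurable [measurable]: "ordered_volume n \<in> borel_measurable M"
proof (induction n)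
  case 0
  have "ordered_volume 0 = (\<lambda>_. 1)" by auto
  then show ?case by simp
next
  case (Suc n)
  have "ordered_volume (Suc n) = (\<lambda>x. \<integral>\<^sup>+t\<in>{0..<x}. ordered_volume n t \<partial>M)" by auto
  then show ?case using nn_initial_integral_measurable[OF Suc] by simp
qed

text \<open>
  Inserting a further point below \<open>x\<close> into an ordered tuple of length \<open>n\<close> gives at least each ordered
  tuple of length \<open>n + 1\<close>, each one in \<open>n + 1\<close> ways. In the induction step the new point is
  compared with the largest point \<open>s\<close> of the tuple only: if it lies below \<open>s\<close> the induction hypothesis
  applies, if above the enlarged tuple is ordered already. Equality may fail because of atoms.
\<close>
lemma ordered_volume_Suc_le:
  assumes "x \<in> Ico0 b"
  shows "of_nat (Suc n) * ordered_volume (Suc n) x \<le> ordered_volume n x * emeasure M {0..<x}"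
  using assms
proof (induction n arbitrary: x)
  case 0
  then show ?case by (simp add: sets_Ico)
next
  case (Suc n)
  interpret sigma_finite_measure M by (rule sigma_finite)
  interpret pair_sigma_finite M M by unfold_locales
  have [measurable]: "{0..<x} \<in> sets M" using Suc.prems sets_Ico by simp
  have sub: "t \<in> Ico0 b" if "t \<in> {0..<x}" for t using that Suc.prems Ico0_downward by auto
  let ?a = "\<lambda>s. ordered_volume n s * indicator {0..<x} s"
  have "of_nat (Suc (Suc n)) * ordered_volume (Suc (Suc n)) x
      = (\<integral>\<^sup>+s\<in>{0..<x}. of_nat (Suc n) * ordered_volume (Suc n) s \<partial>M)
        + (\<integral>\<^sup>+t\<in>{0..<x}. ordered_volume (Suc n) t \<partial>M)"
    by (simp only: ordered_volume.simps(2)[of "Suc n"] mult.assoc of_nat_Suc[of "Suc n"] distrib_right)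
      (simp add: nn_integral_cmult mult.assoc add.commute del: of_nat_Suc ordered_volume.simps)
  also have "\<dots> \<le> (\<integral>\<^sup>+s. ?a s * emeasure M {0..<s} \<partial>M)
        + (\<integral>\<^sup>+t\<in>{0..<x}. ordered_volume (Suc n) t \<partial>M)"
    by (intro add_right_mono nn_integral_mono)
      (use Suc.IH sub in \<open>auto simp: indicator_def simp del: ordered_volume.simps of_nat_Suc\<close>)
  also have "(\<integral>\<^sup>+s. ?a s * emeasure M {0..<s} \<partial>M) = (\<integral>\<^sup>+s. \<integral>\<^sup>+t. ?a s * (if t < s then 1 else 0) \<partial>M \<partial>M)"
  proof (rule nn_integral_cong)
    fix s assume s: "s \<in> space M"
    have "(\<integral>\<^sup>+t. ?a s * (if t < s then 1 else 0) \<partial>M) = (\<integral>\<^sup>+t. ?a s * indicator {0..<s} t \<partial>M)"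
      by (rule nn_integral_cong) (auto simp: indicator_def space_M Ico0_nonneg)
    also have "\<dots> = ?a s * emeasure M {0..<s}"
      using s by (intro nn_integral_cmult_indicator sets_Ico) (auto simp: space_M)
    finally show "?a s * emeasure M {0..<s} = (\<integral>\<^sup>+t. ?a s * (if t < s then 1 else 0) \<partial>M)" by simp
  qed
  also have "\<dots> = (\<integral>\<^sup>+t. \<integral>\<^sup>+s. ?a s * (if t < s then 1 else 0) \<partial>M \<partial>M)"
    by (rule Fubini') simp
  also have "\<dots> = (\<integral>\<^sup>+t\<in>{0..<x}. (\<integral>\<^sup>+s. ?a s * (if t < s then 1 else 0) \<partial>M) \<partial>M)"
  proof (rule nn_integral_cong)
    fix t assume "t \<in> space M"
    then have "0 \<le> t" by (simp add: space_M Ico0_nonneg)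
    then have "(\<integral>\<^sup>+s. ?a s * (if t < s then 1 else 0) \<partial>M) = 0" if "t \<notin> {0..<x}"
      using that by (subst nn_integral_cong[where v = "\<lambda>_. 0"]) (auto simp: indicator_def)
    then show "(\<integral>\<^sup>+s. ?a s * (if t < s then 1 else 0) \<partial>M)
      = (\<integral>\<^sup>+s. ?a s * (if t < s then 1 else 0) \<partial>M) * indicator {0..<x} t"
      by (cases "t \<in> {0..<x}") auto
  qed
  also have "\<dots> + (\<integral>\<^sup>+t\<in>{0..<x}. ordered_volume (Suc n) t \<partial>M)
      = (\<integral>\<^sup>+t. ((\<integral>\<^sup>+s. ?a s * (if t < s then 1 else 0) \<partial>M) * indicator {0..<x} t
          + ordered_volume (Suc n) t * indicator {0..<x} t) \<partial>M)"
    by (rule nn_integral_add[symmetric]) (simp_all del: ordered_volume.simps)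
  also have "\<dots> \<le> (\<integral>\<^sup>+t. ordered_volume (Suc n) x * indicator {0..<x} t \<partial>M)"
  proof (rule nn_integral_mono)
    fix t assume t: "t \<in> space M"
    show "(\<integral>\<^sup>+s. ?a s * (if t < s then 1 else 0) \<partial>M) * indicator {0..<x} t
        + ordered_volume (Suc n) t * indicator {0..<x} t \<le> ordered_volume (Suc n) x * indicator {0..<x} t"
    proof (cases "t \<in> {0..<x}")
      case True
      have [measurable]: "{0..<t} \<in> sets M" using sub[OF True] sets_Ico by simp
      have "(\<integral>\<^sup>+s. ?a s * (if t < s then 1 else 0) \<partial>M) + ordered_volume (Suc n) t
        = (\<integral>\<^sup>+s. ?a s * (if t < s then 1 else 0) + ordered_volume n s * indicator {0..<t} s \<partial>M)"
        unfolding ordered_volume.simps by (rule nn_integral_add[symmetric]) simp_all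
      also have "\<dots> \<le> ordered_volume (Suc n) x"
        unfolding ordered_volume.simps by (rule nn_integral_mono) (use True in \<open>auto simp: indicator_def\<close>)
      finally show ?thesis using True by simp
    qed simp
  qed
  also have "\<dots> = ordered_volume (Suc n) x * emeasure M {0..<x}"
    by (rule nn_integral_cmult_indicator) simp
  finally show ?case .
qed

lemma ordered_volume_le:
  assumes "x \<in> Ico0 b"
  shows "ordered_volume n x \<le> ennreal (cum x ^ n / fact n)"
proof (induction n)
  case (Suc n)
  have "ennreal (real (Suc n)) * ordered_volume (Suc n) x \<le> ordered_volume n x * ennreal (cum x)"
    using ordered_volume_Suc_le[OF assms, of n] emeasure_Ico[of 0 x] assms
    by (simp add: cum_def Ico0_nonneg ennreal_of_nat_eq_real_of_nat del: ordered_volume.simps)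
  also have "\<dots> \<le> ennreal (cum x ^ n / fact n) * ennreal (cum x)"
    using Suc by (rule mult_right_mono) simp
  also have "\<dots> = ennreal (real (Suc n)) * ennreal (cum x ^ Suc n / fact (Suc n))"
    using cum_nonneg[of x] by (simp add: ennreal_mult[symmetric] field_simps del: of_nat_Suc)
  finally show ?case
    using ennreal_mult_le_mult_iff[of "ennreal (real (Suc n))"] by (simp del: ordered_volume.simps)
qed simp

end

definition locally_bounded :: "ereal \<Rightarrow> (real \<Rightarrow> complex) \<Rightarrow> bool" where
  "locally_bounded b g \<longleftrightarrow> (\<forall>X\<in>Ico0 b. \<exists>C. \<forall>x\<in>{0..X}. cmod (g x) \<le> C)"

lemma locally_bounded_const: "locally_bounded b (\<lambda>_. c)"
  by (auto simp: locally_bounded_def)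

lemma locally_bounded_add:
  assumes "locally_bounded b f" "locally_bounded b g"
  shows "locally_bounded b (\<lambda>x. f x + g x)"
  unfolding locally_bounded_def
proof
  fix X assume X: "X \<in> Ico0 b"
  obtain C D where "\<forall>x\<in>{0..X}. cmod (f x) \<le> C" "\<forall>x\<in>{0..X}. cmod (g x) \<le> D"
    using assms X unfolding locally_bounded_def by meson
  then have "\<forall>x\<in>{0..X}. cmod (f x + g x) \<le> C + D"
    by (auto intro: norm_triangle_mono)
  then show "\<exists>C. \<forall>x\<in>{0..X}. cmod (f x + g x) \<le> C" ..
qed

lemma locally_bounded_cmult:
  assumes "locally_bounded b g" shows "locally_bounded b (\<lambda>x. c * g x)"
  unfolding locally_bounded_def
proof
  fix X assume X: "X \<in> Ico0 b"
  obtain C where "\<forall>x\<in>{0..X}. cmod (g x) \<le> C"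
    using assms X unfolding locally_bounded_def by meson
  then have "\<forall>x\<in>{0..X}. cmod (c * g x) \<le> cmod c * C"
    by (auto simp: norm_mult intro: mult_left_mono)
  then show "\<exists>C. \<forall>x\<in>{0..X}. cmod (c * g x) \<le> C" ..
qed

definition integral_fun :: "real measure \<Rightarrow> (real \<Rightarrow> complex) \<Rightarrow> real \<Rightarrow> complex" where
  "integral_fun M g x = (LINT t:{0..<x}|M. g t)"

lemma integral_fun_0 [simp]: "integral_fun M g 0 = 0"
  by (simp add: integral_fun_def set_lebesgue_integral_def)

context initial_finite_measure
begin

lemma set_integrable_locally_bounded:
  assumes "g \<in> borel_measurable M" "locally_bounded b g" "x \<in> Ico0 b"
  shows "set_integrable M {0..<x} g"
proof -
  obtain C where "\<forall>t\<in>{0..x}. cmod (g t) \<le> C"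
    using assms unfolding locally_bounded_def by meson
  then show ?thesis by (intro set_integrable_bounded[OF assms(1,3), of C]) auto
qed

lemma primitive_integral_fun:
  assumes "g \<in> borel_measurable M" "locally_bounded b g"
  shows "primitive b M g (integral_fun M g)"
  using assms set_integrable_locally_bounded[OF assms] unfolding primitive_def
  by (simp, simp add: integral_fun_def)

lemma primitive_locally_bounded: "primitive b M f F \<Longrightarrow> locally_bounded b F"
  unfolding locally_bounded_def by (metis atLeastAtMost_iff primitive_bounded)

lemma cmod_integral_fun_le:
  assumes "set_integrable M {0..<x} g"
  shows "ennreal (cmod (integral_fun M g x)) \<le> (\<integral>\<^sup>+t\<in>{0..<x}. ennreal (cmod (g t)) \<partial>M)"
proof -
  have "ennreal (cmod (integral_fun M g x)) \<le> (\<integral>\<^sup>+t. ennreal (norm (indicat_real {0..<x} t *\<^sub>R g t)) \<partial>M)"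
    using assms unfolding set_integrable_def set_lebesgue_integral_def integral_fun_def
    by (rule integral_norm_bound_ennreal)
  also have "\<dots> = (\<integral>\<^sup>+t\<in>{0..<x}. ennreal (cmod (g t)) \<partial>M)"
    by (rule nn_integral_cong) (auto simp: indicator_def)
  finally show ?thesis .
qed

lemma integral_fun_bounded_convergence:
  assumes "\<And>n. g n \<in> borel_measurable M" "g' \<in> borel_measurable M" and x: "x \<in> Ico0 b"
    and B: "\<And>n t. t \<in> {0..<x} \<Longrightarrow> cmod (g n t) \<le> B"
    and lim: "\<And>t. t \<in> {0..<x} \<Longrightarrow> (\<lambda>n. g n t) \<longlonglongrightarrow> g' t"
  shows "(\<lambda>n. integral_fun M (g n) x) \<longlonglongrightarrow> integral_fun M g' x"
  unfolding integral_fun_def set_lebesgue_integral_def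
proof (rule integral_dominated_convergence[where w = "\<lambda>t. B * indicat_real {0..<x} t"])
  have [measurable]: "{0..<x} \<in> sets M" using x sets_Ico by simp
  note assms(1,2)[measurable]
  show "(\<lambda>t. indicat_real {0..<x} t *\<^sub>R g n t) \<in> borel_measurable M" for n by measurable
  show "(\<lambda>t. indicat_real {0..<x} t *\<^sub>R g' t) \<in> borel_measurable M" by measurable
  show "integrable M (\<lambda>t. B * indicat_real {0..<x} t)"
    using finite_initial[OF x] by (intro integrable_mult_right integrable_real_indicator) (auto simp: less_top)
  show "AE t in M. (\<lambda>n. indicat_real {0..<x} t *\<^sub>R g n t) \<longlonglongrightarrow> indicat_real {0..<x} t *\<^sub>R g' t"
    using lim by (intro AE_I2) (auto simp: indicator_def)
  show "AE t in M. norm (indicat_real {0..<x} t *\<^sub>R g n t) \<le> B * indicat_real {0..<x} t" for n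
    using B by (intro AE_I2) (auto simp: indicator_def)
qed

end

context initial_finite_pair
begin

text \<open>
  The terms of the Neumann series of the integral equation for \<open>u\<^sub>1\<close> alone; the second component of the
  solution is recovered afterwards.
\<close>
primrec picard :: "complex \<Rightarrow> complex \<Rightarrow> complex \<Rightarrow> nat \<Rightarrow> real \<Rightarrow> complex" where
  "picard z c1 c2 0 x = c1 + c2 * integral_fun M1 (\<lambda>_. 1) x"
| "picard z c1 c2 (Suc n) x = - z * integral_fun M1 (integral_fun M2 (picard z c1 c2 n)) x"

lemma integral_fun_1:
  assumes "g \<in> borel_measurable M1" "locally_bounded b g"
  shows "integral_fun M1 g \<in> borel_measurable M1" "locally_bounded b (integral_fun M1 g)"
  using m1.primitive_integral_fun[OF assms] m1.primitive_measurable m1.primitive_locally_bounded by blast+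

lemma integral_fun_2:
  assumes "g \<in> borel_measurable M1" "locally_bounded b g"
  shows "integral_fun M2 g \<in> borel_measurable M1" "locally_bounded b (integral_fun M2 g)"
  using m2.primitive_integral_fun[of g] m2.primitive_measurable m2.primitive_locally_bounded assms
  unfolding measurable_12 by blast+

lemma picard_regular: "picard z c1 c2 n \<in> borel_measurable M1 \<and> locally_bounded b (picard z c1 c2 n)"
proof (induction n)
  case 0
  have "picard z c1 c2 0 = (\<lambda>x. c1 + c2 * integral_fun M1 (\<lambda>_. 1) x)" by auto
  then show ?case
    using integral_fun_1[OF _ locally_bounded_const, of 1]
    by (auto intro!: locally_bounded_add locally_bounded_cmult locally_bounded_const)
next
  case (Suc n)
  have *: "picard z c1 c2 (Suc n) = (\<lambda>x. - z * integral_fun M1 (integral_fun M2 (picard z c1 c2 n)) x)"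
    by auto
  have "integral_fun M1 (integral_fun M2 (picard z c1 c2 n)) \<in> borel_measurable M1"
    "locally_bounded b (integral_fun M1 (integral_fun M2 (picard z c1 c2 n)))"
    using Suc integral_fun_1 integral_fun_2 by auto
  then show ?case
    unfolding * using locally_bounded_cmult[of b _ "- z"] by auto
qed

text \<open>
  For the outer integration only the total mass of \<open>[0,X)\<close> is used; iterating the inner one produces
  the ordered volumes of the second measure and with them the factorial.
\<close>
lemma picard_bound:
  assumes X: "X \<in> Ico0 b" and C: "\<And>x. x \<in> {0..X} \<Longrightarrow> cmod (picard z c1 c2 0 x) \<le> C"
    and x: "x \<in> {0..X}"
  shows "cmod (picard z c1 c2 n x) \<le> C * ((cmod z * m1.cum X * m2.cum X) ^ n / fact n)"
proof -
  have C0: "0 \<le> C" using C[OF x] norm_ge_zero order_trans by blast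
  define K where "K = cmod z * m1.cum X"
  have K: "0 \<le> K" unfolding K_def using m1.cum_nonneg by simp
  have inI: "x \<in> Ico0 b" if "x \<in> {0..X}" for x using that X Ico0_downward by auto
  have "ennreal (cmod (picard z c1 c2 n x)) \<le> ennreal (C * K ^ n) * m2.ordered_volume n x"
    if "x \<in> {0..X}" for x
    using that
  proof (induction n arbitrary: x)
    case 0
    then show ?case using C[of x] C0 by (simp add: ennreal_leI del: picard.simps)
  next
    case (Suc n)
    let ?p = "picard z c1 c2 n" and ?A = "ennreal (C * K ^ n)"
    have reg: "?p \<in> borel_measurable M1" "?p \<in> borel_measurable M2" "locally_bounded b ?p"
      using picard_regular measurable_12 by auto
    have [measurable]: "{0..<x} \<in> sets M1" "{0..<x} \<in> sets M2"
      using inI[OF Suc.prems] m1.sets_Ico m2.sets_Ico by auto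
    have "ennreal (cmod (integral_fun M2 ?p t)) \<le> ?A * m2.ordered_volume (Suc n) x" if "t \<in> {0..<x}" for t
    proof -
      have t: "t \<in> {0..X}" "t \<le> x" using that Suc.prems by auto
      have "ennreal (cmod (integral_fun M2 ?p t)) \<le> (\<integral>\<^sup>+s\<in>{0..<t}. ennreal (cmod (?p s)) \<partial>M2)"
        by (intro m2.cmod_integral_fun_le m2.set_integrable_locally_bounded reg inI t)
      also have "\<dots> \<le> (\<integral>\<^sup>+s\<in>{0..<x}. ?A * m2.ordered_volume n s \<partial>M2)"
        by (rule nn_integral_mono) (use Suc.IH t Suc.prems in \<open>auto simp: indicator_def\<close>)
      also have "\<dots> = ?A * m2.ordered_volume (Suc n) x"
        by (simp add: mult.assoc nn_integral_cmult)
      finally show ?thesis .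
    qed
    note inner = this
    have "ennreal (cmod (integral_fun M1 (integral_fun M2 ?p) x))
        \<le> (\<integral>\<^sup>+t\<in>{0..<x}. ennreal (cmod (integral_fun M2 ?p t)) \<partial>M1)"
      by (intro m1.cmod_integral_fun_le m1.set_integrable_locally_bounded integral_fun_2 reg inI Suc.prems)
    also have "\<dots> \<le> (\<integral>\<^sup>+t\<in>{0..<x}. ?A * m2.ordered_volume (Suc n) x \<partial>M1)"
      by (rule nn_integral_mono) (use inner in \<open>auto simp: indicator_def simp del: m2.ordered_volume.simps\<close>)
    also have "\<dots> = ?A * m2.ordered_volume (Suc n) x * emeasure M1 {0..<x}"
      by (rule nn_integral_cmult_indicator) simp
    also have "emeasure M1 {0..<x} \<le> ennreal (m1.cum X)"
      using m1.emeasure_Ico[of 0 x] inI[OF Suc.prems] Suc.prems m1.cum_mono[of x X] X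
      by (auto simp: m1.cum_def intro!: ennreal_leI)
    finally have *: "ennreal (cmod (integral_fun M1 (integral_fun M2 ?p) x))
        \<le> ?A * m2.ordered_volume (Suc n) x * ennreal (m1.cum X)"
      by (simp add: mult_left_mono del: m2.ordered_volume.simps)
    have "ennreal (cmod (picard z c1 c2 (Suc n) x))
        = ennreal (cmod z) * ennreal (cmod (integral_fun M1 (integral_fun M2 ?p) x))"
      by (simp add: norm_mult ennreal_mult)
    also have "\<dots> \<le> ennreal (cmod z) * (?A * m2.ordered_volume (Suc n) x * ennreal (m1.cum X))"
      by (rule mult_left_mono[OF *]) simp
    also have "\<dots> = (ennreal (cmod z) * ?A * ennreal (m1.cum X)) * m2.ordered_volume (Suc n) x"
      by (simp only: ac_simps)
    also have "ennreal (cmod z) * ?A * ennreal (m1.cum X) = ennreal (C * K ^ Suc n)"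
      using C0 K m1.cum_nonneg[of X] by (simp add: ennreal_mult[symmetric] K_def ac_simps)
    finally show ?case .
  qed
  note * = this[OF x]
  have "m2.ordered_volume n x \<le> ennreal (m2.cum X ^ n / fact n)"
    using m2.ordered_volume_le[OF inI[OF x], of n] x X m2.cum_mono[of x X] m2.cum_nonneg[of x]
    by (auto intro!: order_trans[OF m2.ordered_volume_le[OF inI[OF x], of n]] ennreal_leI
        divide_right_mono power_mono)
  then have "ennreal (cmod (picard z c1 c2 n x)) \<le> ennreal (C * K ^ n) * ennreal (m2.cum X ^ n / fact n)"
    using * by (meson mult_left_mono order_trans zero_le)
  also have "\<dots> = ennreal (C * ((K * m2.cum X) ^ n / fact n))"
    using C0 K m2.cum_nonneg[of X]
    by (simp add: ennreal_mult[symmetric] power_mult_distrib)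
  finally show ?thesis
    unfolding K_def[symmetric] using C0 K m2.cum_nonneg[of X] by (subst (asm) ennreal_le_iff) auto
qed

definition solution :: "complex \<Rightarrow> (real \<Rightarrow> complex) \<Rightarrow> (real \<Rightarrow> complex) \<Rightarrow> bool" where
  "solution z u1 u2 \<longleftrightarrow> primitive b M1 u2 u1 \<and> primitive b M2 (\<lambda>t. - (z * u1 t)) u2"

text \<open>
  Summing the Picard iterates gives \<open>u\<^sub>1 = c\<^sub>1 + c\<^sub>2 R\<^sub>1 - z J\<^sub>1 J\<^sub>2 u\<^sub>1\<close>, where \<open>J\<^sub>i\<close> integrates against the
  \<open>i\<close>-th measure. The series is dominated on every \<open>[0,X]\<close> by an exponential series, so bounded
  convergence permits to integrate it term by term.
\<close>
theorem solution_exists: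
  obtains u1 u2 where "solution z u1 u2" "u1 0 = c1" "u2 0 = c2"
proof -
  let ?p = "picard z c1 c2"
  let ?S = "\<lambda>N x. \<Sum>n<N. ?p n x"
  define u1 where "u1 x = (\<Sum>n. ?p n x)" for x
  define u2 where "u2 x = c2 - z * integral_fun M2 u1 x" for x
  have bound: "\<exists>B. \<forall>x\<in>{0..X}. summable (\<lambda>n. ?p n x) \<and> cmod (u1 x) \<le> B \<and> (\<forall>N. cmod (?S N x) \<le> B)"
    if X: "X \<in> Ico0 b" for X
  proof -
    obtain C where C: "\<And>x. x \<in> {0..X} \<Longrightarrow> cmod (?p 0 x) \<le> C"
      using picard_regular X unfolding locally_bounded_def by meson
    have C0: "0 \<le> C" using order_trans[OF norm_ge_zero C[of 0]] Ico0_nonneg[OF X] by simp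
    define q where "q = cmod z * m1.cum X * m2.cum X"
    have q: "0 \<le> q" unfolding q_def using m1.cum_nonneg m2.cum_nonneg by simp
    have sums: "(\<lambda>n. C * (q ^ n / fact n)) sums (C * exp q)"
      using exp_converges[of q] by (intro sums_mult) (simp add: divide_inverse mult.commute)
    have "summable (\<lambda>n. ?p n x) \<and> cmod (u1 x) \<le> C * exp q \<and> (\<forall>N. cmod (?S N x) \<le> C * exp q)"
      if x: "x \<in> {0..X}" for x
    proof -
      have le: "cmod (?p n x) \<le> C * (q ^ n / fact n)" for n
        using picard_bound[OF X C x] unfolding q_def by blast
      have s: "summable (\<lambda>n. norm (?p n x))"
        by (rule summable_comparison_test'[OF sums_summable[OF sums]]) (use le in auto)
      have "cmod (?S N x) \<le> C * exp q" for N
      proof -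
        have "cmod (?S N x) \<le> (\<Sum>n<N. C * (q ^ n / fact n))"
          by (rule order_trans[OF norm_sum sum_mono[OF le]])
        also have "\<dots> \<le> C * exp q"
          unfolding sums_unique[OF sums]
          by (rule sum_le_suminf[OF sums_summable[OF sums]]) (use C0 q in auto)
        finally show ?thesis .
      qed
      moreover have "cmod (u1 x) \<le> C * exp q"
        using summable_norm[OF s] suminf_le[OF le s sums_summable[OF sums]] sums_unique[OF sums]
        unfolding u1_def by simp
      ultimately show ?thesis using summable_norm_cancel[OF s] by blast
    qed
    then show ?thesis by blast
  qed
  have lim: "(\<lambda>N. ?S N x) \<longlonglongrightarrow> u1 x" if "x \<in> Ico0 b" for x
    using bound[OF that] that unfolding u1_def
    by (metis Ico0_nonneg atLeastAtMost_iff order_refl summable_LIMSEQ)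
  have pm: "?p n \<in> borel_measurable M1" for n using picard_regular by blast
  have Sm: "?S N \<in> borel_measurable M1" for N using pm by (intro borel_measurable_sum) auto
  have Slb: "locally_bounded b (?S N)" for N
    unfolding locally_bounded_def using bound by meson
  have u1m: "u1 \<in> borel_measurable M1"
    by (rule borel_measurable_LIMSEQ_metric[of "?S"]) (use Sm lim in \<open>auto simp: m1.space_M\<close>)
  have u1lb: "locally_bounded b u1" unfolding locally_bounded_def using bound by meson
  have u2m: "u2 \<in> borel_measurable M1" and u2lb: "locally_bounded b u2"
    using integral_fun_2[OF u1m u1lb] locally_bounded_add[OF locally_bounded_const[of b c2]
        locally_bounded_cmult[OF integral_fun_2(2)[OF u1m u1lb], of "- z"]]
    unfolding u2_def by simp_all
  have p2: "primitive b M2 (\<lambda>t. - (z * u1 t)) u2"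
    using primitive_add_const[OF primitive_cmult[OF m2.primitive_integral_fun[of u1], of "- z"], of c2]
      u1m u1lb unfolding measurable_12 u2_def by simp
  have u1_eq: "u1 x = c1 + integral_fun M1 u2 x" if x: "x \<in> Ico0 b" for x
  proof -
    obtain B where B: "\<And>t N. t \<in> {0..x} \<Longrightarrow> cmod (?S N t) \<le> B"
      using bound[OF x] by meson
    have inI: "t \<in> Ico0 b" if "t \<in> {0..x}" for t using that x Ico0_downward by auto
    have inner: "(\<lambda>N. integral_fun M2 (?S N) t) \<longlonglongrightarrow> integral_fun M2 u1 t" if t: "t \<in> {0..x}" for t
      by (rule m2.integral_fun_bounded_convergence[where B = B])
        (use Sm u1m inI B lim t in \<open>auto simp: measurable_12\<close>)
    have B': "cmod (integral_fun M2 (?S N) t) \<le> B * m2.cum x" if t: "t \<in> {0..<x}" for N t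
    proof -
      have B0: "0 \<le> B" using B[of 0 0] t by simp
      have [measurable]: "{0..<t} \<in> sets M2" using inI t m2.sets_Ico by auto
      have "ennreal (cmod (integral_fun M2 (?S N) t)) \<le> (\<integral>\<^sup>+s\<in>{0..<t}. ennreal (cmod (?S N s)) \<partial>M2)"
        by (intro m2.cmod_integral_fun_le m2.set_integrable_locally_bounded)
          (use Sm Slb inI t in \<open>auto simp: measurable_12\<close>)
      also have "\<dots> \<le> (\<integral>\<^sup>+s\<in>{0..<t}. ennreal B \<partial>M2)"
        by (rule nn_integral_mono) (use B t in \<open>auto simp: indicator_def intro!: ennreal_leI\<close>)
      also have "\<dots> = ennreal B * emeasure M2 {0..<t}" by (rule nn_integral_cmult_indicator) simp
      also have "emeasure M2 {0..<t} = ennreal (m2.cum t)"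
        using m2.emeasure_Ico[of 0 t] inI[of t] t by (simp add: m2.cum_def)
      also have "ennreal B * ennreal (m2.cum t) \<le> ennreal (B * m2.cum x)"
        using B0 m2.cum_nonneg[of t] m2.cum_mono[of t x] x t
        by (auto simp: ennreal_mult[symmetric] intro!: ennreal_leI mult_left_mono)
      finally show ?thesis using B0 m2.cum_nonneg[of x] by (subst (asm) ennreal_le_iff) auto
    qed
    have I2S: "integral_fun M2 (?S N) \<in> borel_measurable M1" for N
      using integral_fun_2[OF Sm Slb] by blast
    have outer: "(\<lambda>N. integral_fun M1 (integral_fun M2 (?S N)) x) \<longlonglongrightarrow> integral_fun M1 (integral_fun M2 u1) x"
      by (rule m1.integral_fun_bounded_convergence[where B = "B * m2.cum x"])
        (use I2S integral_fun_2[OF u1m u1lb] B' inner x in auto)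
    have lin2: "integral_fun M2 (?S N) t = (\<Sum>n<N. integral_fun M2 (?p n) t)" if "t \<in> Ico0 b" for N t
      unfolding integral_fun_def set_lebesgue_integral_def scaleR_sum_right
    proof (rule Bochner_Integration.integral_sum)
      show "integrable M2 (\<lambda>s. indicat_real {0..<t} s *\<^sub>R ?p n s)" for n
        using m2.set_integrable_locally_bounded[of "?p n" t] picard_regular[of z c1 c2 n] that
        unfolding measurable_12 set_integrable_def by blast
    qed
    have lin1: "integral_fun M1 (integral_fun M2 (?S N)) x = (\<Sum>n<N. integral_fun M1 (integral_fun M2 (?p n)) x)" for N
    proof -
      have "integral_fun M1 (integral_fun M2 (?S N)) x = (LINT t|M1. (\<Sum>n<N. indicat_real {0..<x} t *\<^sub>R integral_fun M2 (?p n) t))"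
        unfolding integral_fun_def[of M1] set_lebesgue_integral_def
        by (rule Bochner_Integration.integral_cong) (auto simp: lin2 m1.space_M scaleR_sum_right)
      also have "\<dots> = (\<Sum>n<N. integral_fun M1 (integral_fun M2 (?p n)) x)"
        unfolding integral_fun_def[of M1] set_lebesgue_integral_def
      proof (rule Bochner_Integration.integral_sum)
        show "integrable M1 (\<lambda>s. indicat_real {0..<x} s *\<^sub>R integral_fun M2 (?p n) s)" for n
          using m1.set_integrable_locally_bounded[OF _ _ x] integral_fun_2[of "?p n"] picard_regular[of z c1 c2 n]
          unfolding set_integrable_def by blast
      qed
      finally show ?thesis .
    qed
    have "?S (Suc N) x = ?p 0 x - z * integral_fun M1 (integral_fun M2 (?S N)) x" for N
      unfolding sum.lessThan_Suc_shift lin1 by (simp add: sum_distrib_left sum_negf)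
    moreover have "(\<lambda>N. ?p 0 x - z * integral_fun M1 (integral_fun M2 (?S N)) x)
        \<longlonglongrightarrow> ?p 0 x - z * integral_fun M1 (integral_fun M2 u1) x"
      by (intro tendsto_intros outer)
    ultimately have "(\<lambda>N. ?S (Suc N) x) \<longlonglongrightarrow> ?p 0 x - z * integral_fun M1 (integral_fun M2 u1) x"
      by simp
    moreover have "(\<lambda>N. ?S (Suc N) x) \<longlonglongrightarrow> u1 x" using LIMSEQ_Suc[OF lim[OF x]] .
    ultimately have 1: "u1 x = ?p 0 x - z * integral_fun M1 (integral_fun M2 u1) x"
      using LIMSEQ_unique by blast
    have "set_integrable M1 {0..<x} (\<lambda>_. 1 :: complex)"
      "set_integrable M1 {0..<x} (integral_fun M2 u1)"
      using m1.set_integrable_locally_bounded[OF _ _ x] integral_fun_2[OF u1m u1lb] locally_bounded_const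
      by auto
    note int = set_integrable_mult_right[of c2, OF this(1)] set_integrable_mult_right[of z, OF this(2)]
    have "(LINT t:{0..<x}|M1. c2) = c2 * (LINT t:{0..<x}|M1. 1)"
      using set_integral_mult_right[of M1 "{0..<x}" c2 "\<lambda>_. 1"] by simp
    then have "integral_fun M1 u2 x = c2 * integral_fun M1 (\<lambda>_. 1) x - z * integral_fun M1 (integral_fun M2 u1) x"
      using set_integral_diff(2)[OF int] unfolding u2_def integral_fun_def[of M1] by simp
    then show ?thesis using 1 by simp
  qed
  have z0: "0 \<in> Ico0 b" using zero_in_Ico0 m1.b_pos by blast
  have u10: "u1 0 = c1" using u1_eq[OF z0] by simp
  moreover have "u2 0 = c2" by (simp add: u2_def)
  moreover have "primitive b M1 u2 u1"
    unfolding primitive_def u10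
    using u1_eq primitive_at(2)[OF m1.primitive_integral_fun[OF u2m u2lb]] u2m
    by (simp add: integral_fun_def)
  ultimately show ?thesis using that p2 unfolding solution_def by blast
qed

end

section \<open>Classes of square integrable functions\<close>

lemma sq_integrable_iff_energy:
  "f \<in> sq_integrable M \<longleftrightarrow> f \<in> borel_measurable M \<and> energy M UNIV f < \<infinity>"
  by (simp add: sq_integrable_def energy_def)

lemma sq_integrable_zero: "(\<lambda>_. 0) \<in> sq_integrable M"
  by (simp add: sq_integrable_def)

lemma cmod_add_sq_le: "(cmod (x + y))\<^sup>2 \<le> 2 * (cmod x)\<^sup>2 + 2 * (cmod y)\<^sup>2"
proof -
  have "(cmod (x + y))\<^sup>2 \<le> (cmod x + cmod y)\<^sup>2"
    by (rule power_mono[OF norm_triangle_ineq]) simp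
  also have "\<dots> \<le> 2 * (cmod x)\<^sup>2 + 2 * (cmod y)\<^sup>2"
    using sum_squares_bound[of "cmod x" "cmod y"] by (simp add: power2_sum)
  finally show ?thesis .
qed

lemma energy_add_le:
  assumes [measurable]: "f \<in> borel_measurable M" "g \<in> borel_measurable M" "A \<in> sets M"
  shows "energy M A (\<lambda>x. f x + g x) \<le> 2 * energy M A f + 2 * energy M A g"
proof -
  have "energy M A (\<lambda>x. f x + g x)
      \<le> (\<integral>\<^sup>+t. (2 * (ennreal ((cmod (f t))\<^sup>2) * indicator A t)
          + 2 * (ennreal ((cmod (g t))\<^sup>2) * indicator A t)) \<partial>M)"
    unfolding energy_def
  proof (rule nn_integral_mono)
    fix t
    have "ennreal ((cmod (f t + g t))\<^sup>2) \<le> ennreal (2 * (cmod (f t))\<^sup>2 + 2 * (cmod (g t))\<^sup>2)"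
      by (rule ennreal_leI[OF cmod_add_sq_le])
    also have "\<dots> = 2 * ennreal ((cmod (f t))\<^sup>2) + 2 * ennreal ((cmod (g t))\<^sup>2)"
      by (simp add: ennreal_plus ennreal_mult)
    finally show "ennreal ((cmod (f t + g t))\<^sup>2) * indicator A t
        \<le> 2 * (ennreal ((cmod (f t))\<^sup>2) * indicator A t) + 2 * (ennreal ((cmod (g t))\<^sup>2) * indicator A t)"
      by (auto simp: indicator_def)
  qed
  also have "\<dots> = 2 * energy M A f + 2 * energy M A g"
    unfolding energy_def by (simp add: nn_integral_add nn_integral_cmult)
  finally show ?thesis .
qed

lemma energy_cmult:
  assumes [measurable]: "f \<in> borel_measurable M" "A \<in> sets M"
  shows "energy M A (\<lambda>x. c * f x) = ennreal ((cmod c)\<^sup>2) * energy M A f"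
  unfolding energy_def
  by (subst nn_integral_cmult[symmetric])
    (auto simp: norm_mult power_mult_distrib ennreal_mult mult.assoc)

lemma energy_space: "energy M (space M) f = energy M UNIV f"
  unfolding energy_def by (rule nn_integral_cong) auto

lemma sq_integrable_add:
  assumes "f \<in> sq_integrable M" "g \<in> sq_integrable M"
  shows "(\<lambda>x. f x + g x) \<in> sq_integrable M"
  using assms energy_add_le[of f M g "space M"] unfolding sq_integrable_iff_energy energy_space
  by (auto simp: ennreal_mult_less_top intro: le_less_trans)

lemma sq_integrable_cmult:
  assumes "f \<in> sq_integrable M" shows "(\<lambda>x. c * f x) \<in> sq_integrable M"
  using assms energy_cmult[of f M "space M"] unfolding sq_integrable_iff_energy energy_space
  by (auto simp: ennreal_mult_less_top)

lemma mem_L2_class: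
  "h \<in> L2_class M f \<longleftrightarrow> f \<in> sq_integrable M \<and> h \<in> sq_integrable M \<and> (AE x in M. f x = h x)"
  by (simp add: L2_class_def ae_rel_def)

lemma L2_class_self: "f \<in> sq_integrable M \<Longrightarrow> f \<in> L2_class M f"
  by (simp add: mem_L2_class)

lemma L2_class_eq_iff:
  assumes "f \<in> sq_integrable M" "g \<in> sq_integrable M"
  shows "L2_class M f = L2_class M g \<longleftrightarrow> (AE x in M. f x = g x)"
proof
  assume "L2_class M f = L2_class M g"
  then have "g \<in> L2_class M f" using L2_class_self[OF assms(2)] by simp
  then show "AE x in M. f x = g x" by (simp add: mem_L2_class)
next
  assume eq: "AE x in M. f x = g x"
  have "(AE x in M. f x = h x) \<longleftrightarrow> (AE x in M. g x = h x)" for h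
  proof
    assume "AE x in M. f x = h x"
    with eq show "AE x in M. g x = h x" by eventually_elim simp
  next
    assume "AE x in M. g x = h x"
    with eq show "AE x in M. f x = h x" by eventually_elim simp
  qed
  then show "L2_class M f = L2_class M g" using assms by (auto simp: mem_L2_class)
qed

lemma carrier_L2: "carrier (L2 M) = L2_class M ` sq_integrable M"
  by (auto simp: L2_def quotient_def L2_class_def)

lemma zero_L2: "\<zero>\<^bsub>L2 M\<^esub> = L2_class M (\<lambda>_. 0)"
  by (simp add: L2_def)

lemma add_L2_class:
  assumes f: "f \<in> sq_integrable M" and g: "g \<in> sq_integrable M"
  shows "L2_class M f \<oplus>\<^bsub>L2 M\<^esub> L2_class M g = L2_class M (\<lambda>x. f x + g x)"
proof -
  have "L2_class M (\<lambda>x. f' x + g' x) = L2_class M (\<lambda>x. f x + g x)"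
    if f': "f' \<in> L2_class M f" and g': "g' \<in> L2_class M g" for f' g'
  proof (subst L2_class_eq_iff)
    show "(\<lambda>x. f' x + g' x) \<in> sq_integrable M" "(\<lambda>x. f x + g x) \<in> sq_integrable M"
      using f' g' f g by (auto simp: mem_L2_class intro: sq_integrable_add)
    have "AE x in M. f x = f' x" "AE x in M. g x = g' x" using f' g' by (auto simp: mem_L2_class)
    then show "AE x in M. f' x + g' x = f x + g x" by eventually_elim simp
  qed
  then have "(\<Union>f'\<in>L2_class M f. \<Union>g'\<in>L2_class M g. L2_class M (\<lambda>x. f' x + g' x))
      = L2_class M (\<lambda>x. f x + g x)"
    using L2_class_self[OF f] L2_class_self[OF g] by blast
  then show ?thesis by (simp add: L2_def)
qed

lemma smult_L2_class:
  assumes f: "f \<in> sq_integrable M"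
  shows "c \<odot>\<^bsub>L2 M\<^esub> L2_class M f = L2_class M (\<lambda>x. c * f x)"
proof -
  have "L2_class M (\<lambda>x. c * f' x) = L2_class M (\<lambda>x. c * f x)" if f': "f' \<in> L2_class M f" for f'
  proof (subst L2_class_eq_iff)
    show "(\<lambda>x. c * f' x) \<in> sq_integrable M" "(\<lambda>x. c * f x) \<in> sq_integrable M"
      using f' f by (auto simp: mem_L2_class intro: sq_integrable_cmult)
    have "AE x in M. f x = f' x" using f' by (auto simp: mem_L2_class)
    then show "AE x in M. c * f' x = c * f x" by eventually_elim simp
  qed
  then have "(\<Union>f'\<in>L2_class M f. L2_class M (\<lambda>x. c * f' x)) = L2_class M (\<lambda>x. c * f x)"
    using L2_class_self[OF f] by blast
  then show ?thesis by (simp add: L2_def)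
qed

text \<open>
  The kernels whose dimension matters consist of the classes of a linear space of functions, so the axioms
  are checked directly on such sets of classes.
\<close>
lemma vectorspace_L2_classes:
  assumes F: "F \<subseteq> sq_integrable M" "(\<lambda>_. 0) \<in> F"
    and add: "\<And>f g. f \<in> F \<Longrightarrow> g \<in> F \<Longrightarrow> (\<lambda>x. f x + g x) \<in> F"
    and cmult: "\<And>c f. f \<in> F \<Longrightarrow> (\<lambda>x. c * f x) \<in> F"
  shows "vectorspace class_ring ((L2 M)\<lparr>carrier := L2_class M ` F\<rparr>)" (is "vectorspace _ ?V")
proof (rule vs_criteria)
  have sq: "f \<in> sq_integrable M" if "f \<in> F" for f using that F by blast
  have a: "L2_class M f \<oplus>\<^bsub>?V\<^esub> L2_class M g = L2_class M (\<lambda>x. f x + g x)" if "f \<in> F" "g \<in> F" for f g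
    using add_L2_class[OF sq sq] that by simp
  have m: "c \<odot>\<^bsub>?V\<^esub> L2_class M f = L2_class M (\<lambda>x. c * f x)" if "f \<in> F" for c f
    using smult_L2_class[OF sq] that by simp
  have z: "\<zero>\<^bsub>?V\<^esub> = L2_class M (\<lambda>_. 0)" by (simp add: zero_L2)
  show "field (class_ring :: complex ring)" by (rule class_field.field_axioms)
  show "\<zero>\<^bsub>?V\<^esub> \<in> carrier ?V" using z F(2) by simp
  show "\<forall>v w. v \<in> carrier ?V \<and> w \<in> carrier ?V \<longrightarrow> v \<oplus>\<^bsub>?V\<^esub> w \<in> carrier ?V"
    using a add by auto
  show "\<forall>v\<in>carrier ?V. \<exists>n\<in>carrier ?V. v \<oplus>\<^bsub>?V\<^esub> n = \<zero>\<^bsub>?V\<^esub>"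
  proof
    fix v assume "v \<in> carrier ?V"
    then obtain f where f: "f \<in> F" "v = L2_class M f" by auto
    have "v \<oplus>\<^bsub>?V\<^esub> L2_class M (\<lambda>x. - 1 * f x) = \<zero>\<^bsub>?V\<^esub>"
      using a[OF f(1) cmult[OF f(1), of "- 1"]] f z by simp
    moreover have "L2_class M (\<lambda>x. - 1 * f x) \<in> carrier ?V" using cmult[OF f(1), of "- 1"] by simp
    ultimately show "\<exists>n\<in>carrier ?V. v \<oplus>\<^bsub>?V\<^esub> n = \<zero>\<^bsub>?V\<^esub>" by blast
  qed
  show "\<forall>c v. c \<in> carrier class_ring \<and> v \<in> carrier ?V \<longrightarrow> c \<odot>\<^bsub>?V\<^esub> v \<in> carrier ?V"
    using m cmult by auto
  show "\<forall>v w. v \<in> carrier ?V \<and> w \<in> carrier ?V \<longrightarrow> v \<oplus>\<^bsub>?V\<^esub> w = w \<oplus>\<^bsub>?V\<^esub> v"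
    using a by (auto simp: add.commute)
  show "\<forall>v w x. v \<in> carrier ?V \<and> w \<in> carrier ?V \<and> x \<in> carrier ?V
      \<longrightarrow> v \<oplus>\<^bsub>?V\<^esub> w \<oplus>\<^bsub>?V\<^esub> x = v \<oplus>\<^bsub>?V\<^esub> (w \<oplus>\<^bsub>?V\<^esub> x)"
    using a add by (auto simp: add.assoc)
  show "\<forall>v\<in>carrier ?V. v \<oplus>\<^bsub>?V\<^esub> \<zero>\<^bsub>?V\<^esub> = v"
    using a[OF _ F(2)] z by auto
  show "\<forall>c d v. c \<in> carrier class_ring \<and> d \<in> carrier class_ring \<and> v \<in> carrier ?V
      \<longrightarrow> (c \<otimes>\<^bsub>class_ring\<^esub> d) \<odot>\<^bsub>?V\<^esub> v = c \<odot>\<^bsub>?V\<^esub> (d \<odot>\<^bsub>?V\<^esub> v)"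
    using m cmult by (auto simp: mult.assoc)
  show "\<forall>v\<in>carrier ?V. \<one>\<^bsub>class_ring\<^esub> \<odot>\<^bsub>?V\<^esub> v = v"
    using m by auto
  show "\<forall>c d v. c \<in> carrier class_ring \<and> d \<in> carrier class_ring \<and> v \<in> carrier ?V
      \<longrightarrow> (c \<oplus>\<^bsub>class_ring\<^esub> d) \<odot>\<^bsub>?V\<^esub> v = c \<odot>\<^bsub>?V\<^esub> v \<oplus>\<^bsub>?V\<^esub> d \<odot>\<^bsub>?V\<^esub> v"
    using m a cmult by (auto simp: distrib_right)
  show "\<forall>c v w. c \<in> carrier class_ring \<and> v \<in> carrier ?V \<and> w \<in> carrier ?V
      \<longrightarrow> c \<odot>\<^bsub>?V\<^esub> (v \<oplus>\<^bsub>?V\<^esub> w) = c \<odot>\<^bsub>?V\<^esub> v \<oplus>\<^bsub>?V\<^esub> c \<odot>\<^bsub>?V\<^esub> w"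
    using m a cmult add by (auto simp: distrib_left)
qed

section \<open>One-dimensional spaces\<close>

lemma (in vectorspace) span_singleton:
  assumes "v \<in> carrier V"
  shows "span {v} = {a \<odot>\<^bsub>V\<^esub> v |a. a \<in> carrier K}"
proof -
  have l: "lincomb a {v} = a v \<odot>\<^bsub>V\<^esub> v" if "a \<in> {v} \<rightarrow> carrier K" for a
    unfolding lincomb_def using assms that by simp
  have "span {v} = {lincomb a {v} |a. a \<in> {v} \<rightarrow> carrier K}"
    by (rule finite_span) (use assms in auto)
  also have "\<dots> = {a \<odot>\<^bsub>V\<^esub> v |a. a \<in> carrier K}"
  proof (intro equalityI subsetI)
    fix w assume "w \<in> {a \<odot>\<^bsub>V\<^esub> v |a. a \<in> carrier K}"
    then obtain a where "a \<in> carrier K" "w = a \<odot>\<^bsub>V\<^esub> v" by blast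
    then show "w \<in> {lincomb a {v} |a. a \<in> {v} \<rightarrow> carrier K}"
      using l[of "\<lambda>_. a"] by force
  qed (use l in auto)
  finally show ?thesis .
qed

lemma (in vectorspace) dim1_if_multiples:
  assumes v: "v \<in> carrier V" "v \<noteq> \<zero>\<^bsub>V\<^esub>"
    and "\<And>w. w \<in> carrier V \<Longrightarrow> \<exists>a\<in>carrier K. w = a \<odot>\<^bsub>V\<^esub> v"
  shows "fin_dim \<and> dim = 1"
proof -
  have "gen_set {v}" unfolding span_singleton[OF v(1)] using assms by auto
  then show ?thesis unfolding fin_dim_def using dim1I v by blast
qed

lemma (in vectorspace) multiples_if_dim1:
  assumes "fin_dim" "dim = 1"
  obtains v where "v \<in> carrier V" "\<And>w. w \<in> carrier V \<Longrightarrow> \<exists>a\<in>carrier K. w = a \<odot>\<^bsub>V\<^esub> v"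
proof -
  have "\<exists>n A. finite A \<and> card A = n \<and> A \<subseteq> carrier V \<and> gen_set A"
    using assms(1) unfolding fin_dim_def by blast
  from LeastI_ex[OF this] obtain A where A: "card A = dim" "A \<subseteq> carrier V" "gen_set A"
    unfolding dim_def by blast
  then obtain v where "A = {v}" using assms(2) card_1_singletonE by metis
  then show ?thesis using that[of v] span_singleton[of v] A by auto
qed

section \<open>Behaviour at the right end\<close>

lemma integrable_mult_sq_integrable:
  assumes "f \<in> sq_integrable M" "g \<in> sq_integrable M"
  shows "integrable M (\<lambda>t. f t * g t)"
proof (rule integrableI_bounded)
  have [measurable]: "f \<in> borel_measurable M" "g \<in> borel_measurable M"
    using assms by (auto simp: sq_integrable_def)
  show "(\<lambda>t. f t * g t) \<in> borel_measurable M" by measurable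
  have "(\<integral>\<^sup>+t. ennreal (norm (f t * g t)) \<partial>M)
      \<le> (\<integral>\<^sup>+t. ennreal ((cmod (f t))\<^sup>2) + ennreal ((cmod (g t))\<^sup>2) \<partial>M)"
  proof (rule nn_integral_mono)
    fix t
    have "norm (f t * g t) \<le> (cmod (f t))\<^sup>2 + (cmod (g t))\<^sup>2"
      using sum_squares_bound[of "cmod (f t)" "cmod (g t)"]
        mult_nonneg_nonneg[OF norm_ge_zero[of "f t"] norm_ge_zero[of "g t"]]
      unfolding norm_mult mult.assoc by linarith
    then show "ennreal (norm (f t * g t)) \<le> ennreal ((cmod (f t))\<^sup>2) + ennreal ((cmod (g t))\<^sup>2)"
      by (subst ennreal_plus[symmetric]) (auto intro: ennreal_leI simp del: ennreal_plus)
  qed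
  also have "\<dots> = (\<integral>\<^sup>+t. ennreal ((cmod (f t))\<^sup>2) \<partial>M) + (\<integral>\<^sup>+t. ennreal ((cmod (g t))\<^sup>2) \<partial>M)"
    by (rule nn_integral_add) measurable
  also have "\<dots> < \<infinity>" using assms by (auto simp: sq_integrable_def)
  finally show "(\<integral>\<^sup>+t. ennreal (norm (f t * g t)) \<partial>M) < \<infinity>" .
qed

lemma sq_integrable_cnj: "f \<in> sq_integrable M \<Longrightarrow> (\<lambda>t. cnj (f t)) \<in> sq_integrable M"
  using measurable_compose[OF _ borel_measurable_continuous_onI, of f M cnj]
  by (simp add: sq_integrable_def continuous_on_cnj)

text \<open>
  Translates the complex integral of \<open>\<bar>f\<bar>\<^sup>2\<close> that Green's formula produces into the square integral.
\<close>
lemma set_integral_mult_cnj: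
  assumes "set_integrable M A (\<lambda>t. f t * cnj (f t))"
  obtains r where "0 \<le> r" "(LINT t:A|M. f t * cnj (f t)) = complex_of_real r" "energy M A f = ennreal r"
proof -
  have eq: "(\<lambda>t. indicat_real A t *\<^sub>R (f t * cnj (f t))) = (\<lambda>t. complex_of_real (indicat_real A t * (cmod (f t))\<^sup>2))"
    using complex_norm_square by (auto simp: scaleR_conv_of_real of_real_power[symmetric] simp del: of_real_power)
  have i: "integrable M (\<lambda>t. indicat_real A t * (cmod (f t))\<^sup>2)"
    using assms unfolding set_integrable_def eq by (simp only: complex_of_real_integrable_eq)
  let ?r = "LINT t|M. indicat_real A t * (cmod (f t))\<^sup>2"
  have "energy M A f = (\<integral>\<^sup>+t. ennreal (indicat_real A t * (cmod (f t))\<^sup>2) \<partial>M)"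
    unfolding energy_def by (rule nn_integral_cong) (auto simp: indicator_def)
  also have "\<dots> = ennreal ?r" by (rule nn_integral_eq_integral[OF i]) auto
  finally have "energy M A f = ennreal ?r" .
  moreover have "(LINT t:A|M. f t * cnj (f t)) = complex_of_real ?r"
    unfolding set_lebesgue_integral_def eq by (rule integral_complex_of_real)
  moreover have "0 \<le> ?r" by (rule integral_nonneg_AE) auto
  ultimately show ?thesis using that by blast
qed

context initial_finite_measure
begin

definition infinite_at_end :: bool where
  "infinite_at_end \<longleftrightarrow> (\<forall>B. \<exists>x\<in>Ico0 b. B < cum x)"

lemma eventually_gt_cum:
  assumes "infinite_at_end"
  shows "\<forall>\<^sub>F x in to_end b. B < cum x"
proof -
  obtain c where c: "c \<in> Ico0 b" "B < cum c" using assms unfolding infinite_at_end_def by blast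
  then show ?thesis
    unfolding eventually_to_end[OF b_pos] using cum_mono[of c]
    by (intro bexI[of _ c]) (force simp: Ico0_nonneg)+
qed

lemma initial_integral_tendsto:
  fixes g :: "real \<Rightarrow> complex"
  assumes g: "integrable M g"
  shows "((\<lambda>x. LINT t:{0..<x}|M. g t) \<longlongrightarrow> (LINT t|M. g t)) (to_end b)"
proof (rule tendstoI)
  fix e :: real assume e: "0 < e"
  have [measurable]: "g \<in> borel_measurable M" using g by auto
  have fin: "(\<integral>\<^sup>+t. ennreal (cmod (g t)) \<partial>M) < \<infinity>" using g unfolding integrable_iff_bounded by blast
  obtain c where c: "c \<in> Ico0 b" "\<And>x. x \<in> Ico0 b \<Longrightarrow> (\<integral>\<^sup>+t\<in>{c..<x}. ennreal (cmod (g t)) \<partial>M) \<le> ennreal (e/2)"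
    using small_tail[OF _ fin, of "ennreal (e/2)"] e by auto
  have tail: "(\<integral>\<^sup>+t\<in>{c..}. ennreal (cmod (g t)) \<partial>M) \<le> ennreal (e/2)"
  proof (rule nn_integral_le_if_initial)
    have "(\<lambda>t. ennreal (cmod (g t)) * indicator {c..} t) = (\<lambda>t. if c \<le> t then ennreal (cmod (g t)) else 0)"
      by auto
    then show "(\<lambda>t. ennreal (cmod (g t)) * indicator {c..} t) \<in> borel_measurable M" by simp
    fix x assume "x \<in> Ico0 b"
    have "(\<integral>\<^sup>+t\<in>{0..<x}. ennreal (cmod (g t)) * indicator {c..} t \<partial>M)
        = (\<integral>\<^sup>+t\<in>{c..<x}. ennreal (cmod (g t)) \<partial>M)"
      by (rule nn_integral_cong) (use Ico0_nonneg[OF c(1)] in \<open>auto simp: indicator_def\<close>)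
    then show "(\<integral>\<^sup>+t\<in>{0..<x}. ennreal (cmod (g t)) * indicator {c..} t \<partial>M) \<le> ennreal (e/2)"
      using c(2) \<open>x \<in> Ico0 b\<close> by simp
  qed
  have "dist (LINT t:{0..<x}|M. g t) (LINT t|M. g t) < e" if x: "x \<in> Ico0 b" "c \<le> x" for x
  proof -
    have [measurable]: "{0..<x} \<in> sets M" using x sets_Ico by simp
    have i: "integrable M (\<lambda>t. indicat_real {0..<x} t *\<^sub>R g t)"
      using integrable_mult_indicator[OF _ g] by simp
    have "(LINT t|M. g t) - (LINT t:{0..<x}|M. g t) = (LINT t|M. g t - indicat_real {0..<x} t *\<^sub>R g t)"
      unfolding set_lebesgue_integral_def by (rule Bochner_Integration.integral_diff[symmetric, OF g i])
    then have "ennreal (cmod ((LINT t|M. g t) - (LINT t:{0..<x}|M. g t)))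
        \<le> (\<integral>\<^sup>+t. ennreal (cmod (g t - indicat_real {0..<x} t *\<^sub>R g t)) \<partial>M)"
      using integral_norm_bound_ennreal[OF Bochner_Integration.integrable_diff[OF g i]] by simp
    also have "\<dots> \<le> (\<integral>\<^sup>+t\<in>{c..}. ennreal (cmod (g t)) \<partial>M)"
      by (rule nn_integral_mono) (use x(2) in \<open>auto simp: indicator_def space_M Ico0_nonneg\<close>)
    also note tail
    finally have "cmod ((LINT t|M. g t) - (LINT t:{0..<x}|M. g t)) \<le> e / 2"
      using e by (subst (asm) ennreal_le_iff) auto
    then show ?thesis using e by (simp add: dist_norm norm_minus_commute)
  qed
  then show "\<forall>\<^sub>F x in to_end b. dist (LINT t:{0..<x}|M. g t) (LINT t|M. g t) < e"
    unfolding eventually_to_end[OF b_pos] using c(1) by blast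
qed

lemma energy_finite_real:
  assumes "energy M UNIV g < \<infinity>"
  obtains E where "0 < E" "\<And>A. energy M A g \<le> ennreal E"
proof -
  let ?E = "enn2real (energy M UNIV g) + 1"
  have "energy M A g \<le> ennreal ?E" for A
  proof -
    have "energy M A g \<le> energy M UNIV g" by (rule energy_mono) simp
    also have "\<dots> = ennreal (enn2real (energy M UNIV g))" using assms by simp
    also have "\<dots> \<le> ennreal ?E" by (rule ennreal_leI) simp
    finally show ?thesis .
  qed
  moreover have "0 < ?E" using enn2real_nonneg[of "energy M UNIV g"] by linarith
  ultimately show ?thesis using that by blast
qed

text \<open>
  A primitive of a square integrable function is Hoelder continuous of order \<open>1/2\<close> with respect to
  \<open>cum\<close>. This bounds it by \<open>cum\<close> at an infinite end and by the remaining mass at a finite end.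
\<close>
lemma primitive_holder:
  assumes G: "primitive b M g G" and E: "energy M UNIV g < \<infinity>"
  obtains E where "0 < E"
    "\<And>x y. 0 \<le> x \<Longrightarrow> x \<le> y \<Longrightarrow> y \<in> Ico0 b \<Longrightarrow> (cmod (G y - G x))\<^sup>2 \<le> E * (cum y - cum x)"
proof -
  obtain E where E: "0 < E" "\<And>A. energy M A g \<le> ennreal E" using energy_finite_real[OF E] by blast
  have "(cmod (G y - G x))\<^sup>2 \<le> E * (cum y - cum x)" if "0 \<le> x" "x \<le> y" "y \<in> Ico0 b" for x y
  proof -
    have "ennreal ((cmod (G y - G x))\<^sup>2) \<le> energy M {x..<y} g * ennreal (cum y - cum x)"
      by (rule primitive_increment_sq_le[OF G that])
    also have "\<dots> \<le> ennreal E * ennreal (cum y - cum x)" using E(2) by (rule mult_right_mono) simp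
    also have "\<dots> = ennreal (E * (cum y - cum x))"
      using E(1) cum_mono[OF that] by (simp add: ennreal_mult)
    finally show ?thesis using E(1) cum_mono[OF that] by (subst (asm) ennreal_le_iff) auto
  qed
  then show ?thesis using that E(1) by blast
qed

text \<open>
  If the product stays above \<open>d\<close>, then \<open>\<bar>G\<bar>\<^sup>2 \<le> C cum\<close> turns into \<open>\<bar>f\<bar>\<^sup>2 \<ge> d\<^sup>2 / (C cum)\<close>, which is not
  integrable.
\<close>
lemma product_small_if_infinite:
  assumes G: "primitive b M g G" "energy M UNIV g < \<infinity>"
    and f: "f \<in> borel_measurable M" "energy M UNIV f < \<infinity>"
    and inf: infinite_at_end and d: "0 < d"
  shows "\<not> (\<forall>\<^sub>F x in to_end b. d \<le> cmod (f x * G x))"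
proof
  assume ge: "\<forall>\<^sub>F x in to_end b. d \<le> cmod (f x * G x)"
  obtain E where E: "0 < E"
    "\<And>x y. 0 \<le> x \<Longrightarrow> x \<le> y \<Longrightarrow> y \<in> Ico0 b \<Longrightarrow> (cmod (G y - G x))\<^sup>2 \<le> E * (cum y - cum x)"
    using primitive_holder[OF G] by blast
  \<comment> \<open>This constant works where \<open>cum \<ge> 1\<close>, so that the initial value can be absorbed.\<close>
  define C where "C = 2 * (cmod (G 0))\<^sup>2 + 2 * E"
  have C: "0 < C" using E(1) by (simp add: C_def add_nonneg_pos)
  have "\<forall>\<^sub>F x in to_end b. x \<in> Ico0 b"
    unfolding eventually_to_end[OF b_pos] using zero_in_Ico0[OF b_pos] by blast
  with ge eventually_gt_cum[OF inf, of 1]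
  have "\<forall>\<^sub>F x in to_end b. ennreal (d\<^sup>2 / C / cum x) \<le> ennreal ((cmod (f x))\<^sup>2)"
  proof eventually_elim
    case (elim x)
    have x: "0 \<le> x" using elim by (simp add: Ico0_nonneg)
    have "(cmod (G x))\<^sup>2 \<le> 2 * (cmod (G 0))\<^sup>2 + 2 * (cmod (G x - G 0))\<^sup>2"
      using cmod_add_sq_le[of "G 0" "G x - G 0"] by simp
    also have "(cmod (G x - G 0))\<^sup>2 \<le> E * (cum x - cum 0)" using E(2)[of 0 x] x elim by simp
    also have "\<dots> \<le> E * cum x" using E(1) cum_nonneg[of 0] by simp
    also have "2 * (cmod (G 0))\<^sup>2 \<le> 2 * (cmod (G 0))\<^sup>2 * cum x"
      using elim mult_left_mono[of 1 "cum x" "2 * (cmod (G 0))\<^sup>2"] by simp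
    finally have Gx: "(cmod (G x))\<^sup>2 \<le> C * cum x" by (simp add: C_def algebra_simps)
    have "d\<^sup>2 \<le> (cmod (f x * G x))\<^sup>2" using elim d by (intro power_mono) auto
    also have "\<dots> = (cmod (f x))\<^sup>2 * (cmod (G x))\<^sup>2" by (simp add: norm_mult power_mult_distrib)
    also have "\<dots> \<le> (cmod (f x))\<^sup>2 * (C * cum x)" by (rule mult_left_mono[OF Gx]) simp
    finally have "d\<^sup>2 / C / cum x \<le> (cmod (f x))\<^sup>2"
      using C elim by (simp add: field_simps)
    then show ?case by (rule ennreal_leI)
  qed
  moreover have "(\<lambda>x. ennreal ((cmod (f x))\<^sup>2)) \<in> borel_measurable M" using f(1) by measurable
  moreover have "(\<integral>\<^sup>+x. ennreal ((cmod (f x))\<^sup>2) \<partial>M) < \<infinity>" using f(2) by (simp add: energy_def)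
  moreover have "0 < d\<^sup>2 / C" using d C by simp
  ultimately show False
    using not_integrable_if_ge_recip_cum inf unfolding infinite_at_end_def by blast
qed

text \<open>
  Here \<open>G\<close> is estimated from the end: letting \<open>y\<close> tend to \<open>b\<close> in \<open>\<bar>G(y) - G(x)\<bar>\<^sup>2 \<le> E (cum(y) - cum(x))\<close>
  bounds \<open>\<bar>G(x)\<bar>\<^sup>2\<close> by a multiple of the remaining mass. That mass is positive, since otherwise \<open>G(x)\<close>
  would vanish.
\<close>
lemma product_small_if_vanishing:
  assumes G: "primitive b M g G" "energy M UNIV g < \<infinity>" "(G \<longlongrightarrow> 0) (to_end b)"
    and f: "f \<in> borel_measurable M" "energy M UNIV f < \<infinity>"
    and fin: "\<not> infinite_at_end" and d: "0 < d"
  shows "\<not> (\<forall>\<^sub>F x in to_end b. d \<le> cmod (f x * G x))"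
proof
  assume ge: "\<forall>\<^sub>F x in to_end b. d \<le> cmod (f x * G x)"
  obtain B where "\<And>x. x \<in> Ico0 b \<Longrightarrow> cum x \<le> B"
    using fin unfolding infinite_at_end_def by (meson not_less)
  then obtain T where T: "(cum \<longlongrightarrow> T) (to_end b)" "\<And>x. x \<in> Ico0 b \<Longrightarrow> cum x \<le> T"
    using bounded_cum_converges by blast
  obtain E where E: "0 < E"
    "\<And>x y. 0 \<le> x \<Longrightarrow> x \<le> y \<Longrightarrow> y \<in> Ico0 b \<Longrightarrow> (cmod (G y - G x))\<^sup>2 \<le> E * (cum y - cum x)"
    using primitive_holder[OF G(1,2)] by blast
  have GT: "(cmod (G x))\<^sup>2 \<le> E * (T - cum x)" if x: "x \<in> Ico0 b" for x
  proof (rule tendsto_le[OF to_end_nontrivial[OF b_pos]])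
    show "((\<lambda>y. E * (cum y - cum x)) \<longlongrightarrow> E * (T - cum x)) (to_end b)"
      by (intro tendsto_intros T)
    show "((\<lambda>y. (cmod (G y - G x))\<^sup>2) \<longlongrightarrow> (cmod (G x))\<^sup>2) (to_end b)"
      using tendsto_power[OF tendsto_norm[OF tendsto_diff[OF G(3) tendsto_const[of "G x"]]], of 2] by simp
    show "\<forall>\<^sub>F y in to_end b. (cmod (G y - G x))\<^sup>2 \<le> E * (cum y - cum x)"
      unfolding eventually_to_end[OF b_pos] using E(2)[of x] x by (auto simp: Ico0_nonneg)
  qed
  have "\<forall>\<^sub>F x in to_end b. x \<in> Ico0 b"
    unfolding eventually_to_end[OF b_pos] using zero_in_Ico0[OF b_pos] by blast
  with ge have "\<forall>\<^sub>F x in to_end b. cum x < T \<and> ennreal (d\<^sup>2 / E / (T - cum x)) \<le> ennreal ((cmod (f x))\<^sup>2)"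
  proof eventually_elim
    case (elim x)
    have "G x \<noteq> 0" using elim d by auto
    then have "0 < (cmod (G x))\<^sup>2" by simp
    then have "0 < E * (T - cum x)" using GT[OF elim(2)] by linarith
    then have lt: "cum x < T" using E(1) by (simp add: zero_less_mult_iff)
    have "d\<^sup>2 \<le> (cmod (f x * G x))\<^sup>2" using elim d by (intro power_mono) auto
    also have "\<dots> = (cmod (f x))\<^sup>2 * (cmod (G x))\<^sup>2" by (simp add: norm_mult power_mult_distrib)
    also have "\<dots> \<le> (cmod (f x))\<^sup>2 * (E * (T - cum x))" by (rule mult_left_mono[OF GT[OF elim(2)]]) simp
    finally have "d\<^sup>2 / E / (T - cum x) \<le> (cmod (f x))\<^sup>2"
      using E(1) lt by (simp add: divide_le_eq mult.assoc mult.commute)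
    then show ?case using lt by (simp add: ennreal_leI)
  qed
  moreover have "(\<lambda>x. ennreal ((cmod (f x))\<^sup>2)) \<in> borel_measurable M" using f(1) by measurable
  moreover have "(\<integral>\<^sup>+x. ennreal ((cmod (f x))\<^sup>2) \<partial>M) < \<infinity>" using f(2) by (simp add: energy_def)
  moreover have "0 < d\<^sup>2 / E" using d E(1) by simp
  ultimately show False
    using not_integrable_if_ge_recip_tail T(1) by blast
qed

end

section \<open>The Dirichlet property and the strong limit point property\<close>

context initial_finite_pair
begin

text \<open>
  The elements of \<open>\<T>\<close>, with the integrability of \<open>u\<^sub>2\<close> and \<open>f\<close> on initial intervals made explicit.
\<close>
definition maximal_triple :: "(real \<Rightarrow> complex) \<Rightarrow> (real \<Rightarrow> complex) \<Rightarrow> (real \<Rightarrow> complex) \<Rightarrow> bool" where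
  "maximal_triple u1 u2 f \<longleftrightarrow> primitive b M1 u2 u1 \<and> primitive b M2 (\<lambda>t. - f t) u2 \<and>
     u1 \<in> sq_integrable M2 \<and> f \<in> sq_integrable M2"

lemma green_formula:
  assumes u: "primitive b M1 u2 u1" and v: "primitive b M2 (\<lambda>t. - h t) v2" and x: "x \<in> Ico0 b"
  shows "u1 x * v2 x = u1 0 * v2 0 - (LINT t:{0..<x}|M2. u1 t * h t) + (LINT t:{0..<x}|M1. v2 t * u2 t)"
proof -
  have "(LINT t:{0..<x}|M2. u1 t * - h t) = - (LINT t:{0..<x}|M2. u1 t * h t)"
    using set_integral_mult_right[of M2 "{0..<x}" "- 1" "\<lambda>t. u1 t * h t"] by simp
  then show ?thesis using product_rule(3)[OF u v x] by (simp add: algebra_simps)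
qed

text \<open>
  By Green's formula the limit exists, and a nonzero limit would keep the product away from \<open>0\<close>.
\<close>
theorem product_tendsto_0:
  assumes u: "maximal_triple u1 u2 f" "u2 \<in> sq_integrable M1"
    and v: "maximal_triple v1 v2 h" "v2 \<in> sq_integrable M1"
    and singular: "m1.infinite_at_end \<or> m2.infinite_at_end"
  shows "((\<lambda>x. u1 x * v2 x) \<longlongrightarrow> 0) (to_end b)"
proof -
  have b: "0 < b" by (rule m1.b_pos)
  have p: "primitive b M1 u2 u1" "primitive b M2 (\<lambda>t. - h t) v2"
    and sq: "u1 \<in> sq_integrable M2" "h \<in> sq_integrable M2"
    using u v by (auto simp: maximal_triple_def)
  let ?L = "u1 0 * v2 0 - (LINT t|M2. u1 t * h t) + (LINT t|M1. v2 t * u2 t)"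
  have "((\<lambda>x. u1 0 * v2 0 - (LINT t:{0..<x}|M2. u1 t * h t) + (LINT t:{0..<x}|M1. v2 t * u2 t)) \<longlongrightarrow> ?L) (to_end b)"
    by (intro tendsto_intros m1.initial_integral_tendsto m2.initial_integral_tendsto
        integrable_mult_sq_integrable sq u(2) v(2))
  moreover have "\<forall>\<^sub>F x in to_end b. u1 x * v2 x
      = u1 0 * v2 0 - (LINT t:{0..<x}|M2. u1 t * h t) + (LINT t:{0..<x}|M1. v2 t * u2 t)"
    unfolding eventually_to_end[OF b] using green_formula[OF p] zero_in_Ico0[OF b] by blast
  ultimately have lim: "((\<lambda>x. u1 x * v2 x) \<longlongrightarrow> ?L) (to_end b)"
    by (subst tendsto_cong)
  have "?L = 0"
  proof (rule ccontr)
    assume "?L \<noteq> 0"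
    then have "0 < cmod ?L" using zero_less_norm_iff by blast
    then have d: "0 < cmod ?L / 2" "cmod ?L / 2 < cmod ?L" by linarith+
    have "\<forall>\<^sub>F x in to_end b. cmod ?L / 2 < cmod (u1 x * v2 x)"
      by (rule order_tendstoD(1)[OF tendsto_norm[OF lim] d(2)])
    then have ge: "\<forall>\<^sub>F x in to_end b. cmod ?L / 2 \<le> cmod (u1 x * v2 x)"
      by eventually_elim simp
    show False using singular
    proof
      assume m1.infinite_at_end
      then show False
        using m1.product_small_if_infinite[OF p(1), of v2 "cmod ?L / 2"] u(2) v(2) d(1) ge
        by (simp add: sq_integrable_iff_energy mult.commute)
    next
      assume m2.infinite_at_end
      moreover have "energy M2 UNIV (\<lambda>t. - h t) = energy M2 UNIV h" by (simp add: energy_def)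
      ultimately show False
        using m2.product_small_if_infinite[OF p(2), of u1 "cmod ?L / 2"] sq d(1) ge
        by (simp add: sq_integrable_iff_energy)
    qed
  qed
  then show ?thesis using lim by simp
qed

text \<open>
  For a singular system this is the limit circle case. Square integrability of the constant \<open>1\<close> is
  implied, because \<open>cum \<ge> 1\<close> near the end.
\<close>
definition limit_circle_growth :: bool where
  "limit_circle_growth \<longleftrightarrow>
     m1.infinite_at_end \<and> (\<lambda>x. complex_of_real (m1.cum x)) \<in> sq_integrable M2"

lemma cum1_measurable: "m1.cum \<in> borel_measurable M2"
  using m1.cum_measurable measurable_cong_sets[of M1 M2 borel borel] m1.sets_M m2.sets_M by simp

lemma emeasure_finite_if_not_infinite:
  assumes "\<not> m2.infinite_at_end"
  shows "emeasure M2 (space M2) < \<infinity>"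
proof -
  obtain B where B: "\<And>x. x \<in> Ico0 b \<Longrightarrow> m2.cum x \<le> B"
    using assms unfolding m2.infinite_at_end_def by (meson not_less)
  have "(\<integral>\<^sup>+t. 1 \<partial>M2) \<le> ennreal B"
  proof (rule m2.nn_integral_le_if_initial)
    fix x assume x: "x \<in> Ico0 b"
    have "(\<integral>\<^sup>+t\<in>{0..<x}. 1 \<partial>M2) = emeasure M2 {0..<x}"
      using x m2.sets_Ico by simp
    also have "\<dots> = ennreal (m2.cum x)"
      using m2.finite_initial[OF x] by (simp add: m2.cum_def emeasure_eq_ennreal_measure less_top)
    also have "\<dots> \<le> ennreal B" by (rule ennreal_leI[OF B[OF x]])
    finally show "(\<integral>\<^sup>+t\<in>{0..<x}. 1 \<partial>M2) \<le> ennreal B" .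
  qed simp
  then show ?thesis by (simp add: le_less_trans)
qed

lemma integrable_if_not_infinite:
  assumes "\<not> m2.infinite_at_end" "h \<in> sq_integrable M2"
  shows "integrable M2 h"
proof -
  have "set_integrable M2 (space M2) h"
    using assms emeasure_finite_if_not_infinite
    by (intro set_integrable_if_energy_finite) (auto simp: sq_integrable_iff_energy energy_space)
  then show ?thesis unfolding set_integrable_def
    by (rule Bochner_Integration.integrable_cong[THEN iffD1, rotated 2]) auto
qed

text \<open>
  Near the end \<open>u\<^sub>2\<close> is within \<open>\<bar>l\<bar>/2\<close> of its limit \<open>l\<close>, so \<open>\<bar>u\<^sub>1\<bar>\<close> is at least
  \<open>\<bar>l\<bar>/2\<close> times \<open>cum\<close> up to a constant, and eventually at least \<open>\<bar>l\<bar>/4\<close> times \<open>cum\<close>. Thus \<open>cum\<close>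
  inherits the square integrability of \<open>u\<^sub>1\<close>; on the initial part it is bounded and the mass of the
  second measure is finite.
\<close>
lemma limit_circle_growth_if_nonzero_limit:
  assumes u: "primitive b M1 u2 u1" "u1 \<in> sq_integrable M2"
    and l: "(u2 \<longlongrightarrow> l) (to_end b)" "l \<noteq> 0"
    and inf1: m1.infinite_at_end and fin2: "\<not> m2.infinite_at_end"
  shows limit_circle_growth
proof -
  have b: "0 < b" by (rule m1.b_pos)
  have "\<forall>\<^sub>F x in to_end b. dist (u2 x) l < cmod l / 2"
    using l by (intro tendstoD) auto
  then obtain c where c: "c \<in> Ico0 b" "\<And>x. x \<in> Ico0 b \<Longrightarrow> c \<le> x \<Longrightarrow> dist (u2 x) l < cmod l / 2"
    unfolding eventually_to_end[OF b] by blast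
  have lower: "cmod l / 2 * (m1.cum x - m1.cum c) - cmod (u1 c) \<le> cmod (u1 x)"
    if x: "x \<in> Ico0 b" "c \<le> x" for x
  proof -
    have c0: "0 \<le> c" using c(1) by (simp add: Ico0_nonneg)
    have [measurable]: "{c..<x} \<in> sets M1" using m1.sets_Ico x c0 by simp
    have i1: "set_integrable M1 {c..<x} (\<lambda>_. l)"
      using m1.emeasure_Ico_finite[OF c0 x(1)] unfolding set_integrable_def
      by (intro integrable_scaleR_left integrable_real_indicator) auto
    have i2: "set_integrable M1 {c..<x} u2"
      by (rule set_integrable_subset[OF primitive_at(2)[OF u(1) x(1)]]) (use c0 in auto)
    have i3: "set_integrable M1 {c..<x} (\<lambda>t. u2 t - l)" by (rule set_integral_diff(1)[OF i2 i1])
    have m: "(LINT t:{c..<x}|M1. l) = of_real (m1.cum x - m1.cum c) * l"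
      using m1.measure_Ico[OF c0 x(2,1)] m1.emeasure_Ico_finite[OF c0 x(1)]
      unfolding set_lebesgue_integral_def
      by (subst integral_scaleR_left) (auto simp: less_top scaleR_conv_of_real)
    have "u1 x - u1 c = (LINT t:{c..<x}|M1. (u2 t - l) + l)"
      using m1.primitive_increment[OF u(1) c0 x(2,1)] by simp
    also have "\<dots> = (LINT t:{c..<x}|M1. u2 t - l) + of_real (m1.cum x - m1.cum c) * l"
      using set_integral_add(2)[OF i3 i1] m by simp
    finally have eq: "of_real (m1.cum x - m1.cum c) * l = u1 x - u1 c - (LINT t:{c..<x}|M1. u2 t - l)"
      by simp
    have "cmod (LINT t:{c..<x}|M1. u2 t - l) \<le> (LINT t|M1. indicat_real {c..<x} t * (cmod l / 2))"
      unfolding set_lebesgue_integral_def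
    proof (rule Bochner_Integration.integral_norm_bound_integral)
      show "integrable M1 (\<lambda>t. indicat_real {c..<x} t *\<^sub>R (u2 t - l))"
        using i3 unfolding set_integrable_def .
      show "integrable M1 (\<lambda>t. indicat_real {c..<x} t * (cmod l / 2))"
        using m1.emeasure_Ico_finite[OF c0 x(1)]
        by (intro integrable_mult_left integrable_real_indicator) auto
      fix t assume "t \<in> space M1"
      then show "norm (indicat_real {c..<x} t *\<^sub>R (u2 t - l)) \<le> indicat_real {c..<x} t * (cmod l / 2)"
        using c(2)[of t] by (auto simp: indicator_def m1.space_M dist_norm)
    qed
    also have "\<dots> = (m1.cum x - m1.cum c) * (cmod l / 2)"
      using m1.measure_Ico[OF c0 x(2,1)] by simp
    finally have "cmod (of_real (m1.cum x - m1.cum c) * l)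
        \<le> cmod (u1 x) + cmod (u1 c) + (m1.cum x - m1.cum c) * (cmod l / 2)"
      unfolding eq
      using norm_triangle_ineq4[of "u1 x - u1 c" "LINT t:{c..<x}|M1. u2 t - l"]
        norm_triangle_ineq4[of "u1 x" "u1 c"] by linarith
    moreover have "cmod (of_real (m1.cum x - m1.cum c) * l) = (m1.cum x - m1.cum c) * cmod l"
      using m1.cum_mono[OF c0 x(2,1)] unfolding norm_mult norm_of_real by simp
    ultimately show ?thesis by (simp add: field_simps)
  qed
  obtain c' where c': "c' \<in> Ico0 b" "c \<le> c'" "\<And>x. x \<in> Ico0 b \<Longrightarrow> c' \<le> x \<Longrightarrow> cmod l / 4 * m1.cum x \<le> cmod (u1 x)"
  proof -
    obtain c1 where c1: "c1 \<in> Ico0 b" "\<And>x. x \<in> Ico0 b \<Longrightarrow> c1 \<le> x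
        \<Longrightarrow> (cmod (u1 c) + cmod l / 2 * m1.cum c) / (cmod l / 4) < m1.cum x"
      using m1.eventually_gt_cum[OF inf1] unfolding eventually_to_end[OF b] by blast
    have "cmod l / 4 * m1.cum x \<le> cmod (u1 x)" if x: "x \<in> Ico0 b" "max c c1 \<le> x" for x
    proof -
      have "cmod (u1 c) + cmod l / 2 * m1.cum c < cmod l / 4 * m1.cum x"
        using c1(2)[of x] x l(2) by (simp add: pos_divide_less_eq mult.commute)
      then show ?thesis using lower[of x] x by (simp add: algebra_simps)
    qed
    then show ?thesis using that[of "max c c1"] c c1 by (simp add: max_in_Ico0)
  qed
  let ?k = "16 / (cmod l)\<^sup>2"
  have le: "ennreal ((cmod (complex_of_real (m1.cum x)))\<^sup>2)
      \<le> ennreal ((m1.cum c')\<^sup>2) + ennreal ?k * ennreal ((cmod (u1 x))\<^sup>2)" if "x \<in> space M2" for x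
  proof -
    have x: "x \<in> Ico0 b" using that by (simp add: m2.space_M)
    have "(m1.cum x)\<^sup>2 \<le> (m1.cum c')\<^sup>2 + ?k * (cmod (u1 x))\<^sup>2"
    proof (cases "c' \<le> x")
      case True
      have "m1.cum x \<le> 4 / cmod l * cmod (u1 x)"
        using c'(3)[OF x True] l(2) by (simp add: field_simps)
      then have "(m1.cum x)\<^sup>2 \<le> (4 / cmod l * cmod (u1 x))\<^sup>2"
        using m1.cum_nonneg by (intro power_mono) auto
      then show ?thesis by (simp add: power_mult_distrib power_divide add_increasing)
    next
      case False
      then have "m1.cum x \<le> m1.cum c'" using m1.cum_mono[of x c'] x c'(1) by (simp add: Ico0_nonneg)
      then have "(m1.cum x)\<^sup>2 \<le> (m1.cum c')\<^sup>2" using m1.cum_nonneg by (intro power_mono) auto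
      then show ?thesis by (simp add: add_increasing2)
    qed
    then show ?thesis by (simp add: ennreal_plus[symmetric] ennreal_mult[symmetric] ennreal_leI del: ennreal_plus)
  qed
  have u1m: "u1 \<in> borel_measurable M2" using u(2) by (simp add: sq_integrable_def)
  have "(\<integral>\<^sup>+x. ennreal ((cmod (complex_of_real (m1.cum x)))\<^sup>2) \<partial>M2)
      \<le> (\<integral>\<^sup>+x. ennreal ((m1.cum c')\<^sup>2) + ennreal ?k * ennreal ((cmod (u1 x))\<^sup>2) \<partial>M2)"
    by (rule nn_integral_mono[OF le])
  also have "\<dots> = ennreal ((m1.cum c')\<^sup>2) * emeasure M2 (space M2)
      + ennreal ?k * (\<integral>\<^sup>+x. ennreal ((cmod (u1 x))\<^sup>2) \<partial>M2)"
    using u1m by (simp add: nn_integral_add nn_integral_cmult)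
  also have "\<dots> < \<infinity>"
    using emeasure_finite_if_not_infinite[OF fin2] u(2)
    by (simp add: ennreal_mult_less_top sq_integrable_def)
  finally have "(\<lambda>x. complex_of_real (m1.cum x)) \<in> sq_integrable M2"
    using cum1_measurable by (simp add: sq_integrable_def)
  then show ?thesis using inf1 unfolding limit_circle_growth_def by blast
qed

text \<open>
  Green's formula for \<open>u\<close> and its conjugate contains \<open>\<integral> \<bar>u\<^sub>2\<bar>\<^sup>2\<close>. If this diverges, the real part of the
  boundary term exceeds \<open>1\<close> near the end, which contradicts one of the two statements on
  products; the case of a nonzero limit of \<open>u\<^sub>2\<close> is excluded by the growth assumption.
\<close>
theorem dirichlet_integral_finite:
  assumes u: "maximal_triple u1 u2 f"
    and singular: "m1.infinite_at_end \<or> m2.infinite_at_end"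
    and growth: "\<not> limit_circle_growth"
  shows "u2 \<in> sq_integrable M1"
proof (rule ccontr)
  assume no: "u2 \<notin> sq_integrable M1"
  have b: "0 < b" by (rule m1.b_pos)
  have p: "primitive b M1 u2 u1" "primitive b M2 (\<lambda>t. - f t) u2"
    and sq: "u1 \<in> sq_integrable M2" "f \<in> sq_integrable M2"
    using u by (auto simp: maximal_triple_def)
  have u2m: "u2 \<in> borel_measurable M1" by (rule primitive_at(3)[OF p(1)])
  let ?K = "\<lambda>x. cnj (u1 0) * u2 0 - (LINT t:{0..<x}|M2. cnj (u1 t) * f t)"
  let ?limK = "cnj (u1 0) * u2 0 - (LINT t|M2. cnj (u1 t) * f t)"
  have "((\<lambda>x. Re (?K x)) \<longlongrightarrow> Re ?limK) (to_end b)"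
    by (intro tendsto_intros m2.initial_integral_tendsto integrable_mult_sq_integrable sq_integrable_cnj sq)
  then have "\<forall>\<^sub>F x in to_end b. Re ?limK - 1 < Re (?K x)" by (intro order_tendstoD) auto
  then obtain c0 where c0: "c0 \<in> Ico0 b" "\<And>x. x \<in> Ico0 b \<Longrightarrow> c0 \<le> x \<Longrightarrow> Re ?limK - 1 < Re (?K x)"
    unfolding eventually_to_end[OF b] by blast
  let ?B = "max 0 (2 - Re ?limK)"
  have "\<exists>c1\<in>Ico0 b. ennreal ?B < energy M1 {0..<c1} u2"
  proof (rule ccontr)
    assume n: "\<not> ?thesis"
    have "(\<integral>\<^sup>+t. ennreal ((cmod (u2 t))\<^sup>2) \<partial>M1) \<le> ennreal ?B"
      by (rule m1.energy_le_if_initial[OF u2m]) (use n in \<open>meson not_less\<close>)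
    also have "\<dots> < \<infinity>" by simp
    finally have "u2 \<in> sq_integrable M1" using u2m unfolding sq_integrable_def by blast
    then show False using no by blast
  qed
  then obtain c1 where c1: "c1 \<in> Ico0 b" "ennreal ?B < energy M1 {0..<c1} u2" by blast
  have ge: "1 \<le> cmod (u1 x * u2 x)" if x: "x \<in> Ico0 b" "max c0 c1 \<le> x" for x
  proof -
    obtain r where r: "0 \<le> r" "(LINT t:{0..<x}|M1. u2 t * cnj (u2 t)) = complex_of_real r"
      "energy M1 {0..<x} u2 = ennreal r"
      using set_integral_mult_cnj[OF product_rule(2)[OF primitive_cnj[OF p(1)] p(2) x(1)]] by blast
    have "ennreal ?B < ennreal r"
      using c1(2) energy_mono[of "{0..<c1}" "{0..<x}" M1 u2] x(2) unfolding r(3)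
      by (auto intro: less_le_trans)
    then have "?B < r" by (simp add: ennreal_less_iff)
    moreover have "cnj (u1 x) * u2 x = ?K x + complex_of_real r"
      using green_formula[OF primitive_cnj[OF p(1)] p(2) x(1)] r(2) by simp
    ultimately have "1 \<le> Re (cnj (u1 x) * u2 x)" using c0(2)[OF x(1)] x(2) by simp
    also have "\<dots> \<le> cmod (cnj (u1 x) * u2 x)" by (rule complex_Re_le_cmod)
    finally show ?thesis by (simp add: norm_mult)
  qed
  have ev: "\<forall>\<^sub>F x in to_end b. 1 \<le> cmod (u1 x * u2 x)"
    unfolding eventually_to_end[OF b] using ge max_in_Ico0[OF c0(1) c1(1)] by blast
  have e: "energy M2 UNIV (\<lambda>t. - f t) < \<infinity>" "energy M2 UNIV u1 < \<infinity>" "u1 \<in> borel_measurable M2"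
    using sq by (auto simp: sq_integrable_iff_energy energy_def)
  show False
  proof (cases m2.infinite_at_end)
    case True
    then show False using m2.product_small_if_infinite[OF p(2) e(1) e(3) e(2), of 1] ev by simp
  next
    case False
    then have inf1: m1.infinite_at_end using singular by blast
    have "integrable M2 (\<lambda>t. - f t)"
      using integrable_if_not_infinite[OF False sq(2)] by simp
    then have "((\<lambda>x. u2 0 + (LINT t:{0..<x}|M2. - f t)) \<longlongrightarrow> u2 0 + (LINT t|M2. - f t)) (to_end b)"
      by (intro tendsto_intros m2.initial_integral_tendsto)
    moreover have "\<forall>\<^sub>F x in to_end b. u2 x = u2 0 + (LINT t:{0..<x}|M2. - f t)"
      unfolding eventually_to_end[OF b] using primitive_at(1)[OF p(2)] zero_in_Ico0[OF b] by blast
    ultimately obtain l where l: "(u2 \<longlongrightarrow> l) (to_end b)" by (auto simp: tendsto_cong)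
    show False
    proof (cases "l = 0")
      case True
      then show False
        using m2.product_small_if_vanishing[OF p(2) e(1) _ e(3) e(2) False, of 1] l ev by simp
    next
      case nz: False
      then show False
        using limit_circle_growth_if_nonzero_limit[OF p(1) sq(1) l nz inf1 False] growth by blast
    qed
  qed
qed

lemma limit_circle_growth_triple:
  assumes limit_circle_growth
  shows "maximal_triple (\<lambda>x. complex_of_real (m1.cum x)) (\<lambda>_. 1) (\<lambda>_. 0)"
  unfolding maximal_triple_def
proof (intro conjI)
  show "primitive b M1 (\<lambda>_. 1) (\<lambda>x. complex_of_real (m1.cum x))"
    unfolding primitive_def
  proof (intro conjI ballI)
    fix x assume x: "x \<in> Ico0 b"
    have S: "{0..<x} \<in> sets M1" "emeasure M1 {0..<x} \<noteq> \<infinity>"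
      using m1.sets_Ico m1.finite_initial x by (auto simp: less_top)
    then show "set_integrable M1 {0..<x} (\<lambda>_. 1 :: complex)"
      unfolding set_integrable_def by (intro integrable_scaleR_left integrable_real_indicator) (auto simp: less_top)
    have "(LINT t:{0..<x}|M1. 1) = complex_of_real (m1.cum x)"
      unfolding set_lebesgue_integral_def using S
      by (subst integral_scaleR_left) (auto simp: less_top scaleR_conv_of_real m1.cum_def)
    then show "complex_of_real (m1.cum x) = complex_of_real (m1.cum 0) + (LINT t:{0..<x}|M1. 1)"
      by (simp add: m1.cum_def)
  qed simp
  show "primitive b M2 (\<lambda>t. - 0) (\<lambda>_. 1)"
    by (simp add: primitive_def set_integrable_def)
qed (use assms in \<open>simp_all add: limit_circle_growth_def sq_integrable_zero\<close>)

end

section \<open>Square integrable solutions\<close>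

context initial_finite_pair
begin

definition sq_solutions :: "complex \<Rightarrow> (real \<Rightarrow> complex) set" where
  "sq_solutions z = {u1 \<in> sq_integrable M2. \<exists>u2. solution z u1 u2}"

text \<open>
  Linear independence of the classes of \<open>1\<close> and \<open>cum\<close>: the solutions for \<open>\<lambda> = 0\<close> are determined by
  their first components almost everywhere.
\<close>
definition cum_independent :: bool where
  "cum_independent \<longleftrightarrow>
     (\<forall>\<alpha> \<beta>. (AE x in M2. \<alpha> + \<beta> * complex_of_real (m1.cum x) = 0) \<longrightarrow> \<alpha> = 0 \<and> \<beta> = 0)"

lemma solution_add:
  assumes "solution z u1 u2" "solution z v1 v2"
  shows "solution z (\<lambda>t. u1 t + v1 t) (\<lambda>t. u2 t + v2 t)"
proof -
  have "primitive b M2 (\<lambda>t. - (z * u1 t) + - (z * v1 t)) (\<lambda>t. u2 t + v2 t)"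
    using assms by (intro primitive_add) (auto simp: solution_def)
  moreover have "(\<lambda>t. - (z * u1 t) + - (z * v1 t)) = (\<lambda>t. - (z * (u1 t + v1 t)))"
    by (auto simp: algebra_simps)
  ultimately show ?thesis using assms primitive_add unfolding solution_def by auto
qed

lemma solution_cmult:
  assumes "solution z u1 u2"
  shows "solution z (\<lambda>t. c * u1 t) (\<lambda>t. c * u2 t)"
proof -
  have "primitive b M2 (\<lambda>t. c * - (z * u1 t)) (\<lambda>t. c * u2 t)"
    using assms by (intro primitive_cmult) (auto simp: solution_def)
  moreover have "(\<lambda>t. c * - (z * u1 t)) = (\<lambda>t. - (z * (c * u1 t)))" by (auto simp: algebra_simps)
  ultimately show ?thesis using assms primitive_cmult unfolding solution_def by auto
qed

lemma solution_combine:
  assumes "solution z u1 u2" "solution z v1 v2"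
  shows "solution z (\<lambda>t. c * u1 t + d * v1 t) (\<lambda>t. c * u2 t + d * v2 t)"
  by (intro solution_add solution_cmult assms)

lemma solution_measurable:
  assumes "solution z u1 u2"
  shows "u1 \<in> borel_measurable M1" "u1 \<in> borel_measurable M2"
  using m1.primitive_measurable assms unfolding measurable_12[symmetric] solution_def by blast+

lemma maximal_triple_solution:
  assumes "solution z u1 u2" "u1 \<in> sq_integrable M2"
  shows "maximal_triple u1 u2 (\<lambda>t. z * u1 t)"
  using assms sq_integrable_cmult by (auto simp: maximal_triple_def solution_def)

lemma sq_solutions_closed:
  "(\<lambda>_. 0) \<in> sq_solutions z"
  "u \<in> sq_solutions z \<Longrightarrow> v \<in> sq_solutions z \<Longrightarrow> (\<lambda>x. u x + v x) \<in> sq_solutions z"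
  "u \<in> sq_solutions z \<Longrightarrow> (\<lambda>x. c * u x) \<in> sq_solutions z"
proof -
  have "solution z (\<lambda>_. 0) (\<lambda>_. 0)"
    by (simp add: solution_def primitive_def set_integrable_def)
  then show "(\<lambda>_. 0) \<in> sq_solutions z"
    unfolding sq_solutions_def using sq_integrable_zero by blast
  show "u \<in> sq_solutions z \<Longrightarrow> v \<in> sq_solutions z \<Longrightarrow> (\<lambda>x. u x + v x) \<in> sq_solutions z"
    unfolding sq_solutions_def using sq_integrable_add solution_add by blast
  show "u \<in> sq_solutions z \<Longrightarrow> (\<lambda>x. c * u x) \<in> sq_solutions z"
    unfolding sq_solutions_def using sq_integrable_cmult solution_cmult by blast
qed

text \<open>
  If \<open>u\<^sub>1\<close> vanishes almost everywhere, then \<open>u\<^sub>2\<close> is constant and \<open>u\<^sub>1\<close> is a linear combination of \<open>1\<close>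
  and \<open>cum\<close>. Hence nontrivial solutions have nonzero classes.
\<close>
lemma solution_zero_imp_initial_zero:
  assumes s: "solution z u1 u2" and z: "AE t in M2. u1 t = 0" and ind: cum_independent
  shows "u1 0 = 0 \<and> u2 0 = 0"
proof -
  have p: "primitive b M1 u2 u1" and p2: "primitive b M2 (\<lambda>t. - (z * u1 t)) u2"
    using s by (auto simp: solution_def)
  have "primitive b M2 (\<lambda>_. 0) u2"
    by (rule m2.primitive_cong_AE[OF p2]) (use z in auto)
  then have u2: "u2 x = u2 0" if "x \<in> Ico0 b" for x
    using primitive_at(1)[of b M2 "\<lambda>_. 0" u2 x] that by simp
  have u1: "u1 x = u1 0 + u2 0 * complex_of_real (m1.cum x)" if x: "x \<in> Ico0 b" for x
  proof -
    have S: "{0..<x} \<in> sets M1" "emeasure M1 {0..<x} \<noteq> \<infinity>"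
      using m1.sets_Ico m1.finite_initial x by (auto simp: less_top)
    have "(LINT t:{0..<x}|M1. u2 t) = (LINT t:{0..<x}|M1. u2 0)"
    proof (rule set_lebesgue_integral_cong[OF S(1)], intro allI impI)
      fix t assume "t \<in> {0..<x}"
      then show "u2 t = u2 0" using x by (intro u2) (auto intro: Ico0_downward)
    qed
    also have "\<dots> = u2 0 * complex_of_real (m1.cum x)"
      unfolding set_lebesgue_integral_def using S
      by (subst integral_scaleR_left) (auto simp: less_top scaleR_conv_of_real m1.cum_def)
    finally show ?thesis using primitive_at(1)[OF p x] by simp
  qed
  have "AE x in M2. u1 0 + u2 0 * complex_of_real (m1.cum x) = 0"
    using z AE_space
  proof eventually_elim
    case (elim x)
    then show ?case using u1[of x] by (simp add: m2.space_M)
  qed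
  then show ?thesis using ind unfolding cum_independent_def by blast
qed

text \<open>
  The imaginary part of Green's formula for \<open>u\<close> and its conjugate: the Dirichlet integral is real and
  drops out.
\<close>
lemma solution_energy:
  assumes s: "solution z u1 u2" and x: "x \<in> Ico0 b"
  obtains r where "0 \<le> r" "energy M2 {0..<x} u1 = ennreal r"
    "Im (cnj (u1 x) * u2 x) = Im (cnj (u1 0) * u2 0) - Im z * r"
proof -
  have p: "primitive b M1 u2 u1" and p2: "primitive b M2 (\<lambda>t. - (z * u1 t)) u2"
    using s by (auto simp: solution_def)
  have lb: "locally_bounded b u1" "locally_bounded b (\<lambda>t. cnj (u1 t))"
    using m1.primitive_locally_bounded[OF p] m1.primitive_locally_bounded[OF primitive_cnj[OF p]] by auto
  obtain C where C: "\<And>t. t \<in> {0..<x} \<Longrightarrow> cmod (u1 t) \<le> C"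
    using lb(1) x unfolding locally_bounded_def by (meson atLeastAtMost_iff atLeastLessThan_iff less_imp_le)
  have m: "(\<lambda>t. cnj (u1 t)) \<in> borel_measurable M2"
    using m1.primitive_measurable[OF primitive_cnj[OF p]] unfolding measurable_12 .
  have i: "set_integrable M2 {0..<x} (\<lambda>t. u1 t * cnj (u1 t))"
    by (rule m2.set_integrable_mult_bounded[OF solution_measurable(2)[OF s]
          m2.set_integrable_locally_bounded[OF m lb(2) x] C])
  obtain r2 where r2: "0 \<le> r2" "(LINT t:{0..<x}|M2. u1 t * cnj (u1 t)) = complex_of_real r2"
    "energy M2 {0..<x} u1 = ennreal r2"
    using set_integral_mult_cnj[OF i] by blast
  obtain r1 where r1: "(LINT t:{0..<x}|M1. u2 t * cnj (u2 t)) = complex_of_real r1"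
    using set_integral_mult_cnj[OF product_rule(2)[OF primitive_cnj[OF p] p2 x]] by blast
  have "(LINT t:{0..<x}|M2. cnj (u1 t) * (z * u1 t)) = (LINT t:{0..<x}|M2. z * (u1 t * cnj (u1 t)))"
    by (simp only: ac_simps)
  also have "\<dots> = z * complex_of_real r2" using r2(2) by simp
  finally have "cnj (u1 x) * u2 x = cnj (u1 0) * u2 0 - z * complex_of_real r2 + complex_of_real r1"
    using green_formula[OF primitive_cnj[OF p] p2 x] r1 by simp
  then have "Im (cnj (u1 x) * u2 x) = Im (cnj (u1 0) * u2 0) - Im z * r2"
    by (simp only: plus_complex.sel minus_complex.sel) simp
  then show ?thesis using that r2 by blast
qed

text \<open>
  With \<open>u\<^sub>2(0) = 0\<close> the quantity \<open>\<bar>Im z\<bar> \<integral>\<^bsub>[0,x)\<^esub> \<bar>u\<^sub>1\<bar>\<^sup>2\<close> equals the modulus of a boundary term at \<open>x\<close>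
  that tends to \<open>0\<close>, although it is nondecreasing in \<open>x\<close>.
\<close>
lemma solution_vanishes:
  assumes s: "solution z u1 u2" and z: "Im z \<noteq> 0" and u20: "u2 0 = 0"
    and lim: "((\<lambda>x. u1 x * u2 x) \<longlongrightarrow> 0) (to_end b)"
  shows "AE t in M2. u1 t = 0"
proof -
  have b: "0 < b" by (rule m1.b_pos)
  have "((\<lambda>x. cmod (u1 x * u2 x)) \<longlongrightarrow> 0) (to_end b)" using lim by (rule tendsto_norm_zero)
  then have "((\<lambda>x. cmod (cnj (u1 x) * u2 x)) \<longlongrightarrow> 0) (to_end b)" by (simp add: norm_mult)
  then have "((\<lambda>x. cnj (u1 x) * u2 x) \<longlongrightarrow> 0) (to_end b)" by (rule tendsto_norm_zero_cancel)
  then have im: "((\<lambda>x. Im (cnj (u1 x) * u2 x)) \<longlongrightarrow> 0) (to_end b)"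
    using tendsto_Im by fastforce
  have "energy M2 {0..<x} u1 = 0" if x: "x \<in> Ico0 b" for x
  proof -
    obtain r where r: "0 \<le> r" "energy M2 {0..<x} u1 = ennreal r"
      using solution_energy[OF s x] by blast
    have "\<bar>Im z\<bar> * r \<le> 0"
    proof (rule tendsto_lowerbound)
      show "((\<lambda>y. \<bar>Im (cnj (u1 y) * u2 y)\<bar>) \<longlongrightarrow> 0) (to_end b)"
        using tendsto_rabs[OF im] by simp
      have "\<bar>Im z\<bar> * r \<le> \<bar>Im (cnj (u1 y) * u2 y)\<bar>" if y: "y \<in> Ico0 b" "x \<le> y" for y
      proof -
        obtain q where q: "0 \<le> q" "energy M2 {0..<y} u1 = ennreal q"
          "Im (cnj (u1 y) * u2 y) = - (Im z * q)"
          using solution_energy[OF s y(1)] u20 by auto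
        have "ennreal r \<le> ennreal q" using energy_mono[of "{0..<x}" "{0..<y}" M2 u1] y(2) r(2) q(2) by auto
        then have "r \<le> q" using q(1) by simp
        then show ?thesis using q by (simp add: abs_mult mult_left_mono)
      qed
      then show "\<forall>\<^sub>F y in to_end b. \<bar>Im z\<bar> * r \<le> \<bar>Im (cnj (u1 y) * u2 y)\<bar>"
        unfolding eventually_to_end[OF b] using x by blast
      show "to_end b \<noteq> bot" by (rule to_end_nontrivial[OF b])
    qed
    then have "r = 0" using z r(1) by (simp add: mult_le_0_iff)
    then show ?thesis using r by simp
  qed
  moreover have [measurable]: "u1 \<in> borel_measurable M2" by (rule solution_measurable(2)[OF s])
  ultimately have "(\<integral>\<^sup>+t. ennreal ((cmod (u1 t))\<^sup>2) \<partial>M2) \<le> 0"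
    by (intro m2.energy_le_if_initial) auto
  then have "AE t in M2. ennreal ((cmod (u1 t))\<^sup>2) = 0"
    by (subst nn_integral_0_iff_AE[symmetric]) auto
  then show ?thesis by eventually_elim simp
qed

text \<open>
  The combination with vanishing second component at \<open>0\<close> is \<open>0\<close>. In particular the square integrable
  solutions form an at most one-dimensional space of classes.
\<close>
lemma sq_solutions_proportional:
  assumes u: "solution z u1 u2" "u1 \<in> sq_integrable M2"
    and v: "solution z v1 v2" "v1 \<in> sq_integrable M2"
    and z: "Im z \<noteq> 0"
    and singular: "m1.infinite_at_end \<or> m2.infinite_at_end"
    and growth: "\<not> limit_circle_growth"
  shows "AE t in M2. v2 0 * u1 t = u2 0 * v1 t"
proof -
  let ?w1 = "\<lambda>t. v2 0 * u1 t + (- u2 0) * v1 t" and ?w2 = "\<lambda>t. v2 0 * u2 t + (- u2 0) * v2 t"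
  have s: "solution z ?w1 ?w2" by (rule solution_combine[OF u(1) v(1)])
  have "?w1 \<in> sq_integrable M2" by (intro sq_integrable_add sq_integrable_cmult u v)
  then have t: "maximal_triple ?w1 ?w2 (\<lambda>t. z * ?w1 t)" by (rule maximal_triple_solution[OF s])
  have d: "?w2 \<in> sq_integrable M1" by (rule dirichlet_integral_finite[OF t singular growth])
  have "AE t in M2. ?w1 t = 0"
    by (rule solution_vanishes[OF s z _ product_tendsto_0[OF t d t d singular]]) simp
  then show ?thesis by eventually_elim simp
qed

text \<open>
  Weyl's limit point construction in terms of initial data. For each \<open>x\<close> some solution with initial
  data \<open>p(x)\<close> of norm \<open>1\<close> has \<open>u\<^sub>2(x) = 0\<close>, and the boundary term at \<open>x\<close> disappears from
  \<open>solution_energy\<close>: \<open>\<bar>Im z\<bar> \<integral>\<^bsub>[0,x)\<^esub> \<bar>u\<^sub>1\<bar>\<^sup>2 \<le> 1\<close>. By compactness of the sphere the data converge along a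
  sequence approaching the end, and Fatou's lemma carries the bound over to the limit.
\<close>
theorem weyl_solution_exists:
  assumes z: "Im z \<noteq> 0"
  obtains u1 u2 where "solution z u1 u2" "u1 \<in> sq_integrable M2" "(u1 0, u2 0) \<noteq> (0, 0)"
proof -
  have b: "0 < b" by (rule m1.b_pos)
  obtain f1 f2 where f: "solution z f1 f2" "f1 0 = 1" "f2 0 = 0" using solution_exists by blast
  obtain g1 g2 where g: "solution z g1 g2" "g1 0 = 0" "g2 0 = 1" using solution_exists by blast
  obtain X where X: "incseq X" "\<And>n. X n \<in> Ico0 b"
    "\<And>x. x \<in> Ico0 b \<Longrightarrow> eventually (\<lambda>n. x < X n) sequentially"
    using Ico0_sequence[OF b] by blast
  \<comment> \<open>One linear condition on two coefficients always has a normalized solution.\<close>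
  have "\<exists>p. p \<in> sphere 0 1 \<and> fst p * f2 x + snd p * g2 x = 0" for x
  proof -
    obtain q :: "complex \<times> complex" where q: "q \<noteq> 0" "fst q * f2 x + snd q * g2 x = 0"
    proof (cases "(g2 x, - f2 x) = 0")
      case True
      then have "g2 x = 0" "f2 x = 0" by (auto simp: zero_prod_def)
      then show ?thesis using that[of "(1, 0)"] by (simp add: zero_prod_def)
    next
      case False
      then show ?thesis using that[of "(g2 x, - f2 x)"] by simp
    qed
    have "fst (sgn q) * f2 x + snd (sgn q) * g2 x = inverse (norm q) *\<^sub>R (fst q * f2 x + snd q * g2 x)"
      by (simp add: sgn_div_norm scaleR_add_right)
    moreover have "sgn q \<in> sphere 0 1" using q(1) by (simp add: norm_sgn)
    ultimately show ?thesis using q(2) by (intro exI[of _ "sgn q"]) simp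
  qed
  then obtain p where p: "\<And>x. p x \<in> sphere 0 1" "\<And>x. fst (p x) * f2 x + snd (p x) * g2 x = 0"
    by metis
  obtain l r where l: "l \<in> sphere 0 (1 :: real)" and r: "strict_mono r" "((\<lambda>n. p (X n)) \<circ> r) \<longlonglongrightarrow> l"
    using compact_sphere[of "0 :: complex \<times> complex" 1] p(1) unfolding compact_def by metis
  define Y where "Y n = X (r n)" for n
  define u where "u q t = fst q * f1 t + snd q * g1 t" for q t
  let ?w2 = "\<lambda>q t. fst q * f2 t + snd q * g2 t"
  have s: "solution z (u q) (?w2 q)" for q
    using solution_combine[OF f(1) g(1)] unfolding u_def by blast
  have m [measurable]: "u q \<in> borel_measurable M2" for q by (rule solution_measurable(2)[OF s])
  have bound: "energy M2 {0..<Y n} (u (p (Y n))) \<le> ennreal (1 / \<bar>Im z\<bar>)" for n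
  proof -
    let ?q = "p (Y n)"
    have Y: "Y n \<in> Ico0 b" using X(2) by (simp add: Y_def)
    obtain e where e: "0 \<le> e" "energy M2 {0..<Y n} (u ?q) = ennreal e"
      "Im (cnj (u ?q (Y n)) * ?w2 ?q (Y n)) = Im (cnj (u ?q 0) * ?w2 ?q 0) - Im z * e"
      using solution_energy[OF s Y] by blast
    have "Im z * e = Im (cnj (fst ?q) * snd ?q)"
      using e(3) p(2)[of "Y n"] f g by (simp add: u_def)
    then have "\<bar>Im z\<bar> * e = \<bar>Im (cnj (fst ?q) * snd ?q)\<bar>"
      using e(1) by (metis abs_mult abs_of_nonneg)
    also have "\<dots> \<le> cmod (cnj (fst ?q) * snd ?q)" by (rule abs_Im_le_cmod)
    also have "\<dots> = cmod (fst ?q) * cmod (snd ?q)" by (simp add: norm_mult)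
    also have "\<dots> \<le> 1 * 1"
      using norm_fst_le[of "fst ?q" "snd ?q"] norm_snd_le[of "snd ?q" "fst ?q"] p(1)[of "Y n"]
      by (intro mult_mono) auto
    finally have "e \<le> 1 / \<bar>Im z\<bar>" using z by (simp add: field_simps)
    then show ?thesis using e(2) by (simp add: ennreal_leI)
  qed
  have conv: "(\<lambda>n. ennreal ((cmod (u (p (Y n)) t))\<^sup>2) * indicator {0..<Y n} t) \<longlonglongrightarrow> ennreal ((cmod (u l t))\<^sup>2)"
    if t: "t \<in> space M2" for t
  proof -
    have t: "t \<in> Ico0 b" using that by (simp add: m2.space_M)
    have "(\<lambda>n. p (Y n)) \<longlonglongrightarrow> l" using r(2) by (simp add: Y_def comp_def)
    then have "(\<lambda>n. ennreal ((cmod (u (p (Y n)) t))\<^sup>2)) \<longlonglongrightarrow> ennreal ((cmod (u l t))\<^sup>2)"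
      unfolding u_def by (intro tendsto_intros)
    moreover have "eventually (\<lambda>n. t < Y n) sequentially"
      using eventually_subseq[OF r(1) X(3)[OF t]] by (simp add: Y_def)
    then have "eventually (\<lambda>n. ennreal ((cmod (u (p (Y n)) t))\<^sup>2) * indicator {0..<Y n} t
        = ennreal ((cmod (u (p (Y n)) t))\<^sup>2)) sequentially"
      by eventually_elim (use t in \<open>simp add: Ico0_nonneg\<close>)
    ultimately show ?thesis by (simp add: tendsto_cong)
  qed
  have S [measurable]: "{0..<Y n} \<in> sets M2" for n using X(2) m2.sets_Ico by (simp add: Y_def)
  have "(\<integral>\<^sup>+t. ennreal ((cmod (u l t))\<^sup>2) \<partial>M2)
      = (\<integral>\<^sup>+t. liminf (\<lambda>n. ennreal ((cmod (u (p (Y n)) t))\<^sup>2) * indicator {0..<Y n} t) \<partial>M2)"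
    by (rule nn_integral_cong) (use lim_imp_Liminf[OF _ conv] in simp)
  also have "\<dots> \<le> liminf (\<lambda>n. \<integral>\<^sup>+t. ennreal ((cmod (u (p (Y n)) t))\<^sup>2) * indicator {0..<Y n} t \<partial>M2)"
    by (rule nn_integral_liminf) measurable
  also have "\<dots> \<le> liminf (\<lambda>n. ennreal (1 / \<bar>Im z\<bar>))"
    using bound unfolding energy_def by (intro Liminf_mono always_eventually) auto
  also have "\<dots> = ennreal (1 / \<bar>Im z\<bar>)" by (simp add: Liminf_const)
  finally have "(\<integral>\<^sup>+t. ennreal ((cmod (u l t))\<^sup>2) \<partial>M2) < \<infinity>" by (rule le_less_trans) simp
  then have sq: "u l \<in> sq_integrable M2" using m unfolding sq_integrable_def by blast
  have "(u l 0, ?w2 l 0) = l" using f g by (simp add: u_def)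
  moreover have "l \<noteq> (0, 0)" using l by (auto simp: zero_prod_def[symmetric])
  ultimately show ?thesis using that[OF s sq] by simp
qed

text \<open>
  Let \<open>E\<close> be the square integral of \<open>u\<^sub>1\<close> over \<open>[0,x)\<close>. Two applications of Cauchy--Schwarz give
  \<open>\<bar>u\<^sub>2\<bar>\<^sup>2 \<le> B\<close> and \<open>\<bar>u\<^sub>1\<bar>\<^sup>2 \<le> 2 \<bar>u\<^sub>1(0)\<bar>\<^sup>2 + 2 B cum\<^sup>2\<close> there with \<open>B = 2 \<bar>u\<^sub>2(0)\<bar>\<^sup>2 + 2 \<bar>z\<bar>\<^sup>2 m E\<close>, where \<open>m\<close>
  bounds the mass of the second measure. Integration yields \<open>E \<le> a + 4 \<bar>z\<bar>\<^sup>2 m A E\<close> with a bound \<open>A\<close> for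
  the square integral of \<open>cum\<close>. Since \<open>E\<close> is finite, it is at most \<open>2 a\<close> if \<open>\<bar>z\<bar>\<close> is small
  enough, whatever \<open>x\<close> is.
\<close>
lemma limit_circle_growth_all_sq:
  assumes g: limit_circle_growth
  obtains z where "Im z \<noteq> 0" "\<And>u1 u2. solution z u1 u2 \<Longrightarrow> u1 \<in> sq_integrable M2"
proof -
  have b: "0 < b" by (rule m1.b_pos)
  have inf: m1.infinite_at_end and sqc: "(\<lambda>x. complex_of_real (m1.cum x)) \<in> sq_integrable M2"
    using g by (auto simp: limit_circle_growth_def)
  obtain A where A: "0 < A" "\<And>S. energy M2 S (\<lambda>x. complex_of_real (m1.cum x)) \<le> ennreal A"
    using m2.energy_finite_real[of "\<lambda>x. complex_of_real (m1.cum x)"] sqc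
    by (auto simp: sq_integrable_iff_energy)
  have "\<forall>\<^sub>F x in to_end b. 1 < m1.cum x" by (rule m1.eventually_gt_cum[OF inf])
  then obtain c where c: "c \<in> Ico0 b" "\<And>x. x \<in> Ico0 b \<Longrightarrow> c \<le> x \<Longrightarrow> 1 < m1.cum x"
    unfolding eventually_to_end[OF b] by blast
  define m where "m = m2.cum c + A"
  have m0: "0 < m" using A(1) m2.cum_nonneg by (simp add: m_def add_nonneg_pos)
  have cum2: "m2.cum x \<le> m" if x: "x \<in> Ico0 b" for x
  proof (cases "c \<le> x")
    case True
    have c0: "0 \<le> c" using c(1) by (simp add: Ico0_nonneg)
    have "ennreal (m2.cum x - m2.cum c) = emeasure M2 {c..<x}"
      using m2.emeasure_Ico[OF c0 True x] by simp
    also have "\<dots> = (\<integral>\<^sup>+t. indicator {c..<x} t \<partial>M2)"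
      using m2.sets_Ico[OF c0 x] by simp
    also have "\<dots> \<le> energy M2 {c..<x} (\<lambda>x. complex_of_real (m1.cum x))"
      unfolding energy_def
    proof (rule nn_integral_mono)
      fix t assume "t \<in> space M2"
      then have t: "t \<in> Ico0 b" by (simp add: m2.space_M)
      show "indicator {c..<x} t \<le> ennreal ((cmod (complex_of_real (m1.cum t)))\<^sup>2) * indicator {c..<x} t"
      proof (cases "t \<in> {c..<x}")
        case True
        have "1 \<le> (m1.cum t)\<^sup>2" using c(2)[OF t] True by (simp add: one_le_power)
        then show ?thesis using True by (simp add: ennreal_leI)
      qed simp
    qed
    also have "\<dots> \<le> ennreal A" by (rule A(2))
    finally have "m2.cum x - m2.cum c \<le> A" using A(1) by simp
    then show ?thesis by (simp add: m_def)
  next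
    case False
    then show ?thesis using m2.cum_mono[of x c] x c(1) A(1) by (simp add: m_def Ico0_nonneg)
  qed
  \<comment> \<open>Chosen such that \<open>4 e\<^sup>2 m A \<le> 1/2\<close>, which makes the feedback term at most \<open>E/2\<close>.\<close>
  define e where "e = 1 / (1 + 8 * m * A)"
  have e: "0 < e" "8 * m * A * e\<^sup>2 \<le> 1"
  proof -
    have p: "0 < m * A" using m0 A(1) by simp
    then show "0 < e" by (simp add: e_def)
    have "8 * m * A * e \<le> 1" "e \<le> 1" using p by (auto simp: e_def field_simps)
    then have "8 * m * A * e * e \<le> 1 * 1" using \<open>0 < e\<close> p by (intro mult_mono) auto
    then show "8 * m * A * e\<^sup>2 \<le> 1" by (simp add: power2_eq_square mult.assoc)
  qed
  define z where "z = \<i> * complex_of_real e"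
  have cz: "cmod z = e" using e(1) by (simp add: z_def norm_mult)
  have "u1 \<in> sq_integrable M2" if s: "solution z u1 u2" for u1 u2
  proof -
    have p: "primitive b M1 u2 u1" and p2: "primitive b M2 (\<lambda>t. - (z * u1 t)) u2"
      using s by (auto simp: solution_def)
    have u1m [measurable]: "u1 \<in> borel_measurable M2" by (rule solution_measurable(2)[OF s])
    let ?a = "2 * (cmod (u1 0))\<^sup>2 * m + 4 * (cmod (u2 0))\<^sup>2 * A"
    have "energy M2 {0..<x} u1 \<le> ennreal (2 * ?a)" if x: "x \<in> Ico0 b" for x
    proof -
      have [measurable]: "{0..<x} \<in> sets M2" using x m2.sets_Ico by simp
      obtain E where E: "0 \<le> E" "energy M2 {0..<x} u1 = ennreal E"
        using solution_energy[OF s x] by blast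
      define B where "B = 2 * (cmod (u2 0))\<^sup>2 + 2 * e\<^sup>2 * m * E"
      have B0: "0 \<le> B" using E(1) m0 by (simp add: B_def)
      have u2: "(cmod (u2 t))\<^sup>2 \<le> B" if t: "0 \<le> t" "t < x" for t
      proof -
        have tI: "t \<in> Ico0 b" using t x Ico0_downward[of x b t] by auto
        have "energy M2 {0..<t} (\<lambda>t. - (z * u1 t)) = ennreal (e\<^sup>2) * energy M2 {0..<t} u1"
          using energy_cmult[OF u1m m2.sets_Ico[OF order_refl tI], of "- z"] cz by simp
        also have "\<dots> \<le> ennreal (e\<^sup>2) * ennreal E"
          using energy_mono[of "{0..<t}" "{0..<x}" M2 u1] E(2) t by (intro mult_left_mono) auto
        finally have 1: "energy M2 {0..<t} (\<lambda>t. - (z * u1 t)) \<le> ennreal (e\<^sup>2 * E)"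
          using E(1) by (simp add: ennreal_mult)
        have "ennreal ((cmod (u2 t - u2 0))\<^sup>2)
            \<le> energy M2 {0..<t} (\<lambda>t. - (z * u1 t)) * ennreal (m2.cum t - m2.cum 0)"
          by (rule m2.primitive_increment_sq_le[OF p2 _ t(1) tI]) simp
        also have "\<dots> \<le> ennreal (e\<^sup>2 * E) * ennreal m"
          using 1 cum2[OF tI] m2.cum_nonneg[of 0] by (intro mult_mono ennreal_leI) auto
        also have "\<dots> = ennreal (e\<^sup>2 * m * E)" using E(1) m0 by (simp add: ennreal_mult[symmetric] ac_simps)
        finally have "(cmod (u2 t - u2 0))\<^sup>2 \<le> e\<^sup>2 * m * E"
          using E(1) m0 by (subst (asm) ennreal_le_iff) auto
        then show ?thesis using cmod_add_sq_le[of "u2 0" "u2 t - u2 0"] by (simp add: B_def)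
      qed
      have u1: "(cmod (u1 t))\<^sup>2 \<le> 2 * (cmod (u1 0))\<^sup>2 + 2 * B * (m1.cum t)\<^sup>2" if t: "0 \<le> t" "t < x" for t
      proof -
        have tI: "t \<in> Ico0 b" using t x Ico0_downward[of x b t] by auto
        have "energy M1 {0..<t} u2 \<le> (\<integral>\<^sup>+s\<in>{0..<t}. ennreal B \<partial>M1)"
          unfolding energy_def
          by (rule nn_integral_mono) (use u2 t in \<open>auto simp: indicator_def intro!: ennreal_leI\<close>)
        also have "\<dots> = ennreal B * emeasure M1 {0..<t}"
          by (rule nn_integral_cmult_indicator[OF m1.sets_Ico[OF order_refl tI]])
        also have "\<dots> = ennreal (B * m1.cum t)"
          using m1.finite_initial[OF tI] B0 m1.cum_nonneg
          by (simp add: m1.cum_def emeasure_eq_ennreal_measure less_top ennreal_mult)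
        finally have 1: "energy M1 {0..<t} u2 \<le> ennreal (B * m1.cum t)" .
        have "ennreal ((cmod (u1 t - u1 0))\<^sup>2) \<le> energy M1 {0..<t} u2 * ennreal (m1.cum t - m1.cum 0)"
          by (rule m1.primitive_increment_sq_le[OF p _ t(1) tI]) simp
        also have "\<dots> \<le> ennreal (B * m1.cum t) * ennreal (m1.cum t)"
          using 1 m1.cum_nonneg[of 0] by (intro mult_mono ennreal_leI) auto
        also have "\<dots> = ennreal (B * (m1.cum t)\<^sup>2)"
          using B0 m1.cum_nonneg by (simp add: ennreal_mult[symmetric] power2_eq_square ac_simps)
        finally have "(cmod (u1 t - u1 0))\<^sup>2 \<le> B * (m1.cum t)\<^sup>2"
          using B0 by (subst (asm) ennreal_le_iff) auto
        then show ?thesis using cmod_add_sq_le[of "u1 0" "u1 t - u1 0"] by simp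
      qed
      let ?c = "\<lambda>t. complex_of_real (m1.cum t)"
      have cm [measurable]: "m1.cum \<in> borel_measurable M2" by (rule cum1_measurable)
      have "ennreal E \<le> (\<integral>\<^sup>+t. ennreal (2 * (cmod (u1 0))\<^sup>2) * indicator {0..<x} t
          + ennreal (2 * B) * (ennreal ((cmod (?c t))\<^sup>2) * indicator {0..<x} t) \<partial>M2)"
        unfolding E(2)[symmetric] energy_def
      proof (rule nn_integral_mono)
        fix t
        show "ennreal ((cmod (u1 t))\<^sup>2) * indicator {0..<x} t
          \<le> ennreal (2 * (cmod (u1 0))\<^sup>2) * indicator {0..<x} t
            + ennreal (2 * B) * (ennreal ((cmod (?c t))\<^sup>2) * indicator {0..<x} t)"
        proof (cases "t \<in> {0..<x}")
          case True
          then have "ennreal ((cmod (u1 t))\<^sup>2) \<le> ennreal (2 * (cmod (u1 0))\<^sup>2 + 2 * B * (m1.cum t)\<^sup>2)"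
            using u1[of t] by (intro ennreal_leI) auto
          also have "\<dots> = ennreal (2 * (cmod (u1 0))\<^sup>2) + ennreal (2 * B) * ennreal ((cmod (?c t))\<^sup>2)"
            using B0 by (subst ennreal_plus) (auto simp: ennreal_mult[symmetric])
          finally show ?thesis using True by simp
        qed simp
      qed
      also have "\<dots> = ennreal (2 * (cmod (u1 0))\<^sup>2) * emeasure M2 {0..<x} + ennreal (2 * B) * energy M2 {0..<x} ?c"
        unfolding energy_def by (simp add: nn_integral_add nn_integral_cmult nn_integral_cmult_indicator)
      also have "\<dots> \<le> ennreal (2 * (cmod (u1 0))\<^sup>2) * ennreal m + ennreal (2 * B) * ennreal A"
      proof (intro add_mono mult_left_mono A(2))
        have "emeasure M2 {0..<x} = ennreal (m2.cum x)"
          using m2.finite_initial[OF x] by (simp add: m2.cum_def emeasure_eq_ennreal_measure less_top)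
        then show "emeasure M2 {0..<x} \<le> ennreal m" using cum2[OF x] by (simp add: ennreal_leI)
      qed auto
      also have "\<dots> = ennreal (2 * (cmod (u1 0))\<^sup>2 * m + 2 * B * A)"
        using B0 m0 A(1) by (subst ennreal_plus) (auto simp: ennreal_mult[symmetric])
      finally have "E \<le> 2 * (cmod (u1 0))\<^sup>2 * m + 2 * B * A"
        using B0 m0 A(1) by (subst (asm) ennreal_le_iff) auto
      also have "\<dots> = ?a + (8 * m * A * e\<^sup>2) * E / 2" by (simp add: B_def algebra_simps)
      also have "\<dots> \<le> ?a + E / 2" using mult_right_mono[OF e(2) E(1)] by (simp add: ac_simps)
      finally have "E \<le> 2 * ?a" by simp
      then show ?thesis using E(2) by (simp add: ennreal_leI)
    qed
    then have "(\<integral>\<^sup>+t. ennreal ((cmod (u1 t))\<^sup>2) \<partial>M2) \<le> ennreal (2 * ?a)"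
      by (rule m2.energy_le_if_initial[OF u1m])
    also have "\<dots> < \<infinity>" by simp
    finally show ?thesis using u1m unfolding sq_integrable_def by blast
  qed
  moreover have "Im z \<noteq> 0" using e(1) by (simp add: z_def)
  ultimately show ?thesis using that by blast
qed

section \<open>The dimension of the space of square integrable solutions\<close>

lemma vectorspace_sq_solutions:
  "vectorspace class_ring ((L2 M2)\<lparr>carrier := L2_class M2 ` sq_solutions z\<rparr>)"
proof (rule vectorspace_L2_classes)
  show "sq_solutions z \<subseteq> sq_integrable M2" by (auto simp: sq_solutions_def)
qed (rule sq_solutions_closed; assumption)+

text \<open>
  Weyl's solution spans the space: its second component does not vanish at \<open>0\<close>, since otherwise
  the solution itself would vanish, so every other square integrable solution is a multiple of it.
\<close>
lemma has_dim_1_if_not_growth: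
  assumes z: "Im z \<noteq> 0" and singular: "m1.infinite_at_end \<or> m2.infinite_at_end"
    and growth: "\<not> limit_circle_growth" and ind: cum_independent
  shows "has_dim (L2 M2) (L2_class M2 ` sq_solutions z) 1"
proof -
  let ?V = "(L2 M2)\<lparr>carrier := L2_class M2 ` sq_solutions z\<rparr>"
  interpret V: vectorspace class_ring ?V by (rule vectorspace_sq_solutions)
  obtain u1 u2 where u: "solution z u1 u2" "u1 \<in> sq_integrable M2" "(u1 0, u2 0) \<noteq> (0, 0)"
    using weyl_solution_exists[OF z] by blast
  have nz: "\<not> (AE t in M2. u1 t = 0)"
    using solution_zero_imp_initial_zero[OF u(1) _ ind] u(3) by auto
  have "u2 0 \<noteq> 0"
  proof
    assume "u2 0 = 0"
    note t = maximal_triple_solution[OF u(1,2)]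
    note d = dirichlet_integral_finite[OF t singular growth]
    show False
      using solution_vanishes[OF u(1) z \<open>u2 0 = 0\<close> product_tendsto_0[OF t d t d singular]] nz by blast
  qed
  have "V.fin_dim \<and> V.dim = 1"
  proof (rule V.dim1_if_multiples)
    show "L2_class M2 u1 \<in> carrier ?V" using u by (auto simp: sq_solutions_def)
    show "L2_class M2 u1 \<noteq> \<zero>\<^bsub>?V\<^esub>"
      using nz L2_class_eq_iff[OF u(2) sq_integrable_zero] by (simp add: zero_L2)
    fix w assume "w \<in> carrier ?V"
    then obtain v1 v2 where v: "solution z v1 v2" "v1 \<in> sq_integrable M2" "w = L2_class M2 v1"
      by (auto simp: sq_solutions_def)
    have "AE t in M2. v1 t = v2 0 / u2 0 * u1 t"
      using sq_solutions_proportional[OF u(1,2) v(1,2) z singular growth]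
      by eventually_elim (use \<open>u2 0 \<noteq> 0\<close> in \<open>simp add: field_simps\<close>)
    then have "w = (v2 0 / u2 0) \<odot>\<^bsub>L2 M2\<^esub> L2_class M2 u1"
      unfolding smult_L2_class[OF u(2)] v(3)
      by (subst L2_class_eq_iff[OF v(2) sq_integrable_cmult[OF u(2)]])
    then show "\<exists>a\<in>carrier class_ring. w = a \<odot>\<^bsub>?V\<^esub> L2_class M2 u1" by auto
  qed
  then show ?thesis unfolding has_dim_def .
qed

text \<open>
  The solutions with initial data \<open>(1,0)\<close> and \<open>(0,1)\<close> would be multiples of one function, hence
  linearly dependent.
\<close>
lemma not_has_dim_1_if_all_sq:
  assumes all: "\<And>u1 u2. solution z u1 u2 \<Longrightarrow> u1 \<in> sq_integrable M2" and ind: cum_independent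
  shows "\<not> has_dim (L2 M2) (L2_class M2 ` sq_solutions z) 1"
proof
  let ?V = "(L2 M2)\<lparr>carrier := L2_class M2 ` sq_solutions z\<rparr>"
  interpret V: vectorspace class_ring ?V by (rule vectorspace_sq_solutions)
  assume "has_dim (L2 M2) (L2_class M2 ` sq_solutions z) 1"
  then have d: "V.fin_dim" "V.dim = 1" unfolding has_dim_def by auto
  obtain v where v: "v \<in> carrier ?V" "\<And>w. w \<in> carrier ?V \<Longrightarrow> \<exists>a\<in>carrier class_ring. w = a \<odot>\<^bsub>?V\<^esub> v"
    using V.multiples_if_dim1[OF d] by blast
  obtain h where h: "h \<in> sq_solutions z" "v = L2_class M2 h" using v(1) by auto
  have hsq: "h \<in> sq_integrable M2" using h by (simp add: sq_solutions_def)
  have mult: "\<exists>a. AE t in M2. u1 t = a * h t" if s: "solution z u1 u2" for u1 u2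
  proof -
    have sq: "u1 \<in> sq_integrable M2" by (rule all[OF s])
    then have "L2_class M2 u1 \<in> carrier ?V" using s by (auto simp: sq_solutions_def)
    then obtain a where "L2_class M2 u1 = a \<odot>\<^bsub>L2 M2\<^esub> L2_class M2 h" using v(2) h(2) by fastforce
    then show ?thesis
      using smult_L2_class[OF hsq] L2_class_eq_iff[OF sq sq_integrable_cmult[OF hsq]] by auto
  qed
  obtain f1 f2 where f: "solution z f1 f2" "f1 0 = 1" "f2 0 = 0" using solution_exists by blast
  obtain g1 g2 where g: "solution z g1 g2" "g1 0 = 0" "g2 0 = 1" using solution_exists by blast
  obtain a c where a: "AE t in M2. f1 t = a * h t" and c: "AE t in M2. g1 t = c * h t"
    using mult[OF f(1)] mult[OF g(1)] by blast
  have "AE t in M2. c * f1 t + (- a) * g1 t = 0" using a c by eventually_elim simp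
  from solution_zero_imp_initial_zero[OF solution_combine[OF f(1) g(1)] this ind]
  have "a = 0" using f g by simp
  then have "AE t in M2. f1 t = 0" using a by simp
  from solution_zero_imp_initial_zero[OF f(1) this ind] show False using f by simp
qed

end

section \<open>Lebesgue--Stieltjes measures\<close>

context LS_function
begin

lemma initial_finite_LS_measure:
  assumes b: "0 < b"
  shows "initial_finite_measure b (LS_measure b R)"
proof
  show "emeasure (LS_measure b R) {0..<x} < \<infinity>" if "x \<in> Ico0 b" for x
    using that zero_in_Ico0[OF b] by (simp add: emeasure_LS_measure Ico0_nonneg)
  let ?G = "(\<lambda>(x, y). {x..<y}) ` {(x, y). x \<in> Ico0 b \<and> y \<in> Ico0 b \<and> x \<le> y}"
  have sub: "?G \<subseteq> Pow (Ico0 b)" using Ico_subset_Ico0 by fastforce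
  have sets: "sets (LS_measure b R) = sigma_sets (Ico0 b) ?G"
    unfolding LS_measure_def by (rule sets_extend_measure[OF sub])
  have "(\<lambda>x. x) \<in> borel_measurable (LS_measure b R)"
    unfolding borel_measurable_iff_less
  proof
    fix a
    show "{w \<in> space (LS_measure b R). w < a} \<in> sets (LS_measure b R)"
    proof (cases "a \<in> Ico0 b")
      case True
      then have "{w \<in> space (LS_measure b R). w < a} = {0..<a}"
        using Ico0_downward[of a b] by (auto simp: Ico0_nonneg)
      moreover have "{0..<a} \<in> ?G" using True zero_in_Ico0[OF b] by (force simp: Ico0_nonneg)
      ultimately show ?thesis unfolding sets by simp
    next
      case False
      then have "{w \<in> space (LS_measure b R). w < a} = (if a < 0 then {} else space (LS_measure b R))"
        by (auto simp: Ico0_def not_less dest: less_le_trans[of "ereal _" b "ereal a"])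
      then show ?thesis using sets.top[of "LS_measure b R"] by (simp split: if_splits)
    qed
  qed
  then have "A \<inter> Ico0 b \<in> sets (LS_measure b R)" if "A \<in> sets borel" for A
    using measurable_sets[of "\<lambda>x. x" "LS_measure b R" borel A] that by (simp add: vimage_def)
  moreover have "?G \<subseteq> sets (restrict_space borel (Ico0 b))"
  proof safe
    fix x y assume "x \<in> Ico0 b" "y \<in> Ico0 b"
    then have "{x..<y} = Ico0 b \<inter> {x..<y}" using Ico_subset_Ico0 by blast
    then show "{x..<y} \<in> sets (restrict_space borel (Ico0 b))"
      unfolding sets_restrict_space by (metis atLeastLessThan_borel imageI)
  qed
  then have "sigma_sets (Ico0 b) ?G \<subseteq> sets (restrict_space borel (Ico0 b))"
    using sets.sigma_sets_subset[of ?G "restrict_space borel (Ico0 b)"] by (simp add: space_restrict_space)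
  ultimately show "sets (LS_measure b R) = sets (restrict_space borel (Ico0 b))"
    using sets unfolding sets_restrict_space by (auto simp: Int_commute)
qed fact

lemma cum_LS_measure:
  assumes "x \<in> Ico0 b"
  shows "initial_finite_measure.cum (LS_measure b R) x = R x"
proof -
  have b: "0 < b" using assms unfolding Ico0_def by (auto intro: le_less_trans[of 0 "ereal x" b])
  interpret initial_finite_measure b "LS_measure b R" by (rule initial_finite_LS_measure[OF b])
  have "0 \<le> R x" using mono assms zero_in_Ico0[OF b] at_0 by (metis Ico0_nonneg mono_onD)
  then show ?thesis
    using emeasure_LS_measure[of 0 x] assms zero_in_Ico0[OF b] at_0
    by (simp add: cum_def Ico0_nonneg measure_def)
qed

lemma no_atom_if_continuous:
  assumes x: "x \<in> Ico0 b" and cont: "continuous (at x within Ico0 b) R"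
  shows "emeasure (LS_measure b R) {x} = 0"
proof -
  have b: "0 < b" using x unfolding Ico0_def by (auto intro: le_less_trans[of 0 "ereal x" b])
  interpret initial_finite_measure b "LS_measure b R" by (rule initial_finite_LS_measure[OF b])
  have "emeasure (LS_measure b R) {x} \<le> ennreal e" if e: "0 < e" for e
  proof -
    obtain d where d: "0 < d" "\<And>y. y \<in> Ico0 b \<Longrightarrow> dist y x < d \<Longrightarrow> dist (R y) (R x) < e"
      using cont e unfolding continuous_within_eps_delta by blast
    obtain y0 where y0: "y0 \<in> Ico0 b" "x < y0" using Ico0_larger[OF x] .
    define y where "y = min y0 (x + d / 2)"
    have y: "x < y" "y \<in> Ico0 b" "dist y x < d"
      using y0 d(1) x Ico0_downward[OF y0(1), of y] by (auto simp: y_def dist_real_def Ico0_nonneg)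
    have "emeasure (LS_measure b R) {x} \<le> emeasure (LS_measure b R) {x..<y}"
      using y x sets_Ico by (intro emeasure_mono) (auto simp: Ico0_nonneg)
    also have "\<dots> = ennreal (R y - R x)" using emeasure_LS_measure[OF x y(2)] y(1) by simp
    also have "\<dots> \<le> ennreal e" using d(2)[OF y(2,3)] by (intro ennreal_leI) (simp add: dist_real_def)
    finally show ?thesis .
  qed
  then show ?thesis using ennreal_le_epsilon[of 0 "emeasure (LS_measure b R) {x}"] by simp
qed

end

lemma (in initial_finite_measure) Ico0_in_sets:
  assumes "b0 \<le> b"
  shows "Ico0 b0 \<in> sets M"
proof -
  have "Ico0 b0 = {x. 0 \<le> x \<and> ereal x < b0}" by (simp add: Ico0_def)
  also have "\<dots> \<in> sets borel" by measurable
  finally show ?thesis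
    unfolding sets_M sets_restrict_space using assms
    by (intro image_eqI[of _ _ "Ico0 b0"]) (auto simp: Ico0_def)
qed

text \<open>
  The independence of \<open>1\<close> and \<open>R\<^sub>1\<close> is assumed on a shorter interval \<open>[0,b\<^sub>0)\<close>, with respect to the
  measure constructed there. This identifies that measure, so that null sets can be transferred.
\<close>
lemma (in LS_function) LS_measure_restrict:
  assumes b0: "0 < b0" "b0 \<le> b"
  shows "LS_measure b0 R = restrict_space (LS_measure b R) (Ico0 b0)"
proof -
  have sub: "Ico0 b0 \<subseteq> Ico0 b" using b0 by (auto simp: Ico0_def)
  have b: "0 < b" using b0 by simp
  interpret L0: LS_function b0 R
  proof
    show "mono_on (Ico0 b0) R" by (rule mono_on_subset[OF mono sub])
  qed (use sub left_cont at_0 in auto)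
  interpret m: initial_finite_measure b "LS_measure b R" by (rule initial_finite_LS_measure[OF b])
  interpret m0: initial_finite_measure b0 "LS_measure b0 R" by (rule L0.initial_finite_LS_measure[OF b0(1)])
  let ?M = "LS_measure b0 R" and ?N = "restrict_space (LS_measure b R) (Ico0 b0)"
  let ?E = "(\<lambda>(x, y). {x..<y}) ` {(x, y). x \<in> Ico0 b0 \<and> y \<in> Ico0 b0 \<and> x \<le> y}"
  have E: "?E \<subseteq> Pow (Ico0 b0)" using Ico_subset_Ico0 by fastforce
  have I: "Ico0 b0 \<in> sets (LS_measure b R)" by (rule m.Ico0_in_sets[OF b0(2)])
  obtain X where X: "incseq X" "\<And>n. X n \<in> Ico0 b0"
    "\<And>x. x \<in> Ico0 b0 \<Longrightarrow> eventually (\<lambda>n. x < X n) sequentially"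
    using Ico0_sequence[OF b0(1)] by blast
  show ?thesis
  proof (rule measure_eqI_generator_eq[of ?E "Ico0 b0" _ _ "\<lambda>n. {0..<X n}"])
    show "Int_stable ?E"
    proof (rule Int_stableI)
      fix S T assume "S \<in> ?E" "T \<in> ?E"
      then obtain x y x' y' where s: "S = {x..<y}" "x \<in> Ico0 b0" "y \<in> Ico0 b0" "x \<le> y"
        and t: "T = {x'..<y'}" "x' \<in> Ico0 b0" "y' \<in> Ico0 b0" "x' \<le> y'" by auto
      have "S \<inter> T = {max x x'..<max (max x x') (min y y')}" using s t by (auto simp: max_def min_def)
      moreover have "max x x' \<in> Ico0 b0" "max (max x x') (min y y') \<in> Ico0 b0"
        using s t by (auto simp: max_def min_def)
      ultimately show "S \<inter> T \<in> ?E" by force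
    qed
    show "sets ?M = sigma_sets (Ico0 b0) ?E"
      unfolding LS_measure_def by (rule sets_extend_measure[OF E])
    moreover have "sets ?N = sets ?M"
      unfolding m0.sets_M sets_restrict_space m.sets_M using sub by (auto simp: image_iff)
    ultimately show "sets ?N = sigma_sets (Ico0 b0) ?E" by simp
    show "emeasure ?M S = emeasure ?N S" if S: "S \<in> ?E" for S
    proof -
      obtain x y where s: "S = {x..<y}" "x \<in> Ico0 b0" "y \<in> Ico0 b0" "x \<le> y" using S by auto
      have "S \<subseteq> Ico0 b0" using S E by blast
      then have "emeasure ?N S = emeasure (LS_measure b R) S"
        using I by (intro emeasure_restrict_space) (auto simp: Int_absorb2[OF sub])
      then show ?thesis
        using s emeasure_LS_measure[OF subsetD[OF sub] subsetD[OF sub], of x y]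
          L0.emeasure_LS_measure[of x y] by simp
    qed
    show "range (\<lambda>n. {0..<X n}) \<subseteq> ?E"
      using X(2) zero_in_Ico0[OF b0(1)] by (force simp: Ico0_nonneg)
    show "(\<Union>n. {0..<X n}) = Ico0 b0"
    proof (intro equalityI subsetI)
      fix x assume "x \<in> (\<Union>n. {0..<X n})"
      then obtain n where "0 \<le> x" "x < X n" by auto
      then show "x \<in> Ico0 b0" using Ico0_downward[OF X(2), of x n] by simp
    next
      fix x assume x: "x \<in> Ico0 b0"
      obtain n where "x < X n" using X(3)[OF x] by (auto simp: eventually_sequentially)
      then show "x \<in> (\<Union>n. {0..<X n})" using x by (auto simp: Ico0_nonneg)
    qed
    show "emeasure ?M {0..<X n} \<noteq> \<infinity>" for n using m0.finite_initial[OF X(2)] by (simp add: less_top)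
  qed (rule E)
qed

lemma (in LS_function) end_value_finite:
  assumes b: "0 < b" and fin: "\<not> initial_finite_measure.infinite_at_end b (LS_measure b R)"
  shows "end_value b R < \<infinity>"
proof -
  interpret initial_finite_measure b "LS_measure b R" by (rule initial_finite_LS_measure[OF b])
  obtain B where "\<And>x. x \<in> Ico0 b \<Longrightarrow> cum x \<le> B"
    using fin unfolding infinite_at_end_def by (meson not_less)
  then obtain T where T: "(cum \<longlongrightarrow> T) (to_end b)"
    using bounded_cum_converges by blast
  have "\<forall>\<^sub>F x in to_end b. cum x = R x"
    unfolding eventually_to_end[OF b] using cum_LS_measure zero_in_Ico0[OF b] by blast
  then have "(R \<longlongrightarrow> T) (to_end b)" using T by (simp add: tendsto_cong)
  then have "((\<lambda>x. ereal (R x)) \<longlongrightarrow> ereal T) (to_end b)" by simp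
  then have "end_value b R = ereal T"
    unfolding end_value_def by (rule tendsto_Lim[OF to_end_nontrivial[OF b]])
  then show ?thesis by simp
qed

section \<open>Integral systems\<close>

lemma (in integral_system) initial_finite_pair_LS_measure:
  "initial_finite_pair b (LS_measure b R1) (LS_measure b R2)"
proof (intro initial_finite_pair.intro initial_finite_pair_axioms.intro)
  show "initial_finite_measure b (LS_measure b R1)" "initial_finite_measure b (LS_measure b R2)"
    using R1 R2 b_pos LS_function.initial_finite_LS_measure by auto
  show "emeasure (LS_measure b R1) {x} = 0 \<or> emeasure (LS_measure b R2) {x} = 0"
    if "x \<in> Ico0 b" for x
    using no_common_discontinuity[OF that] LS_function.no_atom_if_continuous[OF R1 that]
      LS_function.no_atom_if_continuous[OF R2 that] by blast
qed


context integral_system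
begin

sublocale S: initial_finite_pair b "LS_measure b R1" "LS_measure b R2"
  by (rule initial_finite_pair_LS_measure)

lemma cum_R1: "x \<in> Ico0 b \<Longrightarrow> S.m1.cum x = R1 x"
  using LS_function.cum_LS_measure[OF R1] by blast

lemma infinite_at_end_if_singular:
  assumes "singular_at_end b R1 R2"
  shows "S.m1.infinite_at_end \<or> S.m2.infinite_at_end"
  using assms LS_function.end_value_finite[OF R1 b_pos] LS_function.end_value_finite[OF R2 b_pos]
  unfolding singular_at_end_def regular_at_end_def by (auto simp: less_top[symmetric])

text \<open>
  A combination that vanishes almost everywhere on \<open>[0,b)\<close> vanishes almost everywhere on \<open>[0,b\<^sub>0)\<close>,
  where it represents the zero of \<open>L\<^sup>2\<close>.
\<close>
lemma cum_independent: "S.cum_independent"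
  unfolding S.cum_independent_def
proof (intro allI impI)
  fix \<alpha> \<beta> assume ae: "AE x in LS_measure b R2. \<alpha> + \<beta> * complex_of_real (S.m1.cum x) = 0"
  obtain b0 where b0: "0 < b0" "b0 \<le> b" and
    ind: "let M = LS_measure b0 R2; u = (\<lambda>_. 1); v = (\<lambda>x. complex_of_real (R1 x)) in
          u \<in> sq_integrable M \<and> v \<in> sq_integrable M \<and>
          (\<forall>\<alpha> \<beta>. \<alpha> \<odot>\<^bsub>L2 M\<^esub> L2_class M u \<oplus>\<^bsub>L2 M\<^esub> \<beta> \<odot>\<^bsub>L2 M\<^esub> L2_class M v = \<zero>\<^bsub>L2 M\<^esub> \<longrightarrow>
            \<alpha> = 0 \<and> \<beta> = 0)"
    using one_R1_independent by blast
  let ?M = "LS_measure b0 R2" and ?v = "\<lambda>x. complex_of_real (R1 x)"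
  have sq: "(\<lambda>_. 1) \<in> sq_integrable ?M" "?v \<in> sq_integrable ?M"
    using ind by (auto simp: Let_def)
  have sub: "Ico0 b0 \<subseteq> Ico0 b" using b0 by (auto simp: Ico0_def)
  have I: "Ico0 b0 \<in> sets (LS_measure b R2)" by (rule S.m2.Ico0_in_sets[OF b0(2)])
  have "AE x in LS_measure b R2. x \<in> Ico0 b0 \<longrightarrow> \<alpha> * 1 + \<beta> * ?v x = 0"
    using ae AE_space by eventually_elim (use cum_R1 in auto)
  then have "AE x in restrict_space (LS_measure b R2) (Ico0 b0). \<alpha> * 1 + \<beta> * ?v x = 0"
    using I by (subst AE_restrict_space_iff) (auto simp: Int_absorb2[OF sub])
  then have "AE x in ?M. \<alpha> * 1 + \<beta> * ?v x = 0"
    unfolding LS_function.LS_measure_restrict[OF R2 b0] .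
  moreover have "(\<lambda>x. \<alpha> * 1 + \<beta> * ?v x) \<in> sq_integrable ?M"
    by (intro sq_integrable_add sq_integrable_cmult sq)
  ultimately have "L2_class ?M (\<lambda>x. \<alpha> * 1 + \<beta> * ?v x) = \<zero>\<^bsub>L2 ?M\<^esub>"
    unfolding zero_L2 using L2_class_eq_iff[OF _ sq_integrable_zero] by blast
  then have "\<alpha> \<odot>\<^bsub>L2 ?M\<^esub> L2_class ?M (\<lambda>_. 1) \<oplus>\<^bsub>L2 ?M\<^esub> \<beta> \<odot>\<^bsub>L2 ?M\<^esub> L2_class ?M ?v = \<zero>\<^bsub>L2 ?M\<^esub>"
    by (subst smult_L2_class[OF sq(1)], subst smult_L2_class[OF sq(2)],
        subst add_L2_class[OF sq_integrable_cmult[OF sq(1)] sq_integrable_cmult[OF sq(2)]]) 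
  then show "\<alpha> = 0 \<and> \<beta> = 0" using ind unfolding Let_def by blast
qed

text \<open>
  Integrability comes for free: \<open>f\<close> is square integrable on sets of finite measure, and then \<open>u\<^sub>2\<close> is
  measurable and locally bounded.
\<close>
lemma triples_iff_maximal_triple: "(u1, u2, f) \<in> triples b R1 R2 \<longleftrightarrow> S.maximal_triple u1 u2 f"
proof
  assume t: "(u1, u2, f) \<in> triples b R1 R2"
  then have sq: "f \<in> sq_integrable (LS_measure b R2)" "u1 \<in> sq_integrable (LS_measure b R2)"
    and u1: "\<And>x. x \<in> Ico0 b \<Longrightarrow> u1 x = u1 0 + (LINT t:{0..<x}|LS_measure b R1. u2 t)"
    and u2: "\<And>x. x \<in> Ico0 b \<Longrightarrow> u2 x = u2 0 - (LINT t:{0..<x}|LS_measure b R2. f t)"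
    unfolding triples_def by blast+
  have fm: "f \<in> borel_measurable (LS_measure b R2)" using sq(1) by (simp add: sq_integrable_def)
  have fi: "set_integrable (LS_measure b R2) {0..<x} f" if x: "x \<in> Ico0 b" for x
  proof (rule set_integrable_if_energy_finite[OF fm])
    show "{0..<x} \<in> sets (LS_measure b R2)" using x S.m2.sets_Ico by simp
    show "energy (LS_measure b R2) {0..<x} f < \<infinity>"
      using sq(1) energy_mono[of "{0..<x}" UNIV "LS_measure b R2" f]
      unfolding sq_integrable_iff_energy by (auto intro: le_less_trans)
  qed (rule S.m2.finite_initial[OF x])
  have p2: "primitive b (LS_measure b R2) (\<lambda>t. - f t) u2"
    unfolding primitive_def
  proof (intro conjI ballI)
    show "(\<lambda>t. - f t) \<in> borel_measurable (LS_measure b R2)" using fm by simp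
    fix x assume x: "x \<in> Ico0 b"
    show "set_integrable (LS_measure b R2) {0..<x} (\<lambda>t. - f t)"
      using set_integrable_mult_right[of "- 1" "LS_measure b R2" "{0..<x}" f] fi[OF x] by simp
    show "u2 x = u2 0 + (LINT t:{0..<x}|LS_measure b R2. - f t)"
      using u2[OF x] set_integral_uminus[OF fi[OF x]] by simp
  qed
  have u2m: "u2 \<in> borel_measurable (LS_measure b R1)"
    using S.m2.primitive_measurable[OF p2] unfolding S.measurable_12 .
  have "primitive b (LS_measure b R1) u2 u1"
    unfolding primitive_def
  proof (intro conjI ballI u2m)
    fix x assume x: "x \<in> Ico0 b"
    show "set_integrable (LS_measure b R1) {0..<x} u2"
      by (rule S.m1.set_integrable_locally_bounded[OF u2m S.m2.primitive_locally_bounded[OF p2] x])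
    show "u1 x = u1 0 + (LINT t:{0..<x}|LS_measure b R1. u2 t)" by (rule u1[OF x])
  qed
  then show "S.maximal_triple u1 u2 f" using p2 sq unfolding S.maximal_triple_def by blast
next
  assume "S.maximal_triple u1 u2 f"
  then have p1: "primitive b (LS_measure b R1) u2 u1"
    and p2: "primitive b (LS_measure b R2) (\<lambda>t. - f t) u2"
    and sq: "u1 \<in> sq_integrable (LS_measure b R2)" "f \<in> sq_integrable (LS_measure b R2)"
    unfolding S.maximal_triple_def by blast+
  have "u2 x = u2 0 - (LINT t:{0..<x}|LS_measure b R2. f t)" if x: "x \<in> Ico0 b" for x
  proof -
    have "(LINT t:{0..<x}|LS_measure b R2. - f t) = - (LINT t:{0..<x}|LS_measure b R2. f t)"
      using set_integral_mult_right[of "LS_measure b R2" "{0..<x}" "- 1" f] by simp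
    then show ?thesis using primitive_at(1)[OF p2 x] by simp
  qed
  then show "(u1, u2, f) \<in> triples b R1 R2"
    unfolding triples_def using sq primitive_at(1)[OF p1] by blast
qed

text \<open>
  An element of the kernel comes from a triple in which \<open>f\<close> agrees with \<open>z u\<^sub>1\<close> almost everywhere only;
  replacing \<open>f\<close> by \<open>z u\<^sub>1\<close> does not affect the integrals.
\<close>
lemma ker_shift_T_max:
  "ker_shift (LS_measure b R2) (T_max b R1 R2) z = L2_class (LS_measure b R2) ` S.sq_solutions z"
proof (intro equalityI subsetI)
  let ?M = "LS_measure b R2"
  fix u assume "u \<in> ker_shift ?M (T_max b R1 R2) z"
  then obtain u1 u2 f where t: "S.maximal_triple u1 u2 f"
    and u: "u = L2_class ?M u1" and zu: "z \<odot>\<^bsub>L2 ?M\<^esub> u = L2_class ?M f"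
    unfolding ker_shift_def T_max_def triples_iff_maximal_triple by blast
  have sq: "u1 \<in> sq_integrable ?M" "f \<in> sq_integrable ?M" using t by (auto simp: S.maximal_triple_def)
  have "L2_class ?M (\<lambda>x. z * u1 x) = L2_class ?M f"
    using zu unfolding u smult_L2_class[OF sq(1)] .
  then have ae: "AE x in ?M. z * u1 x = f x"
    using L2_class_eq_iff[OF sq_integrable_cmult[OF sq(1)] sq(2)] by blast
  have "primitive b ?M (\<lambda>t. - (z * u1 t)) u2"
  proof (rule S.m2.primitive_cong_AE)
    show "primitive b ?M (\<lambda>t. - f t) u2" using t by (simp add: S.maximal_triple_def)
    show "(\<lambda>t. - (z * u1 t)) \<in> borel_measurable ?M" 
      using sq_integrable_cmult[OF sq(1), of "- z"] by (simp add: sq_integrable_def)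
    show "AE t in ?M. - f t = - (z * u1 t)" using ae by eventually_elim simp
  qed
  then have "S.solution z u1 u2" using t by (simp add: S.maximal_triple_def S.solution_def)
  then show "u \<in> L2_class ?M ` S.sq_solutions z" using u sq(1) unfolding S.sq_solutions_def by blast
next
  let ?M = "LS_measure b R2"
  fix u assume "u \<in> L2_class ?M ` S.sq_solutions z"
  then obtain u1 u2 where s: "S.solution z u1 u2" and sq: "u1 \<in> sq_integrable ?M" and u: "u = L2_class ?M u1"
    unfolding S.sq_solutions_def by blast
  have "(u, L2_class ?M (\<lambda>x. z * u1 x)) \<in> T_max b R1 R2"
    using S.maximal_triple_solution[OF s sq] u unfolding T_max_def triples_iff_maximal_triple by blast
  then show "u \<in> ker_shift ?M (T_max b R1 R2) z"
    unfolding ker_shift_def using u sq smult_L2_class[OF sq] by (simp add: carrier_L2)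
qed

lemma limit_point_iff:
  assumes "singular_at_end b R1 R2"
  shows "limit_point b R1 R2 \<longleftrightarrow> \<not> S.limit_circle_growth"
proof
  assume lp: "limit_point b R1 R2"
  show "\<not> S.limit_circle_growth"
  proof
    assume S.limit_circle_growth
    then obtain z where z: "Im z \<noteq> 0"
      "\<And>u1 u2. S.solution z u1 u2 \<Longrightarrow> u1 \<in> sq_integrable (LS_measure b R2)"
      using S.limit_circle_growth_all_sq by blast
    have "z \<notin> \<real>" using z(1) complex_is_Real_iff by blast
    moreover have "\<not> has_dim (L2 (LS_measure b R2)) (L2_class (LS_measure b R2) ` S.sq_solutions z) 1"
      by (rule S.not_has_dim_1_if_all_sq[OF _ cum_independent]) (rule z(2))
    ultimately show False using lp unfolding limit_point_def ker_shift_T_max by blast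
  qed
next
  assume "\<not> S.limit_circle_growth"
  then show "limit_point b R1 R2"
    unfolding limit_point_def ker_shift_T_max
    using S.has_dim_1_if_not_growth[OF _ infinite_at_end_if_singular[OF assms] _ cum_independent]
    by (simp add: complex_is_Real_iff)
qed

lemma Dirichlet_property_iff:
  "Dirichlet_property b R1 R2 \<longleftrightarrow>
     (\<forall>u1 u2 f. S.maximal_triple u1 u2 f \<longrightarrow> u2 \<in> sq_integrable (LS_measure b R1))"
proof -
  have "u2 \<in> borel_measurable (LS_measure b R1)" if "S.maximal_triple u1 u2 f" for u1 u2 f
    using that primitive_at(3) unfolding S.maximal_triple_def by blast
  then show ?thesis
    unfolding Dirichlet_property_def sq_integrable_def Ball_def split_paired_All prod.case
      triples_iff_maximal_triple by blast
qed

lemma Dirichlet_property_if_not_growth: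
  assumes "singular_at_end b R1 R2" "\<not> S.limit_circle_growth"
  shows "Dirichlet_property b R1 R2"
  unfolding Dirichlet_property_iff
  using S.dirichlet_integral_finite[OF _ infinite_at_end_if_singular[OF assms(1)] assms(2)] by blast

lemma strong_limit_point_if_Dirichlet_property:
  assumes "singular_at_end b R1 R2" "Dirichlet_property b R1 R2"
  shows "strong_limit_point b R1 R2"
  using S.product_tendsto_0[OF _ _ _ _ infinite_at_end_if_singular[OF assms(1)]] assms(2)
  unfolding strong_limit_point_def Dirichlet_property_iff
  by (auto simp: triples_iff_maximal_triple)

lemma strong_limit_point_diag_if_strong_limit_point:
  "strong_limit_point b R1 R2 \<Longrightarrow> strong_limit_point_diag b R1 R2"
  unfolding strong_limit_point_def strong_limit_point_diag_def by fastforce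

text \<open>For the triple \<open>(R\<^sub>1, 1, 0)\<close> the product is \<open>R\<^sub>1\<close>, which is unbounded.\<close>
lemma not_growth_if_strong_limit_point_diag:
  assumes "strong_limit_point_diag b R1 R2"
  shows "\<not> S.limit_circle_growth"
proof
  assume g: S.limit_circle_growth
  have "((\<lambda>x. complex_of_real (S.m1.cum x) * 1) \<longlongrightarrow> 0) (to_end b)"
    using assms S.limit_circle_growth_triple[OF g]
    unfolding strong_limit_point_diag_def triples_iff_maximal_triple[symmetric] by fastforce
  then have "\<forall>\<^sub>F x in to_end b. cmod (complex_of_real (S.m1.cum x) * 1) < 1"
    by (intro order_tendstoD(2)[OF tendsto_norm_zero]) auto
  moreover have "\<forall>\<^sub>F x in to_end b. 1 < S.m1.cum x"
    using g S.m1.eventually_gt_cum unfolding S.limit_circle_growth_def by blast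
  ultimately have "\<forall>\<^sub>F x in to_end b. False" by eventually_elim simp
  then show False using to_end_nontrivial[OF b_pos] by (simp add: trivial_limit_def)
qed

end

theorem theorem4p3:
  fixes b :: ereal and R1 R2 :: "real \<Rightarrow> real"
  assumes "integral_system b R1 R2"
    and "singular_at_end b R1 R2"
  shows "(limit_point b R1 R2 \<longleftrightarrow> Dirichlet_property b R1 R2) \<and>
         (Dirichlet_property b R1 R2 \<longleftrightarrow> strong_limit_point_diag b R1 R2) \<and>
         (strong_limit_point_diag b R1 R2 \<longleftrightarrow> strong_limit_point b R1 R2)"
proof -
  interpret integral_system b R1 R2 by fact
  note limit_point_iff[OF assms(2)]
    Dirichlet_property_if_not_growth[OF assms(2)]
    strong_limit_point_if_Dirichlet_property[OF assms(2)]
    strong_limit_point_diag_if_strong_limit_point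
    not_growth_if_strong_limit_point_diag
  then show ?thesis by blast
qed

end
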